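(* Let $X_n=\sum_{i=0}^\infty a_i\varepsilon_{n-i}$ be a linear process with i.i.d. real innovations $(\varepsilon_i)_{i\in\mathbb{Z}}$ and real coefficients $(a_i)_{i\ge 0}$, $a_0\neq 0$, the series being well defined, and suppose $X_n$ has a probability density function $f\in L^2(\mathbb{R})$. Let $\phi_\varepsilon(\lambda)=\mathbb{E}[e^{\iota\lambda\varepsilon_1}]$. Suppose that: (1) for some $\gamma\in(0,1]$, $\sum_{i=0}^\infty|a_i|^\gamma<\infty$; at least $M\ge 1$ of the coefficients $a_i$ are non-zero ($M$ an integer); and for some constant $\beta\ge\gamma$ the function $u\mapsto |u|^\beta\phi_\varepsilon(u)$ belongs to $L^1(\mathbb{R})\cap L^\infty(\mathbb{R})$; (2) the scaling function $\varphi$ and the mother wavelet $\psi$ both have compact support and are twice continuously differentiable, and $\psi$ has $\lceil M\beta\rceil$ vanishing moments; (3) the derivative of $\phi_\varepsilon$ has bounded modulus on $\mathbb{R}$; (4) in case $\gamma\in(1/2,1]$, there is a constant $c>0$ such that $\mathbb{E}|e^{\iota\lambda\varepsilon_1}-\phi_\varepsilon(\lambda)|^2\le c\,(|\lambda|^{2\gamma}\wedge 1)$ for all $\lambda\in\mathbb{R}$. Let $\hat f_n$ be the wavelet estimator of $f$ based on $X_1,\dots,X_n$ with truncation level $j_n=\left\lceil\frac{\log_2 n}{2M\beta+1}\right\rceil$. Then $$\mathbb{E}\int_{\mathbb{R}}\big[\hat f_n(x)-f(x)\big]^2dx=O\Big(n^{-\frac{2M\beta}{2M\beta+1}}\Bi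g).$$
   Context: $\iota$ is the imaginary unit, $a\wedge b=\min(a,b)$. The functions $\varphi,\psi$ are a real-valued scaling function and mother wavelet: with $\varphi_{jk}(x)=2^{j/2}\varphi(2^jx-k)$ and $\psi_{jk}(x)=2^{j/2}\psi(2^jx-k)$, $j,k\in\mathbb{Z}$, the family $\{\varphi_{0k}\}_{k\in\mathbb{Z}}\cup\{\psi_{jk}\}_{j\ge 0,k\in\mathbb{Z}}$ is an orthonormal basis of $L^2(\mathbb{R})$ arising from a multiresolution analysis. "$\psi$ has $m$ vanishing moments" means $\int_{\mathbb{R}}x^r\psi(x)\,dx=0$ for $r=0,\dots,m-1$. The wavelet estimator with truncation level $j_n$ is $$\hat f_n(x)=\sum_{k\in\mathbb{Z}}\hat\alpha_{0k}\varphi_{0k}(x)+\sum_{j=0}^{j_n}\sum_{k\in\mathbb{Z}}\hat\beta_{jk}\psi_{jk}(x),\qquad \hat\alpha_{0k}=\frac1n\sum_{i=1}^n\varphi_{0k}(X_i),\quad \hat\beta_{jk}=\frac1n\sum_{i=1}^n\psi_{jk}(X_i).$$ $b_n=O(d_n)$ means there is a constant $C$ with $b_n\le C d_n$ for all $n\in\mathbb{N}$. *)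

theory Defs
  imports "HOL-Probability.Probability"
begin

text \<open>
  \<open>L2\<close> consists of Borel functions rather than classes of functions modulo equality almost
  everywhere. Closed subsets in the sense of \<open>L2_closure\<close> are automatically saturated under
  almost-everywhere equality.
\<close>

definition L2 :: "(real \<Rightarrow> real) set" where
  "L2 = {g \<in> borel_measurable borel. integrable lborel (\<lambda>x. (g x)\<^sup>2)}"

definition L2_inner :: "(real \<Rightarrow> real) \<Rightarrow> (real \<Rightarrow> real) \<Rightarrow> real" where
  "L2_inner g h = (LINT x|lborel. g x * h x)"

definition L2_norm :: "(real \<Rightarrow> real) \<Rightarrow> real" where
  "L2_norm g = sqrt (L2_inner g g)"

text \<open>Only meaningful for subsets \<open>S\<close> of \<open>L2\<close>.\<close>

definition L2_closure :: "(real \<Rightarrow> real) set \<Rightarrow> (real \<Rightarrow> real) set" where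
  "L2_closure S = {g \<in> L2. \<forall>e>0. \<exists>h\<in>S. L2_norm (\<lambda>x. g x - h x) < e}"

definition L2_closed_subspace :: "(real \<Rightarrow> real) set \<Rightarrow> bool" where
  "L2_closed_subspace V \<longleftrightarrow>
     V \<subseteq> L2 \<and> (\<lambda>x. 0) \<in> V \<and>
     (\<forall>g\<in>V. \<forall>h\<in>V. (\<lambda>x. g x + h x) \<in> V) \<and>
     (\<forall>c. \<forall>g\<in>V. (\<lambda>x. c * g x) \<in> V) \<and>
     L2_closure V = V"

definition finite_combinations :: "('i \<Rightarrow> real \<Rightarrow> real) \<Rightarrow> 'i set \<Rightarrow> (real \<Rightarrow> real) set" where
  "finite_combinations e I = {(\<lambda>x. \<Sum>i\<in>F. c i * e i x) | F c. finite F \<and> F \<subseteq> I}"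

definition orthonormal_basis ::
  "('i \<Rightarrow> real \<Rightarrow> real) \<Rightarrow> 'i set \<Rightarrow> (real \<Rightarrow> real) set \<Rightarrow> bool" where
  "orthonormal_basis e I V \<longleftrightarrow>
     (\<forall>i\<in>I. e i \<in> L2) \<and>
     (\<forall>i\<in>I. \<forall>j\<in>I. L2_inner (e i) (e j) = (if i = j then 1 else 0)) \<and>
     L2_closure (finite_combinations e I) = V"

definition dilate :: "(real \<Rightarrow> real) \<Rightarrow> int \<Rightarrow> int \<Rightarrow> real \<Rightarrow> real" where
  "dilate g j k x = 2 powr (real_of_int j / 2) * g (2 powr real_of_int j * x - real_of_int k)"

definition multiresolution_analysis ::
  "(int \<Rightarrow> (real \<Rightarrow> real) set) \<Rightarrow> (real \<Rightarrow> real) \<Rightarrow> bool" where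
  "multiresolution_analysis V \<phi> \<longleftrightarrow>
     (\<forall>j. L2_closed_subspace (V j)) \<and>
     (\<forall>j. V j \<subseteq> V (j + 1)) \<and>
     (\<forall>j g. g \<in> V j \<longleftrightarrow> (\<lambda>x. g (2 * x)) \<in> V (j + 1)) \<and>
     (\<Inter>j. V j) = {g \<in> L2. AE x in lborel. g x = 0} \<and>
     L2_closure (\<Union>j. V j) = L2 \<and>
     orthonormal_basis (dilate \<phi> 0) UNIV (V 0)"

definition mother_wavelet ::
  "(int \<Rightarrow> (real \<Rightarrow> real) set) \<Rightarrow> (real \<Rightarrow> real) \<Rightarrow> bool" where
  "mother_wavelet V \<psi> \<longleftrightarrow>
     (\<forall>j. orthonormal_basis (dilate \<psi> j) UNIV
            {g \<in> V (j + 1). \<forall>h\<in>V j. L2_inner g h = 0})"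

text \<open>
  The family consisting of \<open>\<phi>\<^sub>0\<^sub>k\<close> for integers \<open>k\<close> and \<open>\<psi>\<^sub>j\<^sub>k\<close> for integers \<open>j \<ge> 0\<close> and \<open>k\<close> is
  indexed by a disjoint sum. That it is an orthonormal basis of \<open>L2\<close> also follows from the
  multiresolution structure.
\<close>

definition wavelet_basis :: "(real \<Rightarrow> real) \<Rightarrow> (real \<Rightarrow> real) \<Rightarrow> bool" where
  "wavelet_basis \<phi> \<psi> \<longleftrightarrow>
     (\<exists>V. multiresolution_analysis V \<phi> \<and> mother_wavelet V \<psi>) \<and>
     orthonormal_basis (case_sum (dilate \<phi> 0) (\<lambda>(j, k). dilate \<psi> j k))
       (UNIV <+> ({0..} \<times> UNIV)) L2"

definition vanishing_moments :: "(real \<Rightarrow> real) \<Rightarrow> nat \<Rightarrow> bool" where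
  "vanishing_moments \<psi> m \<longleftrightarrow> (\<forall>r<m. has_bochner_integral lborel (\<lambda>x. x ^ r * \<psi> x) 0)"

definition compactly_supported :: "(real \<Rightarrow> real) \<Rightarrow> bool" where
  "compactly_supported g \<longleftrightarrow> compact (closure (support_on UNIV g))"

definition twice_continuously_differentiable :: "(real \<Rightarrow> real) \<Rightarrow> bool" where
  "twice_continuously_differentiable g \<longleftrightarrow>
     (\<exists>g' g''. (\<forall>x. (g has_real_derivative g' x) (at x)) \<and>
               (\<forall>x. (g' has_real_derivative g'' x) (at x)) \<and>
               continuous_on UNIV g'')"

text \<open>The sample is \<open>xs 1, \<dots>, xs n\<close>.\<close>

definition empirical_coeff ::
  "(real \<Rightarrow> real) \<Rightarrow> nat \<Rightarrow> (nat \<Rightarrow> real) \<Rightarrow> int \<Rightarrow> int \<Rightarrow> real" where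
  "empirical_coeff g n xs j k = (1 / real n) * (\<Sum>i=1..n. dilate g j k (xs i))"

text \<open>
  For compactly supported \<open>\<phi>\<close> and \<open>\<psi>\<close> only finitely many terms of the sums over \<open>k\<close> are
  non-zero.
\<close>

definition wavelet_estimator ::
  "(real \<Rightarrow> real) \<Rightarrow> (real \<Rightarrow> real) \<Rightarrow> int \<Rightarrow> nat \<Rightarrow> (nat \<Rightarrow> real) \<Rightarrow> real \<Rightarrow> real" where
  "wavelet_estimator \<phi> \<psi> J n xs x =
     (\<Sum>\<^sub>\<infinity>k\<in>UNIV. empirical_coeff \<phi> n xs 0 k * dilate \<phi> 0 k x) +
     (\<Sum>j=0..J. \<Sum>\<^sub>\<infinity>k\<in>UNIV. empirical_coeff \<psi> n xs j k * dilate \<psi> j k x)"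

text \<open>
  The value is junk at points where the series diverges, so convergence almost surely has to be
  assumed separately.
\<close>

definition linear_process ::
  "(nat \<Rightarrow> real) \<Rightarrow> (int \<Rightarrow> 'w \<Rightarrow> real) \<Rightarrow> int \<Rightarrow> 'w \<Rightarrow> real" where
  "linear_process a \<epsilon> n \<omega> = (\<Sum>i. a i * \<epsilon> (n - int i) \<omega>)"

definition iid :: "'w measure \<Rightarrow> (int \<Rightarrow> 'w \<Rightarrow> real) \<Rightarrow> bool" where
  "iid P \<epsilon> \<longleftrightarrow>
     prob_space.indep_vars P (\<lambda>_. borel) \<epsilon> UNIV \<and>
     (\<forall>i j. distr P borel (\<epsilon> i) = distr P borel (\<epsilon> j))"

end

theory Submission
  imports Defs
begin

text \<open>
  Write \<open>s = M \<beta>\<close>. By orthonormality the integrated squared error is the sum of the squared errors of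
  all wavelet coefficients, so it splits into the variances of the empirical coefficients of levels
  \<open>0 \<le> j \<le> J\<close> and the bias \<open>\<Sum>j>J. \<Sum>k. \<beta>\<^sub>j\<^sub>k\<^sup>2\<close>. It suffices that, uniformly in \<open>j\<close>, the variances of one level
  add up to \<open>O(2\<^sup>j / n)\<close> and the squared coefficients of one level to \<open>O(2 powr (-2 j s))\<close>; the level
  \<open>J\<close> balances the two geometric sums.

  All estimates of sums over \<open>k\<close> come from one inequality, \<open>wavelet_coefficients_bound\<close>: for every
  measurable \<open>D\<close>, the numbers \<open>\<integral> (Fourier transform of \<psi>\<^sub>j\<^sub>k)(u) D(u) du\<close> have a square sum over \<open>k\<close> of at
  most \<open>C 2 powr (-2 j s) \<integral> |u| powr (2 s) |D(u)|\<^sup>2 du\<close>, as soon as \<open>\<psi>\<close> has at least \<open>s\<close> vanishing moments.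
  After rescaling, these numbers are samples at the integers of a Fourier integral
  \<open>\<integral> iexp (k v) H(v) dv\<close>, and the samples are controlled by \<open>\<integral> (1 + v\<^sup>2) |H(v)|\<^sup>2 dv\<close>
  (\<open>sampled_fourier_bound\<close>). This holds by duality, because the Fourier transform of \<open>1 / (1 + v\<^sup>2)\<close> decays
  exponentially and is therefore summable over the integers.

  \<^emph>\<open>Bias.\<close> The coefficient \<open>\<beta>\<^sub>j\<^sub>k\<close> is \<open>1 / (2 \<pi>)\<close> times such an integral with \<open>D(u)\<close> the characteristic
  function of the process at \<open>-u\<close>. The latter is dominated by a product of \<open>M\<close> rescaled copies of \<open>\<phi>\<^sub>\<epsilon>\<close>, so that
  \<open>|u| powr (2 s) |D(u)|\<^sup>2\<close> is integrable (\<open>linear_process_sobolev\<close>).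

  \<^emph>\<open>Variance.\<close> Write \<open>X\<^sub>i = a\<^sub>0 \<epsilon>\<^sub>i + Y\<^sub>i\<close>, where \<open>Y\<^sub>i\<close> depends on the earlier innovations only, and
  \<open>h(y) = E g(a\<^sub>0 \<epsilon> + y)\<close> for \<open>g = \<psi>\<^sub>j\<^sub>k\<close>. The differences \<open>g(X\<^sub>i) - h(Y\<^sub>i)\<close> are orthogonal martingale
  differences, so they contribute like independent observations
  (\<open>martingale_difference_variance\<close>); only boundedly many \<open>\<psi>\<^sub>j\<^sub>k\<close> overlap, whence \<open>O(2\<^sup>j / n)\<close>. The remainder
  \<open>\<Sum>\<^sub>i h(Y\<^sub>i) - E h(Y\<^sub>i)\<close> is again a Fourier integral, now with
  \<open>D(u) = \<phi>\<^sub>\<epsilon>(- a\<^sub>0 u) \<Sum>\<^sub>i (iexp (- u Y\<^sub>i) - E iexp (- u Y\<^sub>i))\<close>, to which the inequality applies with \<open>s = 0\<close>.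
  Summability of \<open>|a\<^sub>i| powr \<gamma>\<close> makes the memory short: the sum in \<open>D\<close> has variance \<open>O(n |u| powr (2 \<gamma>))\<close>
  (\<open>linear_process_empirical_cf_variance\<close>), and \<open>\<gamma> \<le> \<beta>\<close> makes \<open>|\<phi>\<^sub>\<epsilon>(a\<^sub>0 u)|\<^sup>2 |u| powr (2 \<gamma>)\<close> integrable.
  Every level therefore receives only \<open>O(1 / n)\<close> from this part.
\<close>

section \<open>Fourier inversion and the Cauchy kernel\<close>

text \<open>
  The sign and normalisation are those of \<open>char\<close>.
\<close>

definition fourier :: "(real \<Rightarrow> real) \<Rightarrow> real \<Rightarrow> complex" where
  "fourier g u = (CLINT x|lborel. of_real (g x) * iexp (u * x))"

abbreviation fourier_pairing :: "(real \<Rightarrow> real) \<Rightarrow> (real \<Rightarrow> complex) \<Rightarrow> complex" where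
  "fourier_pairing g D \<equiv> (CLINT u|lborel. fourier g u * D u)"

text \<open>
  Up to normalisation, the squared homogeneous Sobolev norm of order \<open>s\<close> of a function with Fourier transform \<open>D\<close>.
\<close>

abbreviation weighted_energy :: "real \<Rightarrow> (real \<Rightarrow> complex) \<Rightarrow> ennreal" where
  "weighted_energy s D \<equiv> (\<integral>\<^sup>+u. ennreal (\<bar>u\<bar> powr (2 * s) * (cmod (D u))\<^sup>2) \<partial>lborel)"

text \<open>
  Fubini for the integrands met here: an integrable product of functions of one variable each, times a
  bounded kernel coupling the variables, usually \<open>iexp (u * x)\<close>.
\<close>

lemma Fubini_bounded_kernel:
  fixes f :: "'a \<Rightarrow> complex" and g :: "'b \<Rightarrow> complex" and K :: "'a \<Rightarrow> 'b \<Rightarrow> complex"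
  assumes "sigma_finite_measure M" "sigma_finite_measure N"
    and f: "integrable M f" and g: "integrable N g"
    and K[measurable]: "case_prod K \<in> borel_measurable (M \<Otimes>\<^sub>M N)"
    and bound: "\<And>x y. norm (K x y) \<le> 1"
  shows "(\<integral>y. g y * (\<integral>x. f x * K x y \<partial>M) \<partial>N) = (\<integral>x. f x * (\<integral>y. g y * K x y \<partial>N) \<partial>M)"
proof -
  interpret M: sigma_finite_measure M by fact
  interpret N: sigma_finite_measure N by fact
  interpret pair_sigma_finite M N ..
  have [measurable]: "f \<in> borel_measurable M" "g \<in> borel_measurable N"
    using f g by auto
  have le: "norm (f x * (g y * K x y)) \<le> norm (f x) * norm (g y)" for x y
    using mult_left_mono[OF bound[of x y], of "norm (f x) * norm (g y)"]
    by (simp add: norm_mult mult.assoc)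
  have dom: "integrable (M \<Otimes>\<^sub>M N) (\<lambda>(x, y). norm (f x) * norm (g y))"
  proof (rule Fubini_integrable)
    show "(\<lambda>(x, y). norm (f x) * norm (g y)) \<in> borel_measurable (M \<Otimes>\<^sub>M N)"
      by measurable
  qed (use f g in \<open>auto intro!: integrable_mult_left integrable_mult_right\<close>)
  have int: "integrable (M \<Otimes>\<^sub>M N) (\<lambda>(x, y). f x * (g y * K x y))"
  proof (rule Bochner_Integration.integrable_bound[OF dom])
    show "(\<lambda>(x, y). f x * (g y * K x y)) \<in> borel_measurable (M \<Otimes>\<^sub>M N)"
      by measurable
  qed (use le in \<open>auto intro!: AE_I2 simp: abs_mult\<close>)
  have "(\<integral>y. g y * (\<integral>x. f x * K x y \<partial>M) \<partial>N) = (\<integral>y. (\<integral>x. f x * (g y * K x y) \<partial>M) \<partial>N)"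
    by (simp flip: integral_mult_right_zero add: mult.left_commute)
  also have "\<dots> = (\<integral>x. (\<integral>y. f x * (g y * K x y) \<partial>N) \<partial>M)"
    by (rule Fubini_integral[OF int])
  finally show ?thesis by simp
qed

lemma integrable_gaussian: "integrable lborel (\<lambda>z::real. exp (- z\<^sup>2 / 2))"
proof -
  have "integrable lborel (\<lambda>z. sqrt (2 * pi) * std_normal_density z)"
    by (intro integrable_mult_right) simp
  then show ?thesis by (simp add: std_normal_density_def)
qed

text \<open>
  This is the characteristic function of the standard normal distribution without its normalisation.
\<close>

lemma integral_gaussian_iexp:
  "(CLINT z|lborel. of_real (exp (- z\<^sup>2 / 2)) * iexp (t * z)) = of_real (sqrt (2 * pi) * exp (- t\<^sup>2 / 2))"
proof -
  have "of_real (exp (- t\<^sup>2 / 2)) = char std_normal_distribution t"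
    by (simp add: char_std_normal_distribution)
  also have "\<dots> = (CLINT z|lborel. std_normal_density z *\<^sub>R iexp (t * z))"
    unfolding char_def by (subst integral_density) auto
  also have "\<dots> = (CLINT z|lborel. of_real (1 / sqrt (2 * pi)) * (of_real (exp (- z\<^sup>2 / 2)) * iexp (t * z)))"
    by (intro Bochner_Integration.integral_cong refl) (simp add: std_normal_density_def scaleR_conv_of_real)
  also have "\<dots> = of_real (1 / sqrt (2 * pi)) * (CLINT z|lborel. of_real (exp (- z\<^sup>2 / 2)) * iexp (t * z))"
    by simp
  finally show ?thesis by (simp add: field_simps)
qed

lemma integral_scaled_gaussian_iexp:
  assumes "\<sigma> > 0"
  shows "(CLINT u|lborel. of_real (exp (- (\<sigma> * u)\<^sup>2 / 2)) * iexp (t * u))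
    = of_real (sqrt (2 * pi) / \<sigma> * exp (- (t / \<sigma>)\<^sup>2 / 2))"
  using assms lborel_integral_real_affine[of \<sigma> "\<lambda>z. of_real (exp (- z\<^sup>2 / 2)) * iexp (t / \<sigma> * z)" 0]
    integral_gaussian_iexp[of "t / \<sigma>"]
  by (simp add: field_simps scaleR_conv_of_real)

lemma continuous_on_UNIV_measurable [measurable_dest]:
  "continuous_on UNIV (g :: real \<Rightarrow> 'a::topological_space) \<Longrightarrow> g \<in> borel_measurable borel"
  by (rule borel_measurable_continuous_onI)

lemma fourier_measurable [measurable]:
  assumes [measurable]: "g \<in> borel_measurable borel"
  shows "fourier g \<in> borel_measurable borel"
  unfolding fourier_def by measurable

text \<open>
  The transform is damped by a Gaussian of width \<open>1 / \<sigma>\<close>. Then Fubini applies, and the damped inversion integral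
  is a Gaussian average of \<open>g\<close> around \<open>x\<close> with standard deviation \<open>\<sigma>\<close>. As \<open>\<sigma>\<close> tends to 0 both sides converge
  dominatedly.
\<close>

theorem fourier_inversion:
  fixes g :: "real \<Rightarrow> real"
  assumes cont: "continuous_on UNIV g" and int: "integrable lborel g"
    and bound: "\<And>x. \<bar>g x\<bar> \<le> B" and intF: "integrable lborel (fourier g)"
  shows "(CLINT u|lborel. fourier g u * iexp (- (u * x))) = of_real (2 * pi * g x)"
proof (rule LIMSEQ_unique)
  define \<sigma> where "\<sigma> n = inverse (real (Suc n))" for n
  have \<sigma>: "\<sigma> n > 0" for n by (simp add: \<sigma>_def)
  have \<sigma>_lim: "\<sigma> \<longlonglongrightarrow> 0" unfolding \<sigma>_def by (rule LIMSEQ_inverse_real_of_nat)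
  have [measurable]: "g \<in> borel_measurable borel" using cont by measurable
  define I where "I n = (CLINT u|lborel. fourier g u * iexp (- (u * x)) * of_real (exp (- (\<sigma> n * u)\<^sup>2 / 2)))" for n
  show "I \<longlonglongrightarrow> (CLINT u|lborel. fourier g u * iexp (- (u * x)))"
    unfolding I_def
  proof (rule integral_dominated_convergence[where w="\<lambda>u. norm (fourier g u)"])
    show "AE u in lborel. (\<lambda>n. fourier g u * iexp (- (u * x)) * of_real (exp (- (\<sigma> n * u)\<^sup>2 / 2))) \<longlonglongrightarrow> fourier g u * iexp (- (u * x))"
    proof (intro AE_I2)
      fix u
      have "(\<lambda>n. fourier g u * iexp (- (u * x)) * of_real (exp (- (\<sigma> n * u)\<^sup>2 / 2)))
        \<longlonglongrightarrow> fourier g u * iexp (- (u * x)) * of_real (exp (- (0 * u)\<^sup>2 / 2))"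
        by (intro tendsto_intros \<sigma>_lim) auto
      then show "(\<lambda>n. fourier g u * iexp (- (u * x)) * of_real (exp (- (\<sigma> n * u)\<^sup>2 / 2))) \<longlonglongrightarrow> fourier g u * iexp (- (u * x))"
        by simp
    qed
  next
    show "AE u in lborel. norm (fourier g u * iexp (- (u * x)) * of_real (exp (- (\<sigma> n * u)\<^sup>2 / 2))) \<le> norm (fourier g u)" for n
      by (intro AE_I2) (auto simp: norm_mult mult_left_le)
  qed (use intF in auto)
  have I_eq: "I n = (CLINT z|lborel. of_real (sqrt (2 * pi) * (exp (- z\<^sup>2 / 2) * g (x + \<sigma> n * z))))" for n
  proof -
    let ?s = "\<sigma> n"
    have gauss: "integrable lborel (\<lambda>u. exp (- (?s * u)\<^sup>2 / 2))"
      using lborel_integrable_real_affine[OF integrable_gaussian, of ?s 0] \<sigma>[of n] by simp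
    have gauss': "integrable lborel (\<lambda>u. iexp (- (u * x)) * complex_of_real (exp (- (?s * u)\<^sup>2 / 2)))"
      by (rule Bochner_Integration.integrable_bound[OF gauss]) (auto simp: norm_mult)
    have "I n = (CLINT u|lborel. (iexp (- (u * x)) * of_real (exp (- (?s * u)\<^sup>2 / 2))) *
         (CLINT y|lborel. of_real (g y) * iexp (u * y)))"
      by (simp add: I_def fourier_def mult_ac)
    also have "\<dots> = (CLINT y|lborel. of_real (g y) *
        (CLINT u|lborel. iexp (- (u * x)) * of_real (exp (- (?s * u)\<^sup>2 / 2)) * iexp (u * y)))"
      by (rule Fubini_bounded_kernel)
         (use int gauss' in \<open>auto simp: sigma_finite_lborel\<close>)
    also have "\<dots> = (CLINT y|lborel. of_real (g y) *
        of_real (sqrt (2 * pi) / ?s * exp (- ((y - x) / ?s)\<^sup>2 / 2)))"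
    proof (intro Bochner_Integration.integral_cong refl arg_cong2[where f="(*)"])
      fix y
      have "(CLINT u|lborel. iexp (- (u * x)) * of_real (exp (- (?s * u)\<^sup>2 / 2)) * iexp (u * y))
        = (CLINT u|lborel. of_real (exp (- (?s * u)\<^sup>2 / 2)) * iexp ((y - x) * u))"
        by (intro Bochner_Integration.integral_cong refl)
           (simp add: algebra_simps flip: exp_add)
      then show "(CLINT u|lborel. iexp (- (u * x)) * of_real (exp (- (?s * u)\<^sup>2 / 2)) * iexp (u * y))
        = of_real (sqrt (2 * pi) / ?s * exp (- ((y - x) / ?s)\<^sup>2 / 2))"
        by (simp only: integral_scaled_gaussian_iexp[OF \<sigma>])
    qed
    also have "\<dots> = \<bar>?s\<bar> *\<^sub>R (CLINT z|lborel. of_real (g (x + ?s * z)) *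
        of_real (sqrt (2 * pi) / ?s * exp (- ((x + ?s * z - x) / ?s)\<^sup>2 / 2)))"
      by (rule lborel_integral_real_affine) (use \<sigma>[of n] in auto)
    also have "\<dots> = (CLINT z|lborel. of_real (sqrt (2 * pi) * (exp (- z\<^sup>2 / 2) * g (x + ?s * z))))"
      unfolding integral_scaleR_right[symmetric]
      by (intro Bochner_Integration.integral_cong refl)
         (use \<sigma>[of n] in \<open>simp add: scaleR_conv_of_real field_simps\<close>)
    finally show ?thesis .
  qed
  have "(\<lambda>n. LINT z|lborel. sqrt (2 * pi) * (exp (- z\<^sup>2 / 2) * g (x + \<sigma> n * z)))
      \<longlonglongrightarrow> (LINT z|lborel. sqrt (2 * pi) * (exp (- z\<^sup>2 / 2) * g x))"
  proof (rule integral_dominated_convergence[where w="\<lambda>z. sqrt (2 * pi) * (exp (- z\<^sup>2 / 2) * B)"])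
    show "AE z in lborel. (\<lambda>n. sqrt (2 * pi) * (exp (- z\<^sup>2 / 2) * g (x + \<sigma> n * z))) \<longlonglongrightarrow> sqrt (2 * pi) * (exp (- z\<^sup>2 / 2) * g x)"
    proof (intro AE_I2 tendsto_intros)
      fix z
      have "(\<lambda>n. x + \<sigma> n * z) \<longlonglongrightarrow> x + 0 * z" by (intro tendsto_intros \<sigma>_lim)
      moreover have "isCont g x" using cont by (simp add: continuous_on_eq_continuous_at)
      ultimately show "(\<lambda>n. g (x + \<sigma> n * z)) \<longlonglongrightarrow> g x"
        using isCont_tendsto_compose[of x g "\<lambda>n. x + \<sigma> n * z" sequentially] by simp
    qed
  qed (use integrable_gaussian bound in \<open>auto simp: abs_mult intro!: mult_left_mono\<close>)
  also have "(LINT z|lborel. sqrt (2 * pi) * (exp (- z\<^sup>2 / 2) * g x)) = 2 * pi * g x"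
    using integral_gaussian_iexp[of 0] by (simp add: integral_complex_of_real flip: of_real_mult)
  finally show "I \<longlonglongrightarrow> of_real (2 * pi * g x)"
    unfolding I_eq integral_complex_of_real by (rule tendsto_of_real)
qed

lemma integral_I0i_exp_iexp:
  "(CLINT x|lborel. indicator {0<..} x *\<^sub>R (of_real (exp (- x)) * iexp (v * x))) = 1 / (1 - \<i> * of_real v)"
proof -
  define w :: complex where "w = \<i> * of_real v - 1"
  have w0: "w \<noteq> 0" by (auto simp: w_def complex_eq_iff)
  have e: "complex_of_real (exp (- x)) * iexp (v * x) = exp (w * of_real x)" for x
    by (simp add: w_def algebra_simps exp_diff exp_minus divide_inverse flip: exp_of_real)
  have "(CLBINT x=0..\<infinity>. exp (w * of_real x)) = 0 - 1 / w"
  proof (rule interval_integral_FTC_integrable[where F="\<lambda>x. exp (w * of_real x) / w"])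
    show "((\<lambda>x. exp (w * of_real x) / w) has_vector_derivative exp (w * of_real x)) (at x)" for x
      using w0 by (auto intro!: derivative_eq_intros has_vector_derivative_real_field)
    show "isCont (\<lambda>x. exp (w * complex_of_real x)) x" for x
      by (intro continuous_intros)
    have "set_integrable lborel {0<..} (\<lambda>x. exp (- (x * 1)) :: real)"
      by (rule integrable_I0i_exp_mscale) simp
    then show "set_integrable lborel (einterval 0 \<infinity>) (\<lambda>x. exp (w * complex_of_real x))"
      unfolding set_integrable_def zero_ereal_def
      by (rule Bochner_Integration.integrable_bound)
         (auto simp: norm_mult w_def split: split_indicator)
    show "(((\<lambda>x. exp (w * of_real x) / w) \<circ> real_of_ereal) \<longlongrightarrow> 1 / w) (at_right 0)"
      unfolding zero_ereal_def ereal_tendsto_simps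
      using w0 by (auto intro!: tendsto_eq_intros)
    have "((\<lambda>x. norm (exp (w * complex_of_real x) / w)) \<longlongrightarrow> 0) at_top"
    proof -
      have "((\<lambda>x::real. exp (- x) / norm w) \<longlongrightarrow> 0 / norm w) at_top"
        using w0 by (intro tendsto_divide tendsto_const filterlim_compose[OF exp_at_bot] filterlim_uminus_at_bot_at_top) auto
      then show ?thesis by (simp add: norm_divide w_def)
    qed
    then show "(((\<lambda>x. exp (w * of_real x) / w) \<circ> real_of_ereal) \<longlongrightarrow> 0) (at_left \<infinity>)"
      unfolding ereal_tendsto_simps by (rule tendsto_norm_zero_cancel)
  qed auto
  then show ?thesis
    unfolding interval_lebesgue_integral_0_infty set_lebesgue_integral_def e
    using w0 by (simp add: w_def field_simps)
qed

lemma integrable_exp_abs: "integrable lborel (\<lambda>x::real. exp (- \<bar>x\<bar>))"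
proof -
  have i: "integrable lborel (\<lambda>x. indicator {0<..} x *\<^sub>R exp (- x) :: real)"
    using integrable_I0i_exp_mscale[of 1] by (simp add: set_integrable_def)
  have "integrable lborel (\<lambda>x. indicator {0<..} x *\<^sub>R exp (- x) + indicator {0<..} (- x) *\<^sub>R exp (- (- x)) :: real)"
    using i lborel_integrable_real_affine[OF i, of "-1" 0] by simp
  moreover have "AE x in lborel. (indicator {0<..} x *\<^sub>R exp (- x) + indicator {0<..} (- x) *\<^sub>R exp (- (- x)) :: real) = exp (- \<bar>x\<bar>)"
    using AE_lborel_singleton[of 0] by eventually_elim (auto simp: indicator_def)
  ultimately show ?thesis
    by (subst (asm) integrable_cong_AE) auto
qed

lemma fourier_exp_abs: "fourier (\<lambda>x. exp (- \<bar>x\<bar>)) v = of_real (2 / (1 + v\<^sup>2))"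
proof -
  define h where "h v x = indicator {0<..} x *\<^sub>R (of_real (exp (- x)) * iexp (v * x))" for v x :: real
  have i: "integrable lborel (h v)" for v
  proof -
    have "integrable lborel (\<lambda>x. indicator {0<..} x *\<^sub>R exp (- x) :: real)"
      using integrable_I0i_exp_mscale[of 1] by (simp add: set_integrable_def)
    then show ?thesis
      unfolding h_def[abs_def]
      by (rule Bochner_Integration.integrable_bound) (auto simp: norm_mult split: split_indicator)
  qed
  have "fourier (\<lambda>x. exp (- \<bar>x\<bar>)) v = (CLINT x|lborel. h v x + h (- v) (- x))"
    unfolding fourier_def h_def
    by (rule integral_cong_AE)
       (use AE_lborel_singleton[of 0] in \<open>auto elim!: eventually_mono simp: indicator_def\<close>)
  also have "\<dots> = (CLINT x|lborel. h v x) + (CLINT x|lborel. h (- v) (- x))"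
    using i[of v] lborel_integrable_real_affine[OF i[of "-v"], of "-1" 0] by simp
  also have "(CLINT x|lborel. h (- v) (- x)) = (CLINT x|lborel. h (- v) x)"
    using lborel_integral_real_affine[of "-1" "h (- v)" 0] by simp
  also have "(CLINT x|lborel. h v x) + (CLINT x|lborel. h (- v) x) = 1 / (1 - \<i> * of_real v) + 1 / (1 + \<i> * of_real v)"
    using integral_I0i_exp_iexp[of v] integral_I0i_exp_iexp[of "- v"] by (simp add: h_def)
  also have "\<dots> = of_real (2 / (1 + v\<^sup>2))"
  proof -
    have "1 - \<i> * complex_of_real v \<noteq> 0" "1 + \<i> * complex_of_real v \<noteq> 0" by (auto simp: complex_eq_iff)
    moreover have "(1 - \<i> * complex_of_real v) * (1 + \<i> * complex_of_real v) = of_real (1 + v\<^sup>2)"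
      by (simp add: algebra_simps power2_eq_square)
    ultimately show ?thesis
      by (simp add: divide_simps)
  qed
  finally show ?thesis .
qed

lemma integrable_inverse_one_plus_square: "integrable lborel (\<lambda>x::real. 1 / (1 + x\<^sup>2))"
  using integrable_inverse_1_plus_square
  by (simp add: set_integrable_def inverse_eq_divide)

text \<open>
  The transform of \<open>exp (- \<bar>x\<bar>)\<close> is explicit and integrable; Fourier inversion turns it into the transform
  of the Cauchy kernel.
\<close>

lemma integral_iexp_cauchy:
  "(CLINT v|lborel. of_real (1 / (1 + v\<^sup>2)) * iexp (k * v)) = of_real (pi * exp (- \<bar>k\<bar>))"
proof -
  have "(CLINT u|lborel. fourier (\<lambda>x. exp (- \<bar>x\<bar>)) u * iexp (- (u * - k))) = of_real (2 * pi * exp (- \<bar>- k\<bar>))"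
  proof (rule fourier_inversion[where B=1])
    have "integrable lborel (\<lambda>x::real. complex_of_real (2 * (1 / (1 + x\<^sup>2))))"
      using integrable_inverse_one_plus_square by (intro integrable_of_real integrable_mult_right)
    then show "integrable lborel (fourier (\<lambda>x. exp (- \<bar>x\<bar>)))"
      by (simp add: fourier_exp_abs[abs_def])
  qed (auto intro!: continuous_intros integrable_exp_abs)
  moreover have "(CLINT u|lborel. fourier (\<lambda>x. exp (- \<bar>x\<bar>)) u * iexp (- (u * - k)))
      = 2 * (CLINT v|lborel. of_real (1 / (1 + v\<^sup>2)) * iexp (k * v))"
    unfolding fourier_exp_abs integral_mult_right_zero[symmetric]
    by (intro Bochner_Integration.integral_cong refl) (simp add: mult_ac)
  ultimately show ?thesis by simp
qed

section \<open>Sampling a Fourier integral at the integers\<close>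

text \<open>
  Both the integers up to \<open>l\<close> and those above \<open>l\<close> are enumerated injectively by their distance from \<open>l\<close>.
\<close>

lemma sum_exp_minus_abs_int_le:
  fixes l :: int
  assumes "finite K"
  shows "(\<Sum>k\<in>K. exp (- \<bar>real_of_int (l - k)\<bar>)) \<le> 2 * (\<Sum>n. exp (- 1 :: real) ^ n)"
proof -
  let ?e = "\<lambda>n. exp (- 1 :: real) ^ n"
  have sm: "summable ?e" by (rule summable_geometric) simp
  have e: "exp (- \<bar>real_of_int (l - k)\<bar>) = ?e (nat \<bar>l - k\<bar>)" for k
    by (simp flip: exp_of_nat_mult)
  have half: "(\<Sum>k\<in>S. ?e (nat \<bar>l - k\<bar>)) \<le> (\<Sum>n. ?e n)" if "finite S" "inj_on (\<lambda>k. nat \<bar>l - k\<bar>) S" for S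
  proof -
    have "(\<Sum>k\<in>S. ?e (nat \<bar>l - k\<bar>)) = (\<Sum>n\<in>(\<lambda>k. nat \<bar>l - k\<bar>) ` S. ?e n)"
      using that by (simp add: sum.reindex)
    also have "\<dots> \<le> (\<Sum>n. ?e n)"
      by (rule sum_le_suminf[OF sm]) (use that in auto)
    finally show ?thesis .
  qed
  have "(\<Sum>k\<in>K. ?e (nat \<bar>l - k\<bar>)) = (\<Sum>k\<in>{k\<in>K. k \<le> l}. ?e (nat \<bar>l - k\<bar>)) + (\<Sum>k\<in>{k\<in>K. \<not> k \<le> l}. ?e (nat \<bar>l - k\<bar>))"
    using assms by (subst sum.union_disjoint[symmetric]) (auto intro!: sum.cong)
  also have "\<dots> \<le> (\<Sum>n. ?e n) + (\<Sum>n. ?e n)"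
    by (intro add_mono half) (use assms in \<open>auto simp: inj_on_def\<close>)
  finally show ?thesis unfolding e by simp
qed

text \<open>
  Expanding the square, the integral becomes a quadratic form in the coefficients whose matrix
  \<open>\<pi> exp (- \<bar>k - l\<bar>)\<close> has bounded row sums. Schur's test bounds such a form by the square sum of the coefficients.
\<close>

lemma trigonometric_polynomial_cauchy_bound:
  "\<exists>C>0. \<forall>K (b :: int \<Rightarrow> complex). finite K \<longrightarrow>
     integrable lborel (\<lambda>v. (cmod (\<Sum>k\<in>K. b k * iexp (of_int k * v)))\<^sup>2 / (1 + v\<^sup>2)) \<and>
     (LINT v|lborel. (cmod (\<Sum>k\<in>K. b k * iexp (of_int k * v)))\<^sup>2 / (1 + v\<^sup>2)) \<le> C * (\<Sum>k\<in>K. (cmod (b k))\<^sup>2)"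
proof -
  define A where "A = 2 * (\<Sum>n. exp (- 1 :: real) ^ n)"
  have A: "(\<Sum>k\<in>K. exp (- \<bar>real_of_int (l - k)\<bar>)) \<le> A" if "finite K" for K l
    unfolding A_def using that by (rule sum_exp_minus_abs_int_le)
  have A0: "A > 0" using A[of "{0}" 0] by simp
  have "integrable lborel (\<lambda>v. (cmod (\<Sum>k\<in>K. b k * iexp (of_int k * v)))\<^sup>2 / (1 + v\<^sup>2)) \<and>
     (LINT v|lborel. (cmod (\<Sum>k\<in>K. b k * iexp (of_int k * v)))\<^sup>2 / (1 + v\<^sup>2)) \<le> pi * A * (\<Sum>k\<in>K. (cmod (b k))\<^sup>2)"
    if K: "finite K" for K and b :: "int \<Rightarrow> complex"
  proof
    let ?B = "\<lambda>v. (\<Sum>k\<in>K. b k * iexp (of_int k * v))"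
    have le: "(cmod (?B v))\<^sup>2 / (1 + v\<^sup>2) \<le> (\<Sum>k\<in>K. cmod (b k))\<^sup>2 * (1 / (1 + v\<^sup>2))" for v
    proof -
      have "cmod (?B v) \<le> (\<Sum>k\<in>K. cmod (b k))"
        by (rule order_trans[OF norm_sum]) (simp add: norm_mult)
      then show ?thesis by (auto simp: divide_inverse intro!: mult_right_mono power_mono)
    qed
    have bnd: "integrable lborel (\<lambda>v. (\<Sum>k\<in>K. cmod (b k))\<^sup>2 * (1 / (1 + v\<^sup>2)))"
      by (intro integrable_mult_right integrable_inverse_one_plus_square)
    show "integrable lborel (\<lambda>v. (cmod (?B v))\<^sup>2 / (1 + v\<^sup>2))"
      by (rule Bochner_Integration.integrable_bound[OF bnd]) (use le in \<open>auto simp del: power_divide\<close>)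
    have ki: "integrable lborel (\<lambda>v. of_real (1 / (1 + v\<^sup>2)) * iexp (k * v))" for k
    proof -
      have "integrable lborel (\<lambda>v. complex_of_real (1 / (1 + v\<^sup>2)))"
        using integrable_inverse_one_plus_square by (rule integrable_of_real)
      then show ?thesis
        by (rule Bochner_Integration.integrable_bound) (auto intro!: AE_I2 simp: norm_mult norm_divide)
    qed
    have "of_real (LINT v|lborel. (cmod (?B v))\<^sup>2 / (1 + v\<^sup>2))
        = (CLINT v|lborel. of_real ((cmod (?B v))\<^sup>2 / (1 + v\<^sup>2)))"
      by (simp only: integral_complex_of_real)
    also have "\<dots> = (CLINT v|lborel. (\<Sum>k\<in>K. \<Sum>l\<in>K. b k * cnj (b l) *
        (of_real (1 / (1 + v\<^sup>2)) * iexp (of_int (k - l) * v))))"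
    proof (intro Bochner_Integration.integral_cong refl)
      fix v :: real
      have "complex_of_real ((cmod (?B v))\<^sup>2 / (1 + v\<^sup>2)) = of_real (1 / (1 + v\<^sup>2)) * (?B v * cnj (?B v))"
        by (simp only: complex_norm_square[symmetric]) simp
      also have "?B v * cnj (?B v) = (\<Sum>k\<in>K. \<Sum>l\<in>K. b k * cnj (b l) * iexp (of_int (k - l) * v))"
        by (simp add: sum_product cnj_sum exp_cnj algebra_simps flip: exp_add)
      finally show "complex_of_real ((cmod (?B v))\<^sup>2 / (1 + v\<^sup>2)) =
          (\<Sum>k\<in>K. \<Sum>l\<in>K. b k * cnj (b l) * (of_real (1 / (1 + v\<^sup>2)) * iexp (of_int (k - l) * v)))"
        by (simp add: sum_distrib_left mult_ac)
    qed
    also have "\<dots> = (\<Sum>k\<in>K. \<Sum>l\<in>K. b k * cnj (b l) * of_real (pi * exp (- \<bar>of_int (k - l)\<bar>)))"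
    proof -
      have i: "integrable lborel (\<lambda>v. b k * cnj (b l) * (of_real (1 / (1 + v\<^sup>2)) * iexp (of_int (k - l) * v)))" for k l
        by (intro integrable_mult_right ki)
      have "(CLINT v|lborel. (\<Sum>k\<in>K. \<Sum>l\<in>K. b k * cnj (b l) *
          (of_real (1 / (1 + v\<^sup>2)) * iexp (of_int (k - l) * v))))
        = (\<Sum>k\<in>K. CLINT v|lborel. (\<Sum>l\<in>K. b k * cnj (b l) *
          (of_real (1 / (1 + v\<^sup>2)) * iexp (of_int (k - l) * v))))"
        by (rule Bochner_Integration.integral_sum) (intro Bochner_Integration.integrable_sum i)
      also have "\<dots> = (\<Sum>k\<in>K. \<Sum>l\<in>K. CLINT v|lborel. b k * cnj (b l) *
          (of_real (1 / (1 + v\<^sup>2)) * iexp (of_int (k - l) * v)))"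
        by (intro sum.cong refl Bochner_Integration.integral_sum i)
      finally show ?thesis
        unfolding integral_mult_right_zero integral_iexp_cauchy .
    qed
    finally have eq: "complex_of_real (LINT v|lborel. (cmod (?B v))\<^sup>2 / (1 + v\<^sup>2)) = \<dots>" .
    have "\<bar>LINT v|lborel. (cmod (?B v))\<^sup>2 / (1 + v\<^sup>2)\<bar>
        \<le> cmod (\<Sum>k\<in>K. \<Sum>l\<in>K. b k * cnj (b l) * of_real (pi * exp (- \<bar>of_int (k - l)\<bar>)))"
      unfolding eq[symmetric] by (simp only: norm_of_real order_refl)
    also have "\<dots> \<le> (\<Sum>k\<in>K. \<Sum>l\<in>K. pi * (((cmod (b k))\<^sup>2 + (cmod (b l))\<^sup>2) / 2 * exp (- \<bar>of_int (k - l)\<bar>)))"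
    proof (intro sum_norm_le)
      fix k l
      have "cmod (b k) * cmod (b l) \<le> ((cmod (b k))\<^sup>2 + (cmod (b l))\<^sup>2) / 2"
        using sum_squares_bound[of "cmod (b k)" "cmod (b l)"] by simp
      then show "cmod (b k * cnj (b l) * of_real (pi * exp (- \<bar>of_int (k - l)\<bar>)))
        \<le> pi * (((cmod (b k))\<^sup>2 + (cmod (b l))\<^sup>2) / 2 * exp (- \<bar>of_int (k - l)\<bar>))"
        by (simp add: norm_mult mult_ac del: of_int_diff)
    qed
    also have "\<dots> = pi * ((\<Sum>k\<in>K. \<Sum>l\<in>K. (cmod (b k))\<^sup>2 / 2 * exp (- \<bar>of_int (k - l)\<bar>))
        + (\<Sum>k\<in>K. \<Sum>l\<in>K. (cmod (b l))\<^sup>2 / 2 * exp (- \<bar>of_int (k - l)\<bar>)))"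
      by (simp add: sum_distrib_left add_divide_distrib ring_distribs flip: sum.distrib del: of_int_diff)
    also have "(\<Sum>k\<in>K. \<Sum>l\<in>K. (cmod (b l))\<^sup>2 / 2 * exp (- \<bar>real_of_int (k - l)\<bar>))
        = (\<Sum>k\<in>K. \<Sum>l\<in>K. (cmod (b k))\<^sup>2 / 2 * exp (- \<bar>of_int (k - l)\<bar>))"
      by (subst sum.swap) (simp add: abs_minus_commute)
    also have "pi * ((\<Sum>k\<in>K. \<Sum>l\<in>K. (cmod (b k))\<^sup>2 / 2 * exp (- \<bar>of_int (k - l)\<bar>))
        + (\<Sum>k\<in>K. \<Sum>l\<in>K. (cmod (b k))\<^sup>2 / 2 * exp (- \<bar>of_int (k - l)\<bar>)))
        = pi * (\<Sum>k\<in>K. (cmod (b k))\<^sup>2 * (\<Sum>l\<in>K. exp (- \<bar>of_int (k - l)\<bar>)))"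
      by (simp add: sum_distrib_left del: of_int_diff flip: sum.distrib)
    also have "\<dots> \<le> pi * (\<Sum>k\<in>K. (cmod (b k))\<^sup>2 * A)"
      by (intro mult_left_mono sum_mono A K) auto
    also have "\<dots> = pi * A * (\<Sum>k\<in>K. (cmod (b k))\<^sup>2)"
      by (simp add: sum_distrib_left sum_distrib_right mult_ac)
    finally show "(LINT v|lborel. (cmod (?B v))\<^sup>2 / (1 + v\<^sup>2)) \<le> pi * A * (\<Sum>k\<in>K. (cmod (b k))\<^sup>2)"
      by simp
  qed
  moreover have "pi * A > 0" using A0 by simp
  ultimately show ?thesis by blast
qed

text \<open>
  A sampling inequality of Sobolev type: the samples at the integers of a function in \<open>H\<^sup>1\<close>, given by its
  Fourier transform \<open>H\<close>, are square summable. It is dual to the preceding lemma: for the samples \<open>c k\<close>, the sum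
  \<open>S\<close> of the \<open>\<bar>c k\<bar>\<^sup>2\<close> is the integral of \<open>H\<close> against a trigonometric polynomial with coefficients \<open>cnj (c k)\<close>. The
  weighted arithmetic-geometric mean inequality bounds this by \<open>S / 2\<close> plus a multiple of the weighted integral of
  \<open>H\<close>, and \<open>S / 2\<close> is absorbed on the left.
\<close>

lemma sampled_fourier_bound:
  "\<exists>C>0. \<forall>K (H :: real \<Rightarrow> complex). finite K \<longrightarrow> H \<in> borel_measurable borel \<longrightarrow>
     ennreal (\<Sum>k\<in>K. (cmod (CLINT v|lborel. iexp (of_int k * v) * H v))\<^sup>2)
       \<le> ennreal C * (\<integral>\<^sup>+v. ennreal ((1 + v\<^sup>2) * (cmod (H v))\<^sup>2) \<partial>lborel)"
proof -
  obtain C where C: "C > 0" and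
    bI: "\<And>K (b :: int \<Rightarrow> complex). finite K \<Longrightarrow>
     integrable lborel (\<lambda>v. (cmod (\<Sum>k\<in>K. b k * iexp (of_int k * v)))\<^sup>2 / (1 + v\<^sup>2))" and
    bL: "\<And>K (b :: int \<Rightarrow> complex). finite K \<Longrightarrow>
     (LINT v|lborel. (cmod (\<Sum>k\<in>K. b k * iexp (of_int k * v)))\<^sup>2 / (1 + v\<^sup>2)) \<le> C * (\<Sum>k\<in>K. (cmod (b k))\<^sup>2)"
    using trigonometric_polynomial_cauchy_bound by blast
  have "ennreal (\<Sum>k\<in>K. (cmod (CLINT v|lborel. iexp (of_int k * v) * H v))\<^sup>2)
       \<le> ennreal C * (\<integral>\<^sup>+v. ennreal ((1 + v\<^sup>2) * (cmod (H v))\<^sup>2) \<partial>lborel)"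
    if K: "finite K" and H[measurable]: "H \<in> borel_measurable borel" for K and H :: "real \<Rightarrow> complex"
  proof (cases "(\<integral>\<^sup>+v. ennreal ((1 + v\<^sup>2) * (cmod (H v))\<^sup>2) \<partial>lborel) = \<infinity>")
    case True
    then show ?thesis using C by (simp add: ennreal_mult_top)
  next
    case False
    define W where "W v = (1 + v\<^sup>2) * (cmod (H v))\<^sup>2" for v
    have W0: "W v \<ge> 0" for v by (simp add: W_def)
    have iW: "integrable lborel W"
      unfolding W_def
      by (rule integrableI_nonneg) (use False in \<open>auto simp: less_top\<close>)
    have amgm: "b * cmod (H v) \<le> (b\<^sup>2 / (1 + v\<^sup>2) / C + C * W v) / 2" for b v
    proof -
      have p: "1 + v\<^sup>2 > 0" by (simp add: add_pos_nonneg)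
      \<comment> \<open>this weight gives the term in \<open>b\<close> a total of \<open>S / 2\<close> after integration\<close>
      let ?t = "sqrt ((1 + v\<^sup>2) * C)"
      have t: "?t > 0" using p C by simp
      have "2 * ((b / ?t) * (?t * cmod (H v))) \<le> (b / ?t)\<^sup>2 + (?t * cmod (H v))\<^sup>2"
        using sum_squares_bound[of "b / ?t" "?t * cmod (H v)"] by (simp only: mult.assoc)
      moreover have "(b / ?t) * (?t * cmod (H v)) = b * cmod (H v)"
        using t by (metis less_irrefl mult.assoc nonzero_eq_divide_eq)
      moreover have "(b / ?t)\<^sup>2 = b\<^sup>2 / (1 + v\<^sup>2) / C" using p C by (simp add: power_divide)
      moreover have "(?t * cmod (H v))\<^sup>2 = C * W v" using p C by (simp add: power_mult_distrib W_def)
      ultimately have "2 * (b * cmod (H v)) \<le> b\<^sup>2 / (1 + v\<^sup>2) / C + C * W v"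
        by (simp only:)
      then show ?thesis by (subst pos_le_divide_eq) (simp_all only: mult.commute zero_less_numeral)
    qed
    have iH: "integrable lborel H"
    proof (rule Bochner_Integration.integrable_bound)
      show "integrable lborel (\<lambda>v. (1 / (1 + v\<^sup>2) / C + C * W v) / 2)"
        by (intro integrable_divide Bochner_Integration.integrable_add integrable_mult_right
            integrable_inverse_one_plus_square iW)
      show "AE v in lborel. norm (H v) \<le> norm ((1 / (1 + v\<^sup>2) / C + C * W v) / 2)"
        using amgm[of 1] by (intro AE_I2) (smt (verit) mult_1 power_one real_norm_def)
    qed auto
    define c where "c k = (CLINT v|lborel. iexp (of_int k * v) * H v)" for k :: int
    define S where "S = (\<Sum>k\<in>K. (cmod (c k))\<^sup>2)"
    define B where "B v = (\<Sum>k\<in>K. cnj (c k) * iexp (of_int k * v))" for v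
    have iHe: "integrable lborel (\<lambda>v. iexp (of_int k * v) * H v)" for k :: int
      by (rule Bochner_Integration.integrable_bound[OF iH]) (auto simp: norm_mult)
    have "of_real S = (\<Sum>k\<in>K. cnj (c k) * c k)"
      by (simp only: S_def complex_norm_square of_real_sum mult.commute)
    also have "\<dots> = (CLINT v|lborel. B v * H v)"
    proof -
      have "(CLINT v|lborel. (\<Sum>k\<in>K. cnj (c k) * (iexp (of_int k * v) * H v)))
        = (\<Sum>k\<in>K. CLINT v|lborel. cnj (c k) * (iexp (of_int k * v) * H v))"
        by (rule Bochner_Integration.integral_sum) (intro integrable_mult_right iHe)
      then show ?thesis
        unfolding B_def sum_distrib_right mult.assoc integral_mult_right_zero c_def[symmetric] by (rule sym)
    qed
    finally have Seq: "complex_of_real S = (CLINT v|lborel. B v * H v)" .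
    have "S = cmod (complex_of_real S)"
      unfolding norm_of_real S_def by (rule sym) (intro abs_of_nonneg sum_nonneg zero_le_power2)
    also have "\<dots> = cmod (CLINT v|lborel. B v * H v)" unfolding Seq ..
    also have "\<dots> \<le> (LINT v|lborel. ((cmod (B v))\<^sup>2 / (1 + v\<^sup>2) / C + C * W v) / 2)"
    proof (rule Bochner_Integration.integral_norm_bound_integral)
      show "integrable lborel (\<lambda>v. B v * H v)"
        unfolding B_def sum_distrib_right mult.assoc
        by (intro Bochner_Integration.integrable_sum) (intro integrable_mult_right iHe)
      show "integrable lborel (\<lambda>v. ((cmod (B v))\<^sup>2 / (1 + v\<^sup>2) / C + C * W v) / 2)"
        unfolding B_def
        by (intro integrable_divide Bochner_Integration.integrable_add integrable_mult_right bI K iW)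
    qed (use amgm in \<open>auto simp: norm_mult\<close>)
    also have "\<dots> = ((LINT v|lborel. (cmod (B v))\<^sup>2 / (1 + v\<^sup>2)) / C + C * (LINT v|lborel. W v)) / 2"
      unfolding B_def
      by (simp only: integral_divide_zero Bochner_Integration.integral_add integral_mult_right_zero
          integrable_divide integrable_mult_right bI K iW)
    also have "(LINT v|lborel. (cmod (B v))\<^sup>2 / (1 + v\<^sup>2)) \<le> C * S"
      using bL[OF K, of "\<lambda>k. cnj (c k)"] by (simp add: B_def S_def)
    finally have "S \<le> C * (LINT v|lborel. W v)"
      using C by (simp add: field_simps)
    then have "ennreal S \<le> ennreal (C * (LINT v|lborel. W v))" by (rule ennreal_leI)
    also have "\<dots> = ennreal C * (\<integral>\<^sup>+v. ennreal (W v) \<partial>lborel)"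
      using C iW W0 by (subst nn_integral_eq_integral) (auto simp: ennreal_mult')
    finally show ?thesis by (simp add: S_def W_def c_def)
  qed
  with C show ?thesis by blast
qed

section \<open>Fourier transforms of compactly supported wavelets\<close>

lemma compactly_supported_vanishes:
  assumes "compactly_supported g"
  obtains R where "R > 0" "\<And>x. R \<le> \<bar>x\<bar> \<Longrightarrow> g x = 0"
proof -
  have "bounded (support_on UNIV g)"
    using assms unfolding compactly_supported_def
    by (meson bounded_subset closure_subset compact_imp_bounded)
  then obtain B where B: "\<And>x. g x \<noteq> 0 \<Longrightarrow> \<bar>x\<bar> \<le> B"
    by (auto simp: bounded_iff support_on_def)
  show ?thesis
    by (rule that[of "\<bar>B\<bar> + 1"]) (use B in \<open>force+\<close>)
qed

lemma integrable_continuous_vanishing: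
  fixes g :: "real \<Rightarrow> 'a::euclidean_space"
  assumes cont: "continuous_on UNIV g" and R: "\<And>x. R \<le> \<bar>x\<bar> \<Longrightarrow> g x = 0"
  shows "integrable lborel g"
proof -
  have "integrable lborel (\<lambda>x. indicator {-R..R} x *\<^sub>R g x)"
    by (rule borel_integrable_compact) (use cont continuous_on_subset in auto)
  also have "(\<lambda>x. indicator {-R..R} x *\<^sub>R g x) = g"
    using R by (auto simp: indicator_def fun_eq_iff)
  finally show ?thesis .
qed

text \<open>
  Integration by parts without boundary terms: the derivative of \<open>g x * iexp (u * x)\<close> integrates to 0.
\<close>

lemma fourier_derivative:
  assumes deriv: "\<And>x. (g has_real_derivative g' x) (at x)"
    and cont: "continuous_on UNIV g'"
    and R: "R > 0" "\<And>x. R \<le> \<bar>x\<bar> \<Longrightarrow> g x = 0" "\<And>x. R \<le> \<bar>x\<bar> \<Longrightarrow> g' x = 0"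
  shows "fourier g' u = - (\<i> * of_real u * fourier g u)"
proof -
  let ?F = "\<lambda>x. complex_of_real (g x) * iexp (u * x)"
  let ?f = "\<lambda>x. complex_of_real (g' x) * iexp (u * x) + \<i> * of_real u * (complex_of_real (g x) * iexp (u * x))"
  have cg: "continuous_on UNIV g"
    using deriv by (meson DERIV_isCont continuous_at_imp_continuous_on)
  have "has_bochner_integral lborel (\<lambda>x. indicator {-R..R} x *\<^sub>R ?f x) (?F R - ?F (-R))"
  proof (rule has_bochner_integral_FTC_Icc)
    show "(?F has_vector_derivative ?f x) (at x within {-R..R})" for x
      using has_field_derivative_at_within[OF deriv[of x], of "{-R..R}"]
      by (auto intro!: derivative_eq_intros has_vector_derivative_of_real has_vector_derivative_real_field simp: algebra_simps)
    show "continuous_on {-R..R} ?f"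
      using cont cg by (intro continuous_intros) (auto intro: continuous_on_subset)
  qed (use R in auto)
  moreover have "(\<lambda>x. indicator {-R..R} x *\<^sub>R ?f x) = ?f"
    using R by (auto simp: indicator_def fun_eq_iff)
  ultimately have 0: "(CLINT x|lborel. ?f x) = 0"
    using R by (simp add: has_bochner_integral_iff)
  have "integrable lborel (\<lambda>x. complex_of_real (g' x) * iexp (u * x))"
    by (rule integrable_continuous_vanishing[where R=R]) (use R cont in \<open>auto intro!: continuous_intros\<close>)
  moreover have "integrable lborel (\<lambda>x. complex_of_real (g x) * iexp (u * x))"
    by (rule integrable_continuous_vanishing[where R=R]) (use R cg in \<open>auto intro!: continuous_intros\<close>)
  ultimately have "(CLINT x|lborel. ?f x) = fourier g' u + \<i> * of_real u * fourier g u"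
    by (simp add: fourier_def)
  with 0 show ?thesis by (simp add: eq_neg_iff_add_eq_0)
qed

lemma norm_fourier_le: "cmod (fourier g u) \<le> (LINT x|lborel. \<bar>g x\<bar>)"
  unfolding fourier_def
  by (rule order_trans[OF integral_norm_bound]) (simp add: norm_mult)

text \<open>
  Two integrations by parts give the quadratic decay, which makes the Fourier transform integrable and thereby
  the inversion formula applicable.
\<close>

lemma C2_compact_support_facts:
  assumes "compactly_supported g" "twice_continuously_differentiable g"
  shows "continuous_on UNIV g" and "integrable lborel g" and "\<exists>B. \<forall>x. \<bar>g x\<bar> \<le> B"
    and "\<exists>A>0. \<forall>u. cmod (fourier g u) \<le> A / (1 + u\<^sup>2)"
    and "integrable lborel (fourier g)"
proof -
  obtain R where R: "R > 0" "\<And>x. R \<le> \<bar>x\<bar> \<Longrightarrow> g x = 0"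
    using compactly_supported_vanishes[OF assms(1)] by blast
  obtain g' g'' where g': "\<And>x. (g has_real_derivative g' x) (at x)"
    and g'': "\<And>x. (g' has_real_derivative g'' x) (at x)" and c'': "continuous_on UNIV g''"
    using assms(2) unfolding twice_continuously_differentiable_def by blast
  show cg: "continuous_on UNIV g"
    using g' by (meson DERIV_isCont continuous_at_imp_continuous_on)
  have c': "continuous_on UNIV g'"
    using g'' by (meson DERIV_isCont continuous_at_imp_continuous_on)
  have zero: "h' x = 0" if d: "\<And>x. (h has_real_derivative h' x) (at x)" and z: "\<And>x. r \<le> \<bar>x\<bar> \<Longrightarrow> h x = 0" and x: "r < \<bar>x\<bar>"
    for h h' :: "real \<Rightarrow> real" and r x
  proof -
    have "open {x. r < \<bar>x\<bar>}" by (intro open_Collect_less continuous_intros)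
    then have "((\<lambda>_. 0) has_real_derivative h' x) (at x)"
      by (rule has_field_derivative_transform_within_open[OF d]) (use x z in auto)
    then show ?thesis by (rule DERIV_unique[OF _ DERIV_const])
  qed
  have R1: "\<And>x. R + 1 \<le> \<bar>x\<bar> \<Longrightarrow> g' x = 0"
    by (rule zero[OF g', of R]) (use R in auto)
  have R2: "\<And>x. R + 2 \<le> \<bar>x\<bar> \<Longrightarrow> g'' x = 0"
    by (rule zero[OF g'', of "R + 1"]) (use R1 in auto)
  show ig: "integrable lborel g" by (rule integrable_continuous_vanishing[OF cg]) (use R in auto)
  show "\<exists>B. \<forall>x. \<bar>g x\<bar> \<le> B"
  proof -
    have "compact (g ` {-R..R})"
      using cg by (intro compact_continuous_image) (auto intro: continuous_on_subset)
    then obtain B where B: "\<And>x. x \<in> {-R..R} \<Longrightarrow> \<bar>g x\<bar> \<le> B"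
      using compact_imp_bounded[of "g ` {-R..R}"] unfolding bounded_iff by (metis imageI real_norm_def)
    show ?thesis
    proof (intro exI allI)
      fix x show "\<bar>g x\<bar> \<le> max B 0"
        using B[of x] R(2)[of x] by (cases "x \<in> {-R..R}") (auto simp: abs_le_iff)
    qed
  qed
  have f1: "fourier g' u = - (\<i> * of_real u * fourier g u)" for u
    by (rule fourier_derivative[where R="R+1"]) (use g' c' R R1 in auto)
  have f2: "fourier g'' u = - (\<i> * of_real u * fourier g' u)" for u
    by (rule fourier_derivative[where R="R+2"]) (use g'' c'' R R1 R2 in auto)
  define A where "A = (LINT x|lborel. \<bar>g x\<bar>) + (LINT x|lborel. \<bar>g'' x\<bar>) + 1"
  have A0: "A > 0" unfolding A_def by (intro add_nonneg_pos add_nonneg_nonneg) auto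
  have dec: "cmod (fourier g u) \<le> A / (1 + u\<^sup>2)" for u
  proof -
    have "u\<^sup>2 * cmod (fourier g u) = cmod (fourier g'' u)"
      by (simp add: f2 f1 norm_mult power2_eq_square)
    then have "(1 + u\<^sup>2) * cmod (fourier g u) \<le> A"
      using norm_fourier_le[of g u] norm_fourier_le[of g'' u] by (simp add: A_def ring_distribs)
    moreover have "1 + u\<^sup>2 > 0" by (simp add: add_pos_nonneg)
    ultimately show ?thesis by (simp add: field_simps)
  qed
  then show "\<exists>A>0. \<forall>u. cmod (fourier g u) \<le> A / (1 + u\<^sup>2)" using A0 by blast
  show "integrable lborel (fourier g)"
  proof (rule Bochner_Integration.integrable_bound)
    show "integrable lborel (\<lambda>u. A * (1 / (1 + u\<^sup>2)))"
      by (intro integrable_mult_right integrable_inverse_one_plus_square)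
    show "AE u in lborel. cmod (fourier g u) \<le> norm (A * (1 / (1 + u\<^sup>2)))"
      by (intro AE_I2 order_trans[OF dec]) (use A0 in simp)
  qed (use cg in auto)
qed

text \<open>
  The vanishing moments allow the Taylor polynomial of \<open>iexp (u * x)\<close> of degree below \<open>m\<close> to be subtracted
  under the integral; the remainder of the exponential is at most \<open>\<bar>u * x\<bar> ^ m\<close>.
\<close>

lemma fourier_vanishing_moments:
  assumes "compactly_supported g" "continuous_on UNIV g" "vanishing_moments g m"
  shows "\<exists>A>0. \<forall>u. cmod (fourier g u) \<le> A * \<bar>u\<bar> ^ m"
proof (cases m)
  case 0
  show ?thesis
  proof (intro exI conjI allI)
    have nn: "(LINT x|lborel. \<bar>g x\<bar>) \<ge> 0" by simp
    then show "(LINT x|lborel. \<bar>g x\<bar>) + 1 > 0" by linarith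
    show "cmod (fourier g u) \<le> ((LINT x|lborel. \<bar>g x\<bar>) + 1) * \<bar>u\<bar> ^ m" for u
      using norm_fourier_le[of g u] 0 by simp
  qed
next
  case (Suc n)
  obtain R where R: "R > 0" "\<And>x. R \<le> \<bar>x\<bar> \<Longrightarrow> g x = 0"
    using compactly_supported_vanishes[OF assms(1)] by blast
  have ig: "integrable lborel (\<lambda>x. \<bar>g x\<bar> * \<bar>x\<bar> ^ m)"
    by (rule integrable_continuous_vanishing[where R=R]) (use R assms(2) in \<open>auto intro!: continuous_intros\<close>)
  have ige: "integrable lborel (\<lambda>x. complex_of_real (g x) * iexp (u * x))" for u
    by (rule integrable_continuous_vanishing[where R=R]) (use R assms(2) in \<open>auto intro!: continuous_intros\<close>)
  define A where "A = (LINT x|lborel. \<bar>g x\<bar> * \<bar>x\<bar> ^ m)"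
  have A0: "A \<ge> 0" by (simp add: A_def)
  have "cmod (fourier g u) \<le> A * \<bar>u\<bar> ^ m" for u
  proof -
    have mom: "integrable lborel (\<lambda>x. x ^ r * g x)" "(LINT x|lborel. x ^ r * g x) = 0" if "r \<le> n" for r
      using assms(3) that Suc by (auto simp: vanishing_moments_def has_bochner_integral_iff)
    let ?T = "\<lambda>x. (\<Sum>k\<le>n. (\<i> * complex_of_real u) ^ k / fact k * complex_of_real (x ^ k * g x))"
    have iT: "integrable lborel ?T"
      by (intro Bochner_Integration.integrable_sum integrable_mult_right integrable_of_real mom) auto
    have "(CLINT x|lborel. ?T x) = 0"
      by (subst Bochner_Integration.integral_sum)
         (auto intro!: sum.neutral integrable_mult_right integrable_of_real mom
               simp: mom integral_complex_of_real simp del: of_real_mult of_real_power)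
    then have "fourier g u = (CLINT x|lborel. complex_of_real (g x) * iexp (u * x) - ?T x)"
      unfolding fourier_def using ige iT by simp
    also have "cmod \<dots> \<le> (LINT x|lborel. \<bar>g x\<bar> * \<bar>x\<bar> ^ m * \<bar>u\<bar> ^ m)"
    proof (rule Bochner_Integration.integral_norm_bound_integral)
      fix x
      have "complex_of_real (g x) * iexp (u * x) - ?T x =
        complex_of_real (g x) * (iexp (u * x) - (\<Sum>k\<le>n. (\<i> * (u * x)) ^ k / fact k))"
        by (simp add: algebra_simps sum_distrib_left power_mult_distrib)
      also have "cmod \<dots> \<le> \<bar>g x\<bar> * (\<bar>u * x\<bar> ^ Suc n / fact (Suc n))"
        unfolding norm_mult by (intro mult_mono iexp_approx1) auto
      also have "\<dots> \<le> \<bar>g x\<bar> * \<bar>u * x\<bar> ^ Suc n"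
      proof (rule mult_left_mono)
        have "\<bar>u * x\<bar> ^ Suc n * 1 \<le> \<bar>u * x\<bar> ^ Suc n * fact (Suc n)"
          by (rule mult_left_mono) (rule fact_ge_1, simp)
        then show "\<bar>u * x\<bar> ^ Suc n / fact (Suc n) \<le> \<bar>u * x\<bar> ^ Suc n"
          by (subst pos_divide_le_eq) (rule fact_gt_zero, simp only: mult_1_right)
      qed simp
      finally show "cmod (complex_of_real (g x) * iexp (u * x) - ?T x) \<le> \<bar>g x\<bar> * \<bar>x\<bar> ^ m * \<bar>u\<bar> ^ m"
        by (simp add: Suc abs_mult power_mult_distrib mult_ac)
    qed (use ige iT ig in auto)
    finally show ?thesis by (simp add: A_def)
  qed
  then have "cmod (fourier g u) \<le> (A + 1) * \<bar>u\<bar> ^ m" for u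
    by (rule order_trans) (simp add: mult_right_mono)
  with A0 show ?thesis by (intro exI[of _ "A + 1"]) auto
qed

text \<open>
  The vanishing moments give the bound near 0, the quadratic decay at infinity. The point 0 is excluded
  because \<open>0 powr 0 = 0\<close>, whereas for \<open>s = 0\<close> the transform of \<open>g\<close> may differ from 0 there.
\<close>

lemma wavelet_fourier_weight_bound:
  assumes g: "compactly_supported g" "twice_continuously_differentiable g" "vanishing_moments g m"
    and s: "0 \<le> s" "s \<le> real m"
  shows "\<exists>A>0. \<forall>v. v \<noteq> 0 \<longrightarrow> (1 + v\<^sup>2) * (cmod (fourier g v))\<^sup>2 \<le> A * \<bar>v\<bar> powr (2 * s)"
proof -
  obtain A where A: "A > 0" "\<And>u. cmod (fourier g u) \<le> A / (1 + u\<^sup>2)"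
    using C2_compact_support_facts(4)[OF g(1,2)] by blast
  obtain B where B: "B > 0" "\<And>u. cmod (fourier g u) \<le> B * \<bar>u\<bar> ^ m"
    using fourier_vanishing_moments[OF g(1) C2_compact_support_facts(1)[OF g(1,2)] g(3)] by blast
  have "(1 + v\<^sup>2) * (cmod (fourier g v))\<^sup>2 \<le> (A\<^sup>2 + 2 * B\<^sup>2) * \<bar>v\<bar> powr (2 * s)" if v: "v \<noteq> 0" for v
  proof (cases "\<bar>v\<bar> \<ge> 1")
    case True
    have p: "1 + v\<^sup>2 > 0" by (simp add: add_pos_nonneg)
    have "(1 + v\<^sup>2) * (cmod (fourier g v))\<^sup>2 \<le> (1 + v\<^sup>2) * (A / (1 + v\<^sup>2))\<^sup>2"
      using p by (intro mult_left_mono power_mono A) auto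
    also have "\<dots> = A\<^sup>2 / (1 + v\<^sup>2)" using p by (simp add: power2_eq_square)
    also have "\<dots> \<le> A\<^sup>2 / 1" by (rule divide_left_mono) (use p in auto)
    also have "\<dots> \<le> A\<^sup>2 * \<bar>v\<bar> powr (2 * s)"
      using ge_one_powr_ge_zero[of "\<bar>v\<bar>" "2 * s"] True s by (simp add: mult_le_cancel_left1)
    also have "\<dots> \<le> (A\<^sup>2 + 2 * B\<^sup>2) * \<bar>v\<bar> powr (2 * s)" by (intro mult_right_mono) auto
    finally show ?thesis .
  next
    case False
    have "v\<^sup>2 \<le> 1" using False by (simp add: abs_square_le_1)
    then have "(1 + v\<^sup>2) * (cmod (fourier g v))\<^sup>2 \<le> 2 * (B * \<bar>v\<bar> ^ m)\<^sup>2"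
      by (intro mult_mono power_mono B) auto
    also have "\<dots> = 2 * B\<^sup>2 * \<bar>v\<bar> powr (2 * real m)"
    proof -
      have "\<bar>v\<bar> powr (2 * real m) = \<bar>v\<bar> powr real (m * 2)" by (simp add: mult.commute)
      also have "\<dots> = (\<bar>v\<bar> ^ m)\<^sup>2" using v by (subst powr_realpow) (simp_all add: power_mult)
      finally show ?thesis by (simp only: power_mult_distrib mult.assoc)
    qed
    also have "\<dots> \<le> 2 * B\<^sup>2 * \<bar>v\<bar> powr (2 * s)"
      using False s v by (intro mult_left_mono powr_mono') auto
    also have "\<dots> \<le> (A\<^sup>2 + 2 * B\<^sup>2) * \<bar>v\<bar> powr (2 * s)" by (intro mult_right_mono) auto
    finally show ?thesis .
  qed
  then show ?thesis using A(1) by (intro exI[of _ "A\<^sup>2 + 2 * B\<^sup>2"]) (auto intro!: add_pos_nonneg)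
qed

lemma fourier_dilate:
  "fourier (dilate g j k) u = of_real (2 powr (- real_of_int j / 2)) * iexp (of_int k * (u / 2 powr j)) * fourier g (u / 2 powr j)"
proof -
  let ?p = "2 powr real_of_int j"
  have p: "?p > 0" by simp
  have "fourier (dilate g j k) u = \<bar>inverse ?p\<bar> *\<^sub>R (CLINT y|lborel. of_real (dilate g j k (of_int k / ?p + inverse ?p * y)) * iexp (u * (of_int k / ?p + inverse ?p * y)))"
    unfolding fourier_def by (rule lborel_integral_real_affine) simp
  also have "(\<lambda>y. complex_of_real (dilate g j k (of_int k / ?p + inverse ?p * y)) * iexp (u * (of_int k / ?p + inverse ?p * y)))
     = (\<lambda>y. (of_real (2 powr (real_of_int j / 2)) * iexp (of_int k * (u / ?p))) * (of_real (g y) * iexp (u / ?p * y)))"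
  proof
    fix y
    have 1: "?p * (of_int k / ?p + inverse ?p * y) - of_int k = y"
      using p by (simp add: field_simps)
    have 2: "iexp (u * (of_int k / ?p + inverse ?p * y)) = iexp (of_int k * (u / ?p)) * iexp (u / ?p * y)"
      by (simp add: field_simps flip: exp_add)
    show "complex_of_real (dilate g j k (of_int k / ?p + inverse ?p * y)) * iexp (u * (of_int k / ?p + inverse ?p * y))
      = (of_real (2 powr (real_of_int j / 2)) * iexp (of_int k * (u / ?p))) * (of_real (g y) * iexp (u / ?p * y))"
      unfolding dilate_def 1 2 by simp
  qed
  also have "\<bar>inverse ?p\<bar> *\<^sub>R (CLINT y|lborel. (of_real (2 powr (real_of_int j / 2)) * iexp (of_int k * (u / ?p))) * (of_real (g y) * iexp (u / ?p * y)))
     = of_real (inverse ?p * 2 powr (real_of_int j / 2)) * iexp (of_int k * (u / ?p)) * fourier g (u / ?p)"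
    by (simp add: fourier_def scaleR_conv_of_real)
  also have "inverse ?p * 2 powr (real_of_int j / 2) = 2 powr (- real_of_int j / 2)"
    by (simp flip: powr_minus powr_add)
  finally show ?thesis .
qed

text \<open>
  After the substitution \<open>u = 2\<^sup>j v\<close> the translation by \<open>k\<close> appears only as the factor \<open>iexp (k v)\<close>, so the
  coefficients of one level are integer samples of one Fourier integral. The weight \<open>1 + v\<^sup>2\<close> of the
  sampling inequality is absorbed by the transform of \<open>g\<close>.
\<close>

lemma wavelet_coefficients_bound:
  assumes g: "compactly_supported g" "twice_continuously_differentiable g" "vanishing_moments g m"
    and s: "0 \<le> s" "s \<le> real m"
  shows "\<exists>C>0. \<forall>j K (D :: real \<Rightarrow> complex). finite K \<longrightarrow> D \<in> borel_measurable borel \<longrightarrow>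
     ennreal (\<Sum>k\<in>K. (cmod (fourier_pairing (dilate g j k) D))\<^sup>2)
       \<le> ennreal (C * 2 powr (- 2 * real_of_int j * s)) * weighted_energy s D"
proof -
  obtain A where A: "A > 0" "\<And>v. v \<noteq> 0 \<Longrightarrow> (1 + v\<^sup>2) * (cmod (fourier g v))\<^sup>2 \<le> A * \<bar>v\<bar> powr (2 * s)"
    using wavelet_fourier_weight_bound[OF assms] by blast
  obtain C where C: "C > 0" "\<And>K (H :: real \<Rightarrow> complex). finite K \<Longrightarrow> H \<in> borel_measurable borel \<Longrightarrow>
     ennreal (\<Sum>k\<in>K. (cmod (CLINT v|lborel. iexp (of_int k * v) * H v))\<^sup>2)
       \<le> ennreal C * (\<integral>\<^sup>+v. ennreal ((1 + v\<^sup>2) * (cmod (H v))\<^sup>2) \<partial>lborel)"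
    using sampled_fourier_bound by blast
  have [measurable]: "g \<in> borel_measurable borel"
    using C2_compact_support_facts(1)[OF g(1,2)] by measurable
  have "ennreal (\<Sum>k\<in>K. (cmod (fourier_pairing (dilate g j k) D))\<^sup>2)
       \<le> ennreal (C * A * 2 powr (- 2 * real_of_int j * s)) * weighted_energy s D"
    if K: "finite K" and [measurable]: "D \<in> borel_measurable borel" for j :: int and K and D :: "real \<Rightarrow> complex"
  proof -
    define p where "p = 2 powr real_of_int j"
    have p: "p > 0" by (simp add: p_def)
    define H where "H v = fourier g v * D (p * v)" for v
    have [measurable]: "H \<in> borel_measurable borel" unfolding H_def by measurable
    have co: "(fourier_pairing (dilate g j k) D) = of_real (2 powr (real_of_int j / 2)) * (CLINT v|lborel. iexp (of_int k * v) * H v)" for k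
    proof -
      have "(fourier_pairing (dilate g j k) D) = \<bar>p\<bar> *\<^sub>R (CLINT v|lborel. fourier (dilate g j k) (0 + p * v) * D (0 + p * v))"
        by (rule lborel_integral_real_affine) (use p in simp)
      also have "(CLINT v|lborel. fourier (dilate g j k) (0 + p * v) * D (0 + p * v)) =
         (CLINT v|lborel. of_real (2 powr (- real_of_int j / 2)) * (iexp (of_int k * v) * H v))"
        using p by (intro Bochner_Integration.integral_cong refl) (simp add: fourier_dilate H_def mult_ac flip: p_def)
      also have "\<bar>p\<bar> *\<^sub>R \<dots> = of_real (p * 2 powr (- real_of_int j / 2)) * (CLINT v|lborel. iexp (of_int k * v) * H v)"
        using p by (simp add: scaleR_conv_of_real)
      also have "p * 2 powr (- real_of_int j / 2) = 2 powr (real_of_int j / 2)"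
        by (simp add: p_def flip: powr_add)
      finally show ?thesis .
    qed
    have pp: "(2 powr (real_of_int j / 2))\<^sup>2 = p"
      by (simp add: p_def power2_eq_square flip: powr_add)
    define Z where "Z = (\<integral>\<^sup>+v. ennreal (\<bar>v\<bar> powr (2 * s) * (cmod (D (p * v)))\<^sup>2) \<partial>lborel)"
    have "(\<Sum>k\<in>K. (cmod (fourier_pairing (dilate g j k) D))\<^sup>2) = p * (\<Sum>k\<in>K. (cmod (CLINT v|lborel. iexp (of_int k * v) * H v))\<^sup>2)"
      by (simp only: co norm_mult norm_of_real abs_of_nonneg[OF powr_ge_zero] power_mult_distrib pp sum_distrib_left)
    then have "ennreal (\<Sum>k\<in>K. (cmod (fourier_pairing (dilate g j k) D))\<^sup>2)
      = ennreal p * ennreal (\<Sum>k\<in>K. (cmod (CLINT v|lborel. iexp (of_int k * v) * H v))\<^sup>2)"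
      using p by (simp add: ennreal_mult')
    also have "\<dots> \<le> ennreal p * (ennreal C * (\<integral>\<^sup>+v. ennreal ((1 + v\<^sup>2) * (cmod (H v))\<^sup>2) \<partial>lborel))"
      by (intro mult_left_mono C K) auto
    also have "\<dots> \<le> ennreal p * (ennreal C * (\<integral>\<^sup>+v. ennreal A * ennreal (\<bar>v\<bar> powr (2 * s) * (cmod (D (p * v)))\<^sup>2) \<partial>lborel))"
    proof (intro mult_left_mono nn_integral_mono_AE)
      show "AE v in lborel. ennreal ((1 + v\<^sup>2) * (cmod (H v))\<^sup>2) \<le> ennreal A * ennreal (\<bar>v\<bar> powr (2 * s) * (cmod (D (p * v)))\<^sup>2)"
        using AE_lborel_singleton[of 0]
      proof eventually_elim
        case (elim v)
        have "(1 + v\<^sup>2) * (cmod (H v))\<^sup>2 = ((1 + v\<^sup>2) * (cmod (fourier g v))\<^sup>2) * (cmod (D (p * v)))\<^sup>2"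
          by (simp add: H_def norm_mult power_mult_distrib)
        also have "\<dots> \<le> (A * \<bar>v\<bar> powr (2 * s)) * (cmod (D (p * v)))\<^sup>2"
          using elim by (intro mult_right_mono A) auto
        finally show ?case using A(1) by (simp add: mult.assoc ennreal_leI flip: ennreal_mult')
      qed
    qed auto
    also have "(\<integral>\<^sup>+v. ennreal A * ennreal (\<bar>v\<bar> powr (2 * s) * (cmod (D (p * v)))\<^sup>2) \<partial>lborel) = ennreal A * Z"
      unfolding Z_def by (rule nn_integral_cmult) measurable
    finally have le: "ennreal (\<Sum>k\<in>K. (cmod (fourier_pairing (dilate g j k) D))\<^sup>2)
        \<le> ennreal p * (ennreal C * (ennreal A * Z))" .
    have pZ: "ennreal p * Z = ennreal (2 powr (- 2 * real_of_int j * s)) * weighted_energy s D"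
    proof -
      have "weighted_energy s D
        = ennreal \<bar>p\<bar> * (\<integral>\<^sup>+v. ennreal (\<bar>0 + p * v\<bar> powr (2 * s) * (cmod (D (0 + p * v)))\<^sup>2) \<partial>lborel)"
        by (rule nn_integral_real_affine) (use p in auto)
      also have "(\<integral>\<^sup>+v. ennreal (\<bar>0 + p * v\<bar> powr (2 * s) * (cmod (D (0 + p * v)))\<^sup>2) \<partial>lborel)
        = (\<integral>\<^sup>+v. ennreal (p powr (2 * s)) * ennreal (\<bar>v\<bar> powr (2 * s) * (cmod (D (p * v)))\<^sup>2) \<partial>lborel)"
        using p by (intro nn_integral_cong) (simp add: abs_mult powr_mult mult_ac flip: ennreal_mult')
      also have "\<dots> = ennreal (p powr (2 * s)) * Z"
        unfolding Z_def by (rule nn_integral_cmult) measurable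
      finally have e: "weighted_energy s D = ennreal p * (ennreal (p powr (2 * s)) * Z)"
        using p by simp
      have "ennreal (2 powr (- 2 * real_of_int j * s)) * ennreal (p powr (2 * s)) = ennreal 1"
        by (simp add: p_def powr_powr mult_ac flip: ennreal_mult' powr_add)
      then have "ennreal p * Z = ennreal p * ((ennreal (2 powr (- 2 * real_of_int j * s)) * ennreal (p powr (2 * s))) * Z)"
        by simp
      then show ?thesis unfolding e by (simp only: mult_ac)
    qed
    note le
    also have "ennreal p * (ennreal C * (ennreal A * Z)) = ennreal (C * A * 2 powr (- 2 * real_of_int j * s)) * weighted_energy s D"
      using C(1) A(1) pZ by (simp add: ennreal_mult' mult.left_commute mult.assoc)
    finally show ?thesis .
  qed
  moreover have "C * A > 0" using C A by simp
  ultimately show ?thesis by blast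
qed

lemma square_le_of_eq_inverse_two_pi:
  assumes "complex_of_real x = of_real (1 / (2 * pi)) * z"
  shows "x\<^sup>2 \<le> (cmod z)\<^sup>2"
proof -
  have "\<bar>x\<bar> = cmod (complex_of_real x)" by (simp only: norm_of_real)
  also have "\<dots> = \<bar>1 / (2 * pi)\<bar> * cmod z"
    unfolding assms norm_mult norm_of_real ..
  also have "\<dots> \<le> 1 * cmod z"
    using pi_gt3 by (intro mult_right_mono) (auto simp: field_simps)
  finally have "\<bar>x\<bar>\<^sup>2 \<le> (cmod z)\<^sup>2" by (intro power_mono) auto
  then show ?thesis by simp
qed

lemma (in prob_space) expectation_fourier:
  assumes g: "compactly_supported g" "twice_continuously_differentiable g"
    and [measurable]: "X \<in> borel_measurable M"
  shows "of_real (expectation (\<lambda>\<omega>. g (X \<omega>)))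
    = of_real (1 / (2 * pi)) * (CLINT u|lborel. fourier g u * (CLINT \<omega>|M. iexp (- (u * X \<omega>))))"
proof -
  obtain B where B: "\<And>x. \<bar>g x\<bar> \<le> B" using C2_compact_support_facts(3)[OF g] by blast
  note F = C2_compact_support_facts[OF g]
  have "of_real (2 * pi) * complex_of_real (expectation (\<lambda>\<omega>. g (X \<omega>))) = (CLINT \<omega>|M. of_real (2 * pi * g (X \<omega>)))"
    by (simp only: integral_complex_of_real of_real_mult[symmetric] integral_mult_right_zero)
  also have "\<dots> = (CLINT \<omega>|M. 1 * (CLINT u|lborel. fourier g u * iexp (- (u * X \<omega>))))"
    using fourier_inversion[OF F(1,2) B F(5)] by simp
  also have "\<dots> = (CLINT u|lborel. fourier g u * (CLINT \<omega>|M. 1 * iexp (- (u * X \<omega>))))"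
    by (rule Fubini_bounded_kernel)
       (use F(5) in \<open>auto simp: sigma_finite_lborel sigma_finite_measure_axioms\<close>)
  finally show ?thesis by (simp add: field_simps)
qed

section \<open>Characteristic functions of linear processes\<close>

lemma (in prob_space) bounded_integrable:
  fixes X :: "'a \<Rightarrow> 'b::{banach,second_countable_topology}"
  assumes "X \<in> borel_measurable M" "\<And>\<omega>. norm (X \<omega>) \<le> B"
  shows "integrable M X"
  using assms by (intro integrable_const_bound[of _ B]) auto

lemma (in prob_space) abs_expectation_le:
  fixes X :: "'a \<Rightarrow> real"
  assumes "X \<in> borel_measurable M" "\<And>\<omega>. \<bar>X \<omega>\<bar> \<le> B"
  shows "\<bar>expectation X\<bar> \<le> B"
proof -
  have "\<bar>expectation X\<bar> \<le> expectation (\<lambda>\<omega>. \<bar>X \<omega>\<bar>)"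
    using Bochner_Integration.integral_norm_bound[of M X] by simp
  also have "\<dots> \<le> expectation (\<lambda>_. B)"
    by (rule Bochner_Integration.integral_mono) (use assms in \<open>auto intro!: bounded_integrable[where B=B]\<close>)
  finally show ?thesis by (simp add: prob_space)
qed

lemma cnj_borel_measurable [measurable (raw)]:
  "f \<in> borel_measurable M \<Longrightarrow> (\<lambda>x. cnj (f x)) \<in> borel_measurable M"
  by (rule measurable_compose[OF _ borel_measurable_continuous_onI]) (auto intro: continuous_intros)

lemma (in prob_space) complex_covariance:
  fixes X Y :: "'a \<Rightarrow> complex"
  assumes [measurable]: "X \<in> borel_measurable M" "Y \<in> borel_measurable M"
    and b: "\<And>\<omega>. norm (X \<omega>) \<le> 1" "\<And>\<omega>. norm (Y \<omega>) \<le> 1"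
  shows "(CLINT \<omega>|M. (X \<omega> - (CLINT \<omega>|M. X \<omega>)) * cnj (Y \<omega> - (CLINT \<omega>|M. Y \<omega>)))
    = (CLINT \<omega>|M. X \<omega> * cnj (Y \<omega>)) - (CLINT \<omega>|M. X \<omega>) * cnj (CLINT \<omega>|M. Y \<omega>)"
proof -
  have i: "integrable M X" "integrable M (\<lambda>\<omega>. cnj (Y \<omega>))" "integrable M (\<lambda>\<omega>. X \<omega> * cnj (Y \<omega>))"
    using b by (auto intro!: bounded_integrable[where B=1] simp: norm_mult mult_le_one)
  define x y where "x = (CLINT \<omega>|M. X \<omega>)" and "y = cnj (CLINT \<omega>|M. Y \<omega>)"
  have "(CLINT \<omega>|M. (X \<omega> - x) * (cnj (Y \<omega>) - y)) = (CLINT \<omega>|M. X \<omega> * cnj (Y \<omega>) - x * cnj (Y \<omega>) - X \<omega> * y + x * y)"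
    by (intro Bochner_Integration.integral_cong refl) (simp add: algebra_simps)
  also have "\<dots> = (CLINT \<omega>|M. X \<omega> * cnj (Y \<omega>)) - x * y - x * y + x * y"
    using i by (simp add: prob_space y_def flip: x_def)
  finally show ?thesis by (simp add: x_def y_def)
qed

text \<open>
  The joint law of independent variables is a product measure, so this is Fubini's theorem. Both variables take values
  in one type because \<open>indep_var\<close> requires it.
\<close>

lemma (in prob_space) indep_var_iterated_integral:
  fixes F :: "'b \<times> 'b \<Rightarrow> real"
  assumes ind: "indep_var S A T B" and F[measurable]: "F \<in> borel_measurable (S \<Otimes>\<^sub>M T)"
    and bound: "\<And>x. \<bar>F x\<bar> \<le> C"
  shows "expectation (\<lambda>\<omega>. F (A \<omega>, B \<omega>)) = expectation (\<lambda>\<omega>. expectation (\<lambda>\<omega>'. F (A \<omega>, B \<omega>')))"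
proof -
  have [measurable]: "A \<in> measurable M S" "B \<in> measurable M T"
    using ind by (auto dest: indep_var_rv1 indep_var_rv2)
  interpret A: prob_space "distr M S A" by (rule prob_space_distr) simp
  interpret B: prob_space "distr M T B" by (rule prob_space_distr) simp
  interpret AB: pair_prob_space "distr M S A" "distr M T B" ..
  have "expectation (\<lambda>\<omega>. F (A \<omega>, B \<omega>)) = (LINT z|distr M (S \<Otimes>\<^sub>M T) (\<lambda>\<omega>. (A \<omega>, B \<omega>)). F z)"
    by (subst integral_distr) auto
  also have "distr M (S \<Otimes>\<^sub>M T) (\<lambda>\<omega>. (A \<omega>, B \<omega>)) = distr M S A \<Otimes>\<^sub>M distr M T B"
    using ind by (simp add: indep_var_distribution_eq)
  also have "(LINT z|\<dots>. F z) = (LINT x|distr M S A. LINT y|distr M T B. F (x, y))"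
    by (rule AB.integral_fst'[symmetric])
       (use bound in \<open>auto intro!: AB.P.integrable_const_bound[of _ C]\<close>)
  also have "\<dots> = (LINT x|distr M S A. expectation (\<lambda>\<omega>'. F (x, B \<omega>')))"
    by (intro Bochner_Integration.integral_cong refl) (subst integral_distr, auto)
  also have "\<dots> = expectation (\<lambda>\<omega>. expectation (\<lambda>\<omega>'. F (A \<omega>, B \<omega>')))"
    by (subst integral_distr) auto
  finally show ?thesis .
qed

locale iid_innovations = prob_space P for P :: "'w measure" +
  fixes \<epsilon> :: "int \<Rightarrow> 'w \<Rightarrow> real"
  assumes iid: "iid P \<epsilon>"
begin

abbreviation cf :: "real \<Rightarrow> complex" where
  "cf \<equiv> char (distr P borel (\<epsilon> 1))"

lemma indep: "indep_vars (\<lambda>_. borel) \<epsilon> UNIV"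
  using iid by (simp add: iid_def)

lemma innovation_measurable [measurable]: "\<epsilon> r \<in> borel_measurable P"
  using indep by (auto simp: indep_vars_def)

lemma expectation_innovation:
  fixes h :: "real \<Rightarrow> 'b::{banach, second_countable_topology}"
  assumes [measurable]: "h \<in> borel_measurable borel"
  shows "(LINT \<omega>|P. h (\<epsilon> r \<omega>)) = (LINT \<omega>|P. h (\<epsilon> 1 \<omega>))"
proof -
  have "(LINT \<omega>|P. h (\<epsilon> r \<omega>)) = (LINT x|distr P borel (\<epsilon> r). h x)" for r
    by (subst integral_distr) auto
  moreover have "distr P borel (\<epsilon> r) = distr P borel (\<epsilon> 1)"
    using iid by (simp add: iid_def)
  ultimately show ?thesis by metis
qed

lemma cf_eq: "(CLINT \<omega>|P. iexp (u * \<epsilon> r \<omega>)) = cf u"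
proof -
  have "(CLINT \<omega>|P. iexp (u * \<epsilon> r \<omega>)) = (CLINT \<omega>|P. iexp (u * \<epsilon> 1 \<omega>))"
    by (rule expectation_innovation) measurable
  also have "\<dots> = cf u" unfolding char_def by (subst integral_distr) auto
  finally show ?thesis .
qed

lemma real_distribution_innovation: "real_distribution (distr P borel (\<epsilon> 1))"
  by (simp add: real_distribution_distr)

lemma norm_cf_le: "cmod (cf u) \<le> 1"
  using real_distribution.cmod_char_le_1[OF real_distribution_innovation] .

lemma cf_measurable [measurable]: "cf \<in> borel_measurable borel"
  using real_distribution.char_measurable[OF real_distribution_innovation] .

lemma cf_0: "cf 0 = 1"
  using real_distribution.char_zero[OF real_distribution_innovation] .

lemma cf_uminus: "cf (- u) = cnj (cf u)"
proof -
  have "cf (- u) = (CLINT \<omega>|P. cnj (iexp (u * \<epsilon> 1 \<omega>)))"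
    unfolding cf_eq[of "- u" 1, symmetric] by (simp add: exp_cnj)
  also have "\<dots> = cnj (cf u)"
    unfolding cf_eq[of u 1, symmetric] by (simp del: exp_cnj)
  finally show ?thesis .
qed

lemma cf_linear_combination:
  assumes "finite R"
  shows "(CLINT \<omega>|P. iexp (u * (\<Sum>r\<in>R. d r * \<epsilon> r \<omega>))) = (\<Prod>r\<in>R. cf (u * d r))"
proof -
  have ind: "indep_vars (\<lambda>_. borel) (\<lambda>r \<omega>. iexp (u * d r * \<epsilon> r \<omega>)) R"
    by (rule indep_vars_compose2[OF indep_vars_subset[OF indep]]) auto
  have "(CLINT \<omega>|P. iexp (u * (\<Sum>r\<in>R. d r * \<epsilon> r \<omega>))) = (CLINT \<omega>|P. (\<Prod>r\<in>R. iexp (u * d r * \<epsilon> r \<omega>)))"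
    by (intro Bochner_Integration.integral_cong refl)
       (simp add: sum_distrib_left mult.assoc exp_sum[OF assms])
  also have "\<dots> = (\<Prod>r\<in>R. CLINT \<omega>|P. iexp (u * d r * \<epsilon> r \<omega>))"
    by (rule indep_vars_lebesgue_integral[OF assms ind])
       (auto intro!: bounded_integrable[where B=1])
  finally show ?thesis by (simp only: cf_eq)
qed

lemma variance_iexp_innovation:
  "(LINT \<omega>|P. (cmod (iexp (u * \<epsilon> r \<omega>) - cf u))\<^sup>2) = 1 - (cmod (cf u))\<^sup>2"
proof -
  have "complex_of_real (LINT \<omega>|P. (cmod (iexp (u * \<epsilon> r \<omega>) - cf u))\<^sup>2)
      = (CLINT \<omega>|P. (iexp (u * \<epsilon> r \<omega>) - cf u) * cnj (iexp (u * \<epsilon> r \<omega>) - cf u))"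
    unfolding integral_complex_of_real[symmetric] complex_norm_square ..
  also have "\<dots> = (CLINT \<omega>|P. iexp (u * \<epsilon> r \<omega>) * cnj (iexp (u * \<epsilon> r \<omega>))) - cf u * cnj (cf u)"
    using complex_covariance[of "\<lambda>\<omega>. iexp (u * \<epsilon> r \<omega>)" "\<lambda>\<omega>. iexp (u * \<epsilon> r \<omega>)"]
    by (simp only: cf_eq) simp
  also have "\<dots> = of_real (1 - (cmod (cf u))\<^sup>2)"
  proof -
    have "iexp x * cnj (iexp x) = 1" for x by (simp add: exp_cnj flip: exp_add)
    then show ?thesis by (simp only: complex_norm_square[symmetric]) (simp add: prob_space)
  qed
  finally show ?thesis by (simp only: of_real_eq_iff)
qed

text \<open>
  The difference is the covariance of \<open>iexp (u * d * \<epsilon> 1)\<close> and \<open>iexp (u * e * \<epsilon> 1)\<close>, so that it is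
  bounded by the product of the two standard deviations. This product is reached by the arithmetic-geometric
  mean inequality with the optimal weight \<open>b / a\<close>; when one of \<open>u\<close>, \<open>d\<close>, \<open>e\<close> is 0, the weight degenerates but
  the covariance is 0.
\<close>

lemma cf_covariance_bound:
  assumes var: "\<And>u. 1 - (cmod (cf u))\<^sup>2 \<le> c * \<bar>u\<bar> powr (2 * \<gamma>)"
  shows "cmod (cf (u * (d - e)) - cf (u * d) * cnj (cf (u * e))) \<le> c * \<bar>u\<bar> powr (2 * \<gamma>) * (\<bar>d\<bar> powr \<gamma> * \<bar>e\<bar> powr \<gamma>)"
proof (cases "u = 0 \<or> d = 0 \<or> e = 0")
  case True
  then have "cf (u * (d - e)) - cf (u * d) * cnj (cf (u * e)) = 0"
    by (auto simp: cf_0 cf_uminus[symmetric])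
  then show ?thesis using True by auto
next
  case False
  define a where "a = \<bar>u * d\<bar> powr \<gamma>"
  define b where "b = \<bar>u * e\<bar> powr \<gamma>"
  have ab: "a > 0" "b > 0" using False by (auto simp: a_def b_def)
  have a2: "\<bar>u * d\<bar> powr (2 * \<gamma>) = a\<^sup>2" "\<bar>u * e\<bar> powr (2 * \<gamma>) = b\<^sup>2"
    by (simp_all add: a_def b_def power2_eq_square flip: powr_add)
  define U where "U \<omega> = iexp (u * d * \<epsilon> 1 \<omega>) - cf (u * d)" for \<omega>
  define V where "V \<omega> = iexp (u * e * \<epsilon> 1 \<omega>) - cf (u * e)" for \<omega>
  have [measurable]: "U \<in> borel_measurable P" "V \<in> borel_measurable P"
    unfolding U_def V_def by measurable
  have UV: "cmod (U \<omega>) \<le> 2" "cmod (V \<omega>) \<le> 2" for \<omega>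
    unfolding U_def V_def
    using norm_cf_le[of "u * d"] norm_cf_le[of "u * e"]
    by (auto intro!: order_trans[OF norm_triangle_ineq4])
  have i: "integrable P (\<lambda>\<omega>. (cmod (U \<omega>))\<^sup>2)" "integrable P (\<lambda>\<omega>. (cmod (V \<omega>))\<^sup>2)"
  proof -
    have "norm ((cmod (U \<omega>))\<^sup>2) \<le> 2\<^sup>2" "norm ((cmod (V \<omega>))\<^sup>2) \<le> 2\<^sup>2" for \<omega>
      using power_mono[OF UV(1)[of \<omega>], of 2] power_mono[OF UV(2)[of \<omega>], of 2] by simp_all
    then show "integrable P (\<lambda>\<omega>. (cmod (U \<omega>))\<^sup>2)" "integrable P (\<lambda>\<omega>. (cmod (V \<omega>))\<^sup>2)"
      by (auto intro!: bounded_integrable[where B="2\<^sup>2"] simp del: real_norm_def)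
  qed
  have "cf (u * (d - e)) - cf (u * d) * cnj (cf (u * e)) = (CLINT \<omega>|P. U \<omega> * cnj (V \<omega>))"
  proof -
    have "(CLINT \<omega>|P. iexp (u * d * \<epsilon> 1 \<omega>) * cnj (iexp (u * e * \<epsilon> 1 \<omega>))) = (CLINT \<omega>|P. iexp (u * (d - e) * \<epsilon> 1 \<omega>))"
      by (intro Bochner_Integration.integral_cong refl) (simp add: exp_cnj algebra_simps flip: exp_add)
    then show ?thesis
      using complex_covariance[of "\<lambda>\<omega>. iexp (u * d * \<epsilon> 1 \<omega>)" "\<lambda>\<omega>. iexp (u * e * \<epsilon> 1 \<omega>)"]
      unfolding U_def V_def by (simp only: cf_eq) simp
  qed
  also have "cmod \<dots> \<le> (LINT \<omega>|P. ((cmod (U \<omega>))\<^sup>2 * (b / a) + (cmod (V \<omega>))\<^sup>2 * (a / b)) / 2)"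
  proof (rule order_trans[OF Bochner_Integration.integral_norm_bound], rule Bochner_Integration.integral_mono)
    fix \<omega>
    let ?s = "sqrt (b / a)"
    have s: "?s > 0" "?s\<^sup>2 = b / a" using ab by auto
    have "2 * ((cmod (U \<omega>) * ?s) * (cmod (V \<omega>) / ?s)) \<le> (cmod (U \<omega>) * ?s)\<^sup>2 + (cmod (V \<omega>) / ?s)\<^sup>2"
      using sum_squares_bound[of "cmod (U \<omega>) * ?s" "cmod (V \<omega>) / ?s"] by (simp only: mult.assoc)
    also have "(cmod (U \<omega>) * ?s) * (cmod (V \<omega>) / ?s) = cmod (U \<omega>) * cmod (V \<omega>)"
      using s(1) by (metis less_irrefl mult.assoc mult.commute nonzero_eq_divide_eq times_divide_eq_right)
    also have "(cmod (U \<omega>) * ?s)\<^sup>2 + (cmod (V \<omega>) / ?s)\<^sup>2 = (cmod (U \<omega>))\<^sup>2 * (b / a) + (cmod (V \<omega>))\<^sup>2 * (a / b)"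
      unfolding power_mult_distrib power_divide s(2) by simp
    finally show "cmod (U \<omega> * cnj (V \<omega>)) \<le> ((cmod (U \<omega>))\<^sup>2 * (b / a) + (cmod (V \<omega>))\<^sup>2 * (a / b)) / 2"
      by (simp add: norm_mult)
  next
    show "integrable P (\<lambda>\<omega>. cmod (U \<omega> * cnj (V \<omega>)))"
    proof (rule bounded_integrable[where B="2 * 2"])
      show "norm (cmod (U \<omega> * cnj (V \<omega>))) \<le> 2 * 2" for \<omega>
        unfolding real_norm_def abs_norm_cancel unfolding norm_mult complex_mod_cnj by (intro mult_mono UV) auto
    qed measurable
    show "integrable P (\<lambda>\<omega>. ((cmod (U \<omega>))\<^sup>2 * (b / a) + (cmod (V \<omega>))\<^sup>2 * (a / b)) / 2)"
      by (intro integrable_divide Bochner_Integration.integrable_add integrable_mult_left i)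
  qed
  also have "\<dots> = ((1 - (cmod (cf (u * d)))\<^sup>2) * (b / a) + (1 - (cmod (cf (u * e)))\<^sup>2) * (a / b)) / 2"
  proof -
    show ?thesis
      unfolding variance_iexp_innovation[of "u * d" 1, symmetric] variance_iexp_innovation[of "u * e" 1, symmetric]
        U_def[symmetric] V_def[symmetric]
      by (simp only: integral_divide_zero integral_mult_left_zero
          Bochner_Integration.integral_add integrable_mult_left i)
  qed
  also have "\<dots> \<le> (c * a\<^sup>2 * (b / a) + c * b\<^sup>2 * (a / b)) / 2"
    using var[of "u * d"] var[of "u * e"] ab unfolding a2
    by (intro divide_right_mono add_mono mult_right_mono) auto
  also have "\<dots> = c * (a * b)" using ab by (simp add: power2_eq_square)
  also have "\<dots> = c * \<bar>u\<bar> powr (2 * \<gamma>) * (\<bar>d\<bar> powr \<gamma> * \<bar>e\<bar> powr \<gamma>)"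
    by (simp add: a_def b_def abs_mult powr_mult mult_ac flip: powr_add)
  finally show ?thesis .
qed

text \<open>
  The joint characteristic functions factor over the innovations. Hence the covariance at times \<open>s\<close> and \<open>t\<close> is a
  difference of two products of numbers in the unit disc and is at most the sum of the differences of the factors,
  that is \<open>c \<bar>u\<bar> powr (2 \<gamma>)\<close> times the sum over \<open>r\<close> of \<open>\<bar>d (s - r)\<bar> powr \<gamma> * \<bar>d (t - r)\<bar> powr \<gamma>\<close>. Summing this
  convolution first over \<open>t\<close>, then over \<open>r\<close>, costs a factor \<open>A\<close> each and leaves one free time.
\<close>

lemma finite_moving_average_variance:
  assumes var: "\<And>u. 1 - (cmod (cf u))\<^sup>2 \<le> c * \<bar>u\<bar> powr (2 * \<gamma>)" and c: "c \<ge> 0"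
    and R: "finite R" and T: "finite T"
    and A: "\<And>S. finite S \<Longrightarrow> (\<Sum>m\<in>S. \<bar>d m\<bar> powr \<gamma>) \<le> A"
  shows "(LINT \<omega>|P. (cmod (\<Sum>t\<in>T. iexp (u * (\<Sum>r\<in>R. d (t - r) * \<epsilon> r \<omega>)) -
            (CLINT \<omega>|P. iexp (u * (\<Sum>r\<in>R. d (t - r) * \<epsilon> r \<omega>)))))\<^sup>2)
       \<le> real (card T) * (c * \<bar>u\<bar> powr (2 * \<gamma>) * A\<^sup>2)"
proof -
  define Z where "Z t \<omega> = (\<Sum>r\<in>R. d (t - r) * \<epsilon> r \<omega>)" for t :: int and \<omega>
  define m where "m t = (CLINT \<omega>|P. iexp (u * Z t \<omega>))" for t
  have [measurable]: "Z t \<in> borel_measurable P" for t unfolding Z_def by measurable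
  have mle: "cmod (m t) \<le> 1" for t
    unfolding m_def by (rule order_trans[OF Bochner_Integration.integral_norm_bound]) (simp add: prob_space)
  define W where "W t \<omega> = iexp (u * Z t \<omega>) - m t" for t \<omega>
  have [measurable]: "W t \<in> borel_measurable P" for t unfolding W_def by measurable
  have Wle: "cmod (W t \<omega>) \<le> 2" for t \<omega>
    unfolding W_def using mle[of t] by (intro order_trans[OF norm_triangle_ineq4]) simp
  have iW: "integrable P (\<lambda>\<omega>. W s \<omega> * cnj (W t \<omega>))" for s t
  proof (rule bounded_integrable[where B="2 * 2"])
    show "cmod (W s \<omega> * cnj (W t \<omega>)) \<le> 2 * 2" for \<omega>
      unfolding norm_mult complex_mod_cnj by (intro mult_mono Wle) auto
  qed measurable
  define b where "b m = \<bar>d m\<bar> powr \<gamma>" for m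
  have b0: "b m \<ge> 0" for m by (simp add: b_def)
  have A0: "A \<ge> 0" using A[of "{}"] by simp
  have cov: "cmod (CLINT \<omega>|P. W s \<omega> * cnj (W t \<omega>)) \<le> c * \<bar>u\<bar> powr (2 * \<gamma>) * (\<Sum>r\<in>R. b (s - r) * b (t - r))" for s t
  proof -
    have "(CLINT \<omega>|P. W s \<omega> * cnj (W t \<omega>)) = (CLINT \<omega>|P. iexp (u * Z s \<omega>) * cnj (iexp (u * Z t \<omega>))) - m s * cnj (m t)"
      unfolding W_def m_def by (rule complex_covariance) auto
    also have "(CLINT \<omega>|P. iexp (u * Z s \<omega>) * cnj (iexp (u * Z t \<omega>)))
        = (CLINT \<omega>|P. iexp (u * (\<Sum>r\<in>R. (d (s - r) - d (t - r)) * \<epsilon> r \<omega>)))"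
      by (intro Bochner_Integration.integral_cong refl)
         (simp add: Z_def exp_cnj left_diff_distrib sum_subtractf right_diff_distrib exp_diff exp_minus divide_inverse)
    also have "\<dots> = (\<Prod>r\<in>R. cf (u * (d (s - r) - d (t - r))))"
      by (rule cf_linear_combination[OF R])
    finally have cov_eq: "(CLINT \<omega>|P. W s \<omega> * cnj (W t \<omega>)) = (\<Prod>r\<in>R. cf (u * (d (s - r) - d (t - r)))) - m s * cnj (m t)" .
    have ms: "m s = (\<Prod>r\<in>R. cf (u * d (s - r)))" for s
      unfolding m_def Z_def by (rule cf_linear_combination[OF R])
    have prods: "(CLINT \<omega>|P. W s \<omega> * cnj (W t \<omega>)) = (\<Prod>r\<in>R. cf (u * (d (s - r) - d (t - r)))) - (\<Prod>r\<in>R. cf (u * d (s - r)) * cnj (cf (u * d (t - r))))"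
      unfolding cov_eq ms prod.distrib cnj_prod ..
    have "cmod (CLINT \<omega>|P. W s \<omega> * cnj (W t \<omega>)) \<le> (\<Sum>r\<in>R. cmod (cf (u * (d (s - r) - d (t - r))) - cf (u * d (s - r)) * cnj (cf (u * d (t - r)))))"
      unfolding prods
    proof (rule norm_prod_diff)
      fix r
      show "cmod (cf (u * (d (s - r) - d (t - r)))) \<le> 1" by (rule norm_cf_le)
      show "cmod (cf (u * d (s - r)) * cnj (cf (u * d (t - r)))) \<le> 1"
        unfolding norm_mult complex_mod_cnj by (intro mult_le_one norm_cf_le norm_ge_zero)
    qed
    also have "\<dots> \<le> (\<Sum>r\<in>R. c * \<bar>u\<bar> powr (2 * \<gamma>) * (b (s - r) * b (t - r)))"
      unfolding b_def by (rule sum_mono) (rule cf_covariance_bound[OF var])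
    finally show ?thesis by (simp only: sum_distrib_left)
  qed
  have shift: "(\<Sum>s\<in>S. b (s - r)) \<le> A" "(\<Sum>s\<in>S. b (r - s)) \<le> A" if "finite S" for S r
    using A[of "(\<lambda>s. s - r) ` S"] A[of "(\<lambda>s. r - s) ` S"] that
    by (simp_all add: b_def sum.reindex inj_on_def)
  have "complex_of_real (LINT \<omega>|P. (cmod (\<Sum>t\<in>T. W t \<omega>))\<^sup>2) = (CLINT \<omega>|P. (\<Sum>s\<in>T. \<Sum>t\<in>T. W s \<omega> * cnj (W t \<omega>)))"
    unfolding integral_complex_of_real[symmetric] complex_norm_square by (simp add: cnj_sum sum_product)
  also have "\<dots> = (\<Sum>s\<in>T. \<Sum>t\<in>T. CLINT \<omega>|P. W s \<omega> * cnj (W t \<omega>))"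
  proof -
    have "(CLINT \<omega>|P. (\<Sum>s\<in>T. \<Sum>t\<in>T. W s \<omega> * cnj (W t \<omega>))) = (\<Sum>s\<in>T. CLINT \<omega>|P. \<Sum>t\<in>T. W s \<omega> * cnj (W t \<omega>))"
      by (rule Bochner_Integration.integral_sum) (intro Bochner_Integration.integrable_sum iW)
    also have "\<dots> = (\<Sum>s\<in>T. \<Sum>t\<in>T. CLINT \<omega>|P. W s \<omega> * cnj (W t \<omega>))"
      by (intro sum.cong refl Bochner_Integration.integral_sum iW)
    finally show ?thesis .
  qed
  finally have sq: "complex_of_real (LINT \<omega>|P. (cmod (\<Sum>t\<in>T. W t \<omega>))\<^sup>2) = (\<Sum>s\<in>T. \<Sum>t\<in>T. CLINT \<omega>|P. W s \<omega> * cnj (W t \<omega>))" .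
  have "(LINT \<omega>|P. (cmod (\<Sum>t\<in>T. W t \<omega>))\<^sup>2) \<le> cmod (complex_of_real (LINT \<omega>|P. (cmod (\<Sum>t\<in>T. W t \<omega>))\<^sup>2))"
    by (simp only: norm_of_real abs_ge_self)
  also have "\<dots> = cmod (\<Sum>s\<in>T. \<Sum>t\<in>T. CLINT \<omega>|P. W s \<omega> * cnj (W t \<omega>))"
    unfolding sq ..
  also have "\<dots> \<le> (\<Sum>s\<in>T. \<Sum>t\<in>T. c * \<bar>u\<bar> powr (2 * \<gamma>) * (\<Sum>r\<in>R. b (s - r) * b (t - r)))"
    by (rule sum_norm_le, rule sum_norm_le, rule cov)
  also have "\<dots> = c * \<bar>u\<bar> powr (2 * \<gamma>) * (\<Sum>s\<in>T. \<Sum>r\<in>R. b (s - r) * (\<Sum>t\<in>T. b (t - r)))"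
  proof -
    have "(\<Sum>t\<in>T. \<Sum>r\<in>R. b (s - r) * b (t - r)) = (\<Sum>r\<in>R. b (s - r) * (\<Sum>t\<in>T. b (t - r)))" for s
      by (subst sum.swap) (simp only: sum_distrib_left)
    then show ?thesis by (simp only: sum_distrib_left[symmetric])
  qed
  also have "\<dots> \<le> c * \<bar>u\<bar> powr (2 * \<gamma>) * (\<Sum>s\<in>T. \<Sum>r\<in>R. b (s - r) * A)"
    by (intro mult_left_mono sum_mono shift T b0) (use c in auto)
  also have "\<dots> = c * \<bar>u\<bar> powr (2 * \<gamma>) * (\<Sum>s\<in>T. (\<Sum>r\<in>R. b (s - r)) * A)"
    by (simp only: sum_distrib_right)
  also have "\<dots> \<le> c * \<bar>u\<bar> powr (2 * \<gamma>) * (\<Sum>s\<in>T. A * A)"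
    by (intro mult_left_mono sum_mono mult_right_mono shift R) (use c A0 in auto)
  also have "\<dots> = real (card T) * (c * \<bar>u\<bar> powr (2 * \<gamma>) * A\<^sup>2)" by (simp add: power2_eq_square)
  finally show ?thesis by (simp add: W_def m_def Z_def)
qed

lemma linear_process_measurable [measurable]: "linear_process b \<epsilon> t \<in> borel_measurable P"
  unfolding linear_process_def by measurable

lemma cf_linear_process:
  assumes "AE \<omega> in P. summable (\<lambda>i. b i * \<epsilon> (t - int i) \<omega>)"
  shows "(\<lambda>N. \<Prod>i<N. cf (u * b i)) \<longlonglongrightarrow> (CLINT \<omega>|P. iexp (u * linear_process b \<epsilon> t \<omega>))"
proof -
  have "(\<lambda>N. CLINT \<omega>|P. iexp (u * (\<Sum>i<N. b i * \<epsilon> (t - int i) \<omega>))) \<longlonglongrightarrow> (CLINT \<omega>|P. iexp (u * linear_process b \<epsilon> t \<omega>))"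
  proof (rule integral_dominated_convergence[where w="\<lambda>_. 1"])
    show "AE \<omega> in P. (\<lambda>N. iexp (u * (\<Sum>i<N. b i * \<epsilon> (t - int i) \<omega>))) \<longlonglongrightarrow> iexp (u * linear_process b \<epsilon> t \<omega>)"
      using assms
    proof eventually_elim
      case (elim \<omega>)
      then show ?case unfolding linear_process_def
        by (intro tendsto_intros summable_LIMSEQ)
    qed
  qed auto
  moreover have "(CLINT \<omega>|P. iexp (u * (\<Sum>i<N. b i * \<epsilon> (t - int i) \<omega>))) = (\<Prod>i<N. cf (u * b i))" for N
  proof -
    let ?f = "\<lambda>i. t - int i"
    have inj: "inj_on ?f {..<N}" by (auto simp: inj_on_def)
    have "(CLINT \<omega>|P. iexp (u * (\<Sum>r\<in>?f ` {..<N}. b (nat (t - r)) * \<epsilon> r \<omega>))) = (\<Prod>r\<in>?f ` {..<N}. cf (u * b (nat (t - r))))"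
      by (rule cf_linear_combination) simp
    then show ?thesis by (simp add: sum.reindex[OF inj] prod.reindex[OF inj] o_def)
  qed
  ultimately show ?thesis by simp
qed

text \<open>
  Truncating the series after \<open>N\<close> terms gives moving averages over a common finite set of innovations. The bound for
  these does not depend on \<open>N\<close> and is inherited by the limit through dominated convergence.
\<close>

lemma linear_process_empirical_cf_variance:
  assumes var: "\<And>u. 1 - (cmod (cf u))\<^sup>2 \<le> c * \<bar>u\<bar> powr (2 * \<gamma>)" and c: "c \<ge> 0"
    and sm: "\<And>t. AE \<omega> in P. summable (\<lambda>i. b i * \<epsilon> (t - int i) \<omega>)"
    and sg: "summable (\<lambda>i. \<bar>b i\<bar> powr \<gamma>)" and T: "finite T"
  shows "(LINT \<omega>|P. (cmod (\<Sum>t\<in>T. iexp (u * linear_process b \<epsilon> t \<omega>) -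
            (CLINT \<omega>|P. iexp (u * linear_process b \<epsilon> t \<omega>))))\<^sup>2)
       \<le> real (card T) * (c * \<bar>u\<bar> powr (2 * \<gamma>) * (\<Sum>i. \<bar>b i\<bar> powr \<gamma>)\<^sup>2)" (is "?L \<le> ?R")
proof -
  define Z where "Z N t \<omega> = (\<Sum>i<N. b i * \<epsilon> (t - int i) \<omega>)" for N t \<omega>
  have [measurable]: "Z N t \<in> borel_measurable P" for N t unfolding Z_def by measurable
  have Zlim: "AE \<omega> in P. (\<lambda>N. iexp (u * Z N t \<omega>)) \<longlonglongrightarrow> iexp (u * linear_process b \<epsilon> t \<omega>)" for t
    using sm[of t]
  proof eventually_elim
    case (elim \<omega>)
    then show ?case unfolding linear_process_def Z_def
      by (intro tendsto_intros summable_LIMSEQ)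
  qed
  have mlim: "(\<lambda>N. CLINT \<omega>|P. iexp (u * Z N t \<omega>)) \<longlonglongrightarrow> (CLINT \<omega>|P. iexp (u * linear_process b \<epsilon> t \<omega>))" for t
    by (rule integral_dominated_convergence[where w="\<lambda>_. 1"]) (use Zlim in auto)
  let ?S = "\<lambda>N \<omega>. (\<Sum>t\<in>T. iexp (u * Z N t \<omega>) - (CLINT \<omega>|P. iexp (u * Z N t \<omega>)))"
  have "(\<lambda>N. LINT \<omega>|P. (cmod (?S N \<omega>))\<^sup>2) \<longlonglongrightarrow> ?L"
  proof (rule integral_dominated_convergence[where w="\<lambda>_. (2 * real (card T))\<^sup>2"])
    have "AE \<omega> in P. \<forall>t\<in>T. (\<lambda>N. iexp (u * Z N t \<omega>)) \<longlonglongrightarrow> iexp (u * linear_process b \<epsilon> t \<omega>)"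
      using T Zlim by (simp add: AE_ball_countable countable_finite)
    then show "AE \<omega> in P. (\<lambda>N. (cmod (?S N \<omega>))\<^sup>2) \<longlonglongrightarrow> (cmod (\<Sum>t\<in>T. iexp (u * linear_process b \<epsilon> t \<omega>) -
            (CLINT \<omega>|P. iexp (u * linear_process b \<epsilon> t \<omega>))))\<^sup>2"
    proof eventually_elim
      case (elim \<omega>)
      then show ?case by (intro tendsto_power tendsto_norm tendsto_sum tendsto_diff mlim) auto
    qed
    show "AE \<omega> in P. norm ((cmod (?S N \<omega>))\<^sup>2) \<le> (2 * real (card T))\<^sup>2" for N
    proof (intro AE_I2)
      fix \<omega>
      have m: "cmod (CLINT \<omega>|P. iexp (u * Z N t \<omega>)) \<le> 1" for t
        by (rule order_trans[OF Bochner_Integration.integral_norm_bound]) (simp add: prob_space)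
      have "cmod (iexp (u * Z N t \<omega>) - (CLINT \<omega>|P. iexp (u * Z N t \<omega>))) \<le> 2" for t
        using m[of t] by (intro order_trans[OF norm_triangle_ineq4]) simp
      then have "cmod (?S N \<omega>) \<le> (\<Sum>t\<in>T. 2)"
        by (intro sum_norm_le)
      then have "(cmod (?S N \<omega>))\<^sup>2 \<le> (2 * real (card T))\<^sup>2"
        by (intro power_mono) (simp_all add: mult.commute)
      then show "norm ((cmod (?S N \<omega>))\<^sup>2) \<le> (2 * real (card T))\<^sup>2" by simp
    qed
  qed auto
  moreover have "(LINT \<omega>|P. (cmod (?S N \<omega>))\<^sup>2) \<le> ?R" for N
  proof -
    define d where "d m = (if 0 \<le> m \<and> m < int N then b (nat m) else 0)" for m :: int
    define R where "R = (\<Union>t\<in>T. (\<lambda>i. t - int i) ` {..<N})"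
    have R: "finite R" using T by (simp add: R_def)
    have Zeq: "Z N t \<omega> = (\<Sum>r\<in>R. d (t - r) * \<epsilon> r \<omega>)" if "t \<in> T" for t \<omega>
    proof -
      have inj: "inj_on (\<lambda>i. t - int i) {..<N}" by (auto simp: inj_on_def)
      have "Z N t \<omega> = (\<Sum>r\<in>(\<lambda>i. t - int i) ` {..<N}. d (t - r) * \<epsilon> r \<omega>)"
        by (simp add: sum.reindex[OF inj] o_def Z_def d_def)
      also have "\<dots> = (\<Sum>r\<in>R. d (t - r) * \<epsilon> r \<omega>)"
      proof (rule sum.mono_neutral_left[OF R])
        show "(\<lambda>i. t - int i) ` {..<N} \<subseteq> R" using that by (auto simp: R_def)
        show "\<forall>r\<in>R - (\<lambda>i. t - int i) ` {..<N}. d (t - r) * \<epsilon> r \<omega> = 0"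
        proof
          fix r assume r: "r \<in> R - (\<lambda>i. t - int i) ` {..<N}"
          have "\<not> (0 \<le> t - r \<and> t - r < int N)"
          proof
            assume "0 \<le> t - r \<and> t - r < int N"
            then have "r = t - int (nat (t - r))" "nat (t - r) \<in> {..<N}" by auto
            then show False using r by blast
          qed
          then have "d (t - r) = 0" unfolding d_def by (rule if_not_P)
          then show "d (t - r) * \<epsilon> r \<omega> = 0" by simp
        qed
      qed
      finally show ?thesis .
    qed
    have A: "(\<Sum>m\<in>S. \<bar>d m\<bar> powr \<gamma>) \<le> (\<Sum>i. \<bar>b i\<bar> powr \<gamma>)" if "finite S" for S
    proof -
      have "(\<Sum>m\<in>S. \<bar>d m\<bar> powr \<gamma>) = (\<Sum>m\<in>{m\<in>S. 0 \<le> m \<and> m < int N}. \<bar>b (nat m)\<bar> powr \<gamma>)"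
        using that by (intro sum.mono_neutral_cong_right) (auto simp: d_def)
      also have "\<dots> = (\<Sum>i\<in>nat ` {m\<in>S. 0 \<le> m \<and> m < int N}. \<bar>b i\<bar> powr \<gamma>)"
        by (subst sum.reindex) (auto simp: inj_on_def)
      also have "\<dots> \<le> (\<Sum>i. \<bar>b i\<bar> powr \<gamma>)"
        by (rule sum_le_suminf[OF sg]) (use that in auto)
      finally show ?thesis .
    qed
    have "(LINT \<omega>|P. (cmod (?S N \<omega>))\<^sup>2) = (LINT \<omega>|P. (cmod (\<Sum>t\<in>T. iexp (u * (\<Sum>r\<in>R. d (t - r) * \<epsilon> r \<omega>)) -
            (CLINT \<omega>|P. iexp (u * (\<Sum>r\<in>R. d (t - r) * \<epsilon> r \<omega>)))))\<^sup>2)"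
      by (simp add: Zeq cong: sum.cong)
    also have "\<dots> \<le> ?R"
      by (rule finite_moving_average_variance[OF var c R T A])
    finally show ?thesis .
  qed
  ultimately show ?thesis by (intro LIMSEQ_le_const2) auto
qed

end

section \<open>The martingale part of the empirical coefficients\<close>

lemma compactly_supportedI:
  assumes "\<And>x. R \<le> \<bar>x\<bar> \<Longrightarrow> g x = 0"
  shows "compactly_supported g"
proof -
  have "support_on UNIV g \<subseteq> {-R..R}"
    using assms by (force simp: support_on_def)
  then have "bounded (support_on UNIV g)"
    using bounded_closed_interval bounded_subset by blast
  then show ?thesis by (simp add: compactly_supported_def)
qed

lemma compactly_supported_dilate:
  assumes "compactly_supported g"
  shows "compactly_supported (dilate g j k)"
proof -
  obtain R where R: "R > 0" "\<And>x. R \<le> \<bar>x\<bar> \<Longrightarrow> g x = 0"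
    using compactly_supported_vanishes[OF assms] by blast
  let ?p = "2 powr real_of_int j"
  show ?thesis
  proof (rule compactly_supportedI[where R="(R + \<bar>real_of_int k\<bar>) / ?p"])
    fix x assume "(R + \<bar>real_of_int k\<bar>) / ?p \<le> \<bar>x\<bar>"
    then have "R + \<bar>real_of_int k\<bar> \<le> \<bar>?p * x\<bar>" by (simp add: field_simps abs_mult)
    then have "R \<le> \<bar>?p * x - k\<bar>" by linarith
    then show "dilate g j k x = 0" by (simp add: dilate_def R)
  qed
qed

lemma twice_continuously_differentiable_dilate:
  assumes "twice_continuously_differentiable g"
  shows "twice_continuously_differentiable (dilate g j k)"
proof -
  obtain g' g'' where g: "\<And>x. (g has_real_derivative g' x) (at x)"
    "\<And>x. (g' has_real_derivative g'' x) (at x)" "continuous_on UNIV g''"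
    using assms unfolding twice_continuously_differentiable_def by blast
  let ?p = "2 powr real_of_int j" and ?q = "2 powr (real_of_int j / 2)"
  have l: "((\<lambda>x. ?p * x - real_of_int k) has_real_derivative ?p) (at x)" for x
    by (auto intro!: derivative_eq_intros)
  have 1: "(dilate g j k has_real_derivative ?q * (g' (?p * x - k) * ?p)) (at x)" for x
    unfolding dilate_def by (intro DERIV_cmult DERIV_chain2[OF g(1) l])
  have 2: "((\<lambda>x. ?q * (g' (?p * x - k) * ?p)) has_real_derivative ?q * (g'' (?p * x - k) * ?p * ?p)) (at x)" for x
    by (intro DERIV_cmult DERIV_cmult_right DERIV_chain2[OF g(2) l])
  have "continuous_on UNIV (\<lambda>x. ?q * (g'' (?p * x - k) * ?p * ?p))"
    by (intro continuous_intros continuous_on_compose2[OF g(3)]) auto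
  then show ?thesis unfolding twice_continuously_differentiable_def
    by (intro exI conjI allI) (rule 1, rule 2, assumption)
qed

text \<open>
  At each point at most \<open>2 R + 1\<close> of the translates are non-zero, when \<open>g\<close> vanishes outside the
  interval from \<open>-R\<close> to \<open>R\<close>.
\<close>

lemma sum_dilate_square_bound:
  assumes "compactly_supported g" "\<And>x. \<bar>g x\<bar> \<le> B"
  shows "\<exists>C>0. \<forall>K j x. finite K \<longrightarrow> (\<Sum>k\<in>K. (dilate g j k x)\<^sup>2) \<le> C * 2 powr real_of_int j"
proof -
  obtain R where R: "R > 0" "\<And>x. R \<le> \<bar>x\<bar> \<Longrightarrow> g x = 0"
    using compactly_supported_vanishes[OF assms(1)] by blast
  have "(\<Sum>k\<in>K. (dilate g j k x)\<^sup>2) \<le> (B\<^sup>2 * (2 * R + 1) + 1) * 2 powr real_of_int j" if K: "finite K" for K j x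
  proof -
    let ?p = "2 powr real_of_int j"
    let ?y = "?p * x"
    let ?I = "{\<lceil>?y - R\<rceil>..\<lfloor>?y + R\<rfloor>}"
    have sq: "(dilate g j k x)\<^sup>2 = ?p * (g (?y - k))\<^sup>2" for k
      by (simp add: dilate_def power_mult_distrib power2_eq_square[of "2 powr _"] flip: powr_add)
    have "(\<Sum>k\<in>K. (dilate g j k x)\<^sup>2) = (\<Sum>k\<in>K \<inter> ?I. ?p * (g (?y - k))\<^sup>2)"
      unfolding sq
    proof (rule sum.mono_neutral_right[OF K])
      show "\<forall>k\<in>K - K \<inter> ?I. ?p * (g (?y - k))\<^sup>2 = 0"
      proof
        fix k assume "k \<in> K - K \<inter> ?I"
        then have "k < \<lceil>?y - R\<rceil> \<or> k > \<lfloor>?y + R\<rfloor>" by auto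
        then have "R \<le> \<bar>?y - k\<bar>" by (auto simp: less_ceiling_iff floor_less_iff)
        then show "?p * (g (?y - k))\<^sup>2 = 0" by (simp add: R)
      qed
    qed auto
    also have "\<dots> \<le> (\<Sum>k\<in>K \<inter> ?I. ?p * B\<^sup>2)"
    proof (intro sum_mono mult_left_mono)
      fix k show "(g (?y - real_of_int k))\<^sup>2 \<le> B\<^sup>2"
        using power_mono[OF assms(2)[of "?y - k"], of 2] by simp
    qed auto
    also have "\<dots> = real (card (K \<inter> ?I)) * (?p * B\<^sup>2)" by simp
    also have "\<dots> \<le> (2 * R + 1) * (?p * B\<^sup>2)"
    proof (rule mult_right_mono)
      have "card (K \<inter> ?I) \<le> card ?I" by (intro card_mono) auto
      then have "real (card (K \<inter> ?I)) \<le> real (nat (\<lfloor>?y + R\<rfloor> - \<lceil>?y - R\<rceil> + 1))" by simp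
      also have "\<dots> = of_int (max 0 (\<lfloor>?y + R\<rfloor> - \<lceil>?y - R\<rceil> + 1))"
        by (cases "0 \<le> \<lfloor>?y + R\<rfloor> - \<lceil>?y - R\<rceil> + 1") (simp_all add: max_def)
      also have "\<dots> \<le> 2 * R + 1"
      proof -
        have "of_int \<lfloor>?y + R\<rfloor> \<le> ?y + R" "?y - R \<le> of_int \<lceil>?y - R\<rceil>" by (rule of_int_floor_le le_of_int_ceiling)+
        then have "real_of_int (\<lfloor>?y + R\<rfloor> - \<lceil>?y - R\<rceil> + 1) \<le> 2 * R + 1"
          unfolding of_int_add of_int_diff of_int_1 by linarith
        then show ?thesis using R(1) by (auto simp: max_def)
      qed
      finally show "real (card (K \<inter> ?I)) \<le> 2 * R + 1" .
    qed auto
    also have "\<dots> \<le> (B\<^sup>2 * (2 * R + 1) + 1) * ?p" by (simp add: algebra_simps)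
    finally show ?thesis .
  qed
  moreover have "B\<^sup>2 * (2 * R + 1) + 1 > 0" using R(1) by (intro add_nonneg_pos mult_nonneg_nonneg) auto
  ultimately show ?thesis by blast
qed

context iid_innovations
begin

definition past :: "int \<Rightarrow> 'w \<Rightarrow> int \<Rightarrow> real" where
  "past t \<omega> = restrict (\<lambda>r. \<epsilon> r \<omega>) {..<t}"

lemma past_measurable [measurable]: "past t \<in> measurable P (PiM {..<t} (\<lambda>_. borel))"
  unfolding past_def by measurable

text \<open>
  By independence the innovation at time \<open>t\<close> may be integrated out with the past held fixed; the inner expectation
  is the conditional expectation given the past.
\<close>

lemma expectation_past_present:
  fixes G :: "(int \<Rightarrow> real) \<times> real \<Rightarrow> real"
  assumes G[measurable]: "G \<in> borel_measurable (PiM {..<t} (\<lambda>_. borel) \<Otimes>\<^sub>M borel)"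
    and bound: "\<And>x. \<bar>G x\<bar> \<le> C"
  shows "expectation (\<lambda>\<omega>. G (past t \<omega>, \<epsilon> t \<omega>)) = expectation (\<lambda>\<omega>. expectation (\<lambda>\<omega>'. G (past t \<omega>, \<epsilon> 1 \<omega>')))"
proof -
  let ?S = "PiM {..<t} (\<lambda>_. borel) :: (int \<Rightarrow> real) measure"
  let ?T = "PiM {t} (\<lambda>_. borel) :: (int \<Rightarrow> real) measure"
  have ind: "indep_var ?S (\<lambda>\<omega>. restrict (\<lambda>r. \<epsilon> r \<omega>) {..<t}) ?T (\<lambda>\<omega>. restrict (\<lambda>r. \<epsilon> r \<omega>) {t})"
    by (rule indep_var_restrict[OF indep]) auto
  have "expectation (\<lambda>\<omega>. (\<lambda>(w, v). G (w, v t)) (restrict (\<lambda>r. \<epsilon> r \<omega>) {..<t}, restrict (\<lambda>r. \<epsilon> r \<omega>) {t}))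
    = expectation (\<lambda>\<omega>. expectation (\<lambda>\<omega>'. (\<lambda>(w, v). G (w, v t)) (restrict (\<lambda>r. \<epsilon> r \<omega>) {..<t}, restrict (\<lambda>r. \<epsilon> r \<omega>') {t})))"
  proof (rule indep_var_iterated_integral[OF ind])
    show "(\<lambda>(w, v). G (w, v t)) \<in> borel_measurable (?S \<Otimes>\<^sub>M ?T)" by measurable
  qed (use bound in auto)
  then have "expectation (\<lambda>\<omega>. G (past t \<omega>, \<epsilon> t \<omega>)) = expectation (\<lambda>\<omega>. expectation (\<lambda>\<omega>'. G (past t \<omega>, \<epsilon> t \<omega>')))"
    by (simp add: past_def)
  also have "expectation (\<lambda>\<omega>'. G (past t \<omega>, \<epsilon> t \<omega>')) = expectation (\<lambda>\<omega>'. G (past t \<omega>, \<epsilon> 1 \<omega>'))" if "\<omega> \<in> space P" for \<omega>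
  proof -
    have "past t \<omega> \<in> space ?S" using that measurable_space[OF past_measurable] by blast
    then have "(\<lambda>x. G (past t \<omega>, x)) \<in> borel_measurable borel" by measurable
    then show ?thesis by (rule expectation_innovation)
  qed
  then have "expectation (\<lambda>\<omega>. expectation (\<lambda>\<omega>'. G (past t \<omega>, \<epsilon> t \<omega>'))) = expectation (\<lambda>\<omega>. expectation (\<lambda>\<omega>'. G (past t \<omega>, \<epsilon> 1 \<omega>')))"
    by (rule Bochner_Integration.integral_cong[OF refl])
  finally show ?thesis .
qed

text \<open>
  Given the innovations before time \<open>t\<close>, the mean of \<open>g (a0 * \<epsilon> t + Y t)\<close> is \<open>h (Y t)\<close>. Therefore terms at
  different times are orthogonal, and each diagonal term is the mean of a conditional variance, which is at most the
  mean of the conditional second moment.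
\<close>

lemma martingale_difference_variance:
  fixes g :: "real \<Rightarrow> real" and a0 :: real and b :: "nat \<Rightarrow> real"
  defines "h \<equiv> \<lambda>y. expectation (\<lambda>\<omega>. g (a0 * \<epsilon> 1 \<omega> + y))"
    and "Y \<equiv> \<lambda>t. linear_process b \<epsilon> (t - 1)"
  assumes g[measurable]: "g \<in> borel_measurable borel" and B: "\<And>x. \<bar>g x\<bar> \<le> B" and T: "finite T"
  shows "expectation (\<lambda>\<omega>. (\<Sum>t\<in>T. g (a0 * \<epsilon> t \<omega> + Y t \<omega>) - h (Y t \<omega>))\<^sup>2)
     \<le> (\<Sum>t\<in>T. expectation (\<lambda>\<omega>. (g (a0 * \<epsilon> t \<omega> + Y t \<omega>))\<^sup>2))"
proof -
  have h_meas[measurable]: "h \<in> borel_measurable borel"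
    unfolding h_def by measurable
  have h_bound: "\<bar>h y\<bar> \<le> B" for y
    unfolding h_def by (rule abs_expectation_le[OF _ B]) measurable
  define y where "y s w = (\<Sum>l. b l * w (s - 1 - int l))" for s :: int and w :: "int \<Rightarrow> real"
  have y_meas[measurable]: "y s \<in> borel_measurable (PiM {..<t} (\<lambda>_. borel))" if "s \<le> t" for s t
    unfolding y_def
    by (rule borel_measurable_suminf) (use that in \<open>auto intro!: borel_measurable_times measurable_component_singleton\<close>)
  have y_past: "y s (past t \<omega>) = Y s \<omega>" if "s \<le> t" for s t \<omega>
    using that by (simp add: y_def Y_def linear_process_def past_def)
  define M where "M t \<omega> = g (a0 * \<epsilon> t \<omega> + Y t \<omega>) - h (Y t \<omega>)" for t \<omega>
  have Y_meas[measurable]: "Y t \<in> borel_measurable P" for t unfolding Y_def by measurable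
  have M_meas[measurable]: "M t \<in> borel_measurable P" for t unfolding M_def by measurable
  have gh: "\<bar>g x - h z\<bar> \<le> 2 * B" for x z using B[of x] h_bound[of z] by linarith
  have B0: "B \<ge> 0" using B[of 0] by linarith
  have M_bound: "\<bar>M t \<omega>\<bar> \<le> 2 * B" for t \<omega> unfolding M_def by (rule gh)
  have MM_bound: "\<bar>M s \<omega> * M t \<omega>\<bar> \<le> 2 * B * (2 * B)" for s t \<omega>
    unfolding abs_mult by (intro mult_mono M_bound) (use B0 in auto)
  have int_MM: "integrable P (\<lambda>\<omega>. M s \<omega> * M t \<omega>)" for s t
    by (rule bounded_integrable[where B="2 * B * (2 * B)"]) (use MM_bound in auto)
  have int_g: "integrable P (\<lambda>\<omega>. g (a0 * \<epsilon> 1 \<omega> + z))" for z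
    by (rule bounded_integrable[where B=B]) (use B in auto)
  have g2: "\<bar>(g x)\<^sup>2\<bar> \<le> B\<^sup>2" for x using power_mono[OF B[of x], of 2] by simp
  have int_g2: "integrable P (\<lambda>\<omega>. (g (a0 * \<epsilon> 1 \<omega> + z))\<^sup>2)" for z
    by (rule bounded_integrable[where B="B\<^sup>2"]) (use g2 in auto)
  have orth: "expectation (\<lambda>\<omega>. M s \<omega> * M t \<omega>) = 0" if "s < t" for s t
  proof -
    define G where "G = (\<lambda>(w, e). (g (a0 * w s + y s w) - h (y s w)) * (g (a0 * e + y t w) - h (y t w)))"
    have [measurable]: "y s \<in> borel_measurable (PiM {..<t} (\<lambda>_. borel))" "y t \<in> borel_measurable (PiM {..<t} (\<lambda>_. borel))"
      "(\<lambda>w. w s) \<in> borel_measurable (PiM {..<t} (\<lambda>_. borel))"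
      using that by (auto intro!: y_meas measurable_component_singleton)
    have "expectation (\<lambda>\<omega>. G (past t \<omega>, \<epsilon> t \<omega>)) = expectation (\<lambda>\<omega>. expectation (\<lambda>\<omega>'. G (past t \<omega>, \<epsilon> 1 \<omega>')))"
    proof (rule expectation_past_present)
      show "G \<in> borel_measurable (PiM {..<t} (\<lambda>_. borel) \<Otimes>\<^sub>M borel)"
        unfolding G_def by measurable
      show "\<bar>G x\<bar> \<le> 2 * B * (2 * B)" for x
        unfolding G_def by (cases x) (simp only: prod.case abs_mult, intro mult_mono gh, use B0 in auto)
    qed
    moreover have "expectation (\<lambda>\<omega>'. G (past t \<omega>, \<epsilon> 1 \<omega>')) = 0" for \<omega>
      using int_g[of "y t (past t \<omega>)"] by (simp add: G_def h_def prob_space)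
    ultimately have "expectation (\<lambda>\<omega>. G (past t \<omega>, \<epsilon> t \<omega>)) = 0" by simp
    moreover have "G (past t \<omega>, \<epsilon> t \<omega>) = M s \<omega> * M t \<omega>" for \<omega>
      using that by (simp add: G_def M_def y_past) (simp add: past_def)
    ultimately show ?thesis by simp
  qed
  have diag: "expectation (\<lambda>\<omega>. M t \<omega> * M t \<omega>) \<le> expectation (\<lambda>\<omega>. (g (a0 * \<epsilon> t \<omega> + Y t \<omega>))\<^sup>2)" for t
  proof -
    define G where "G = (\<lambda>(w, e). (g (a0 * e + y t w) - h (y t w))\<^sup>2)"
    define G2 where "G2 = (\<lambda>(w, e). (g (a0 * e + y t w))\<^sup>2)"
    have [measurable]: "y t \<in> borel_measurable (PiM {..<t} (\<lambda>_. borel))" by (rule y_meas) simp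
    have [measurable]: "G \<in> borel_measurable (PiM {..<t} (\<lambda>_. borel) \<Otimes>\<^sub>M borel)"
      "G2 \<in> borel_measurable (PiM {..<t} (\<lambda>_. borel) \<Otimes>\<^sub>M borel)"
      unfolding G_def G2_def by measurable
    have Gb: "\<bar>G x\<bar> \<le> (2 * B)\<^sup>2" for x
      using power_mono[OF gh[of "a0 * snd x + y t (fst x)" "y t (fst x)"], of 2] by (auto simp: G_def split: prod.split)
    have G2b: "\<bar>G2 x\<bar> \<le> B\<^sup>2" for x
      using g2 by (auto simp: G2_def split: prod.split)
    have "expectation (\<lambda>\<omega>. M t \<omega> * M t \<omega>) = expectation (\<lambda>\<omega>. G (past t \<omega>, \<epsilon> t \<omega>))"
      by (simp add: G_def M_def y_past power2_eq_square)
    also have "\<dots> = expectation (\<lambda>\<omega>. expectation (\<lambda>\<omega>'. G (past t \<omega>, \<epsilon> 1 \<omega>')))"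
      by (rule expectation_past_present[OF _ Gb]) measurable
    also have "\<dots> \<le> expectation (\<lambda>\<omega>. expectation (\<lambda>\<omega>'. G2 (past t \<omega>, \<epsilon> 1 \<omega>')))"
    proof (rule Bochner_Integration.integral_mono)
      have ile: "integrable P (\<lambda>\<omega>. expectation (\<lambda>\<omega>'. F (past t \<omega>, \<epsilon> 1 \<omega>')))"
        if [measurable]: "F \<in> borel_measurable (PiM {..<t} (\<lambda>_. borel) \<Otimes>\<^sub>M borel)" and F: "\<And>x. \<bar>F x\<bar> \<le> C" for F :: "_ \<Rightarrow> real" and C
      proof (rule integrable_const_bound[where B=C])
        show "AE \<omega> in P. norm (expectation (\<lambda>\<omega>'. F (past t \<omega>, \<epsilon> 1 \<omega>'))) \<le> C"
        proof (rule AE_I2)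
          fix \<omega> assume "\<omega> \<in> space P"
          then have "past t \<omega> \<in> space (PiM {..<t} (\<lambda>_. borel))" using measurable_space[OF past_measurable] by blast
          then show "norm (expectation (\<lambda>\<omega>'. F (past t \<omega>, \<epsilon> 1 \<omega>'))) \<le> C"
            unfolding real_norm_def by (intro abs_expectation_le F) measurable
        qed
      qed measurable
      show "integrable P (\<lambda>\<omega>. expectation (\<lambda>\<omega>'. G (past t \<omega>, \<epsilon> 1 \<omega>')))" by (rule ile[OF _ Gb]) measurable
      show "integrable P (\<lambda>\<omega>. expectation (\<lambda>\<omega>'. G2 (past t \<omega>, \<epsilon> 1 \<omega>')))" by (rule ile[OF _ G2b]) measurable
      fix \<omega>
      let ?z = "y t (past t \<omega>)"
      have "expectation (\<lambda>\<omega>'. G (past t \<omega>, \<epsilon> 1 \<omega>')) = variance (\<lambda>\<omega>'. g (a0 * \<epsilon> 1 \<omega>' + ?z))"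
        by (simp add: G_def h_def)
      also have "\<dots> = expectation (\<lambda>\<omega>'. (g (a0 * \<epsilon> 1 \<omega>' + ?z))\<^sup>2) - (expectation (\<lambda>\<omega>'. g (a0 * \<epsilon> 1 \<omega>' + ?z)))\<^sup>2"
        by (rule variance_eq[OF int_g int_g2])
      also have "\<dots> \<le> expectation (\<lambda>\<omega>'. G2 (past t \<omega>, \<epsilon> 1 \<omega>'))" by (simp add: G2_def)
      finally show "expectation (\<lambda>\<omega>'. G (past t \<omega>, \<epsilon> 1 \<omega>')) \<le> expectation (\<lambda>\<omega>'. G2 (past t \<omega>, \<epsilon> 1 \<omega>'))" .
    qed
    also have "\<dots> = expectation (\<lambda>\<omega>. G2 (past t \<omega>, \<epsilon> t \<omega>))"
      by (rule expectation_past_present[OF _ G2b, symmetric]) measurable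
    finally show ?thesis by (simp add: G2_def y_past)
  qed
  have "expectation (\<lambda>\<omega>. (\<Sum>t\<in>T. M t \<omega>)\<^sup>2) = (\<Sum>s\<in>T. \<Sum>t\<in>T. expectation (\<lambda>\<omega>. M s \<omega> * M t \<omega>))"
  proof -
    have "expectation (\<lambda>\<omega>. (\<Sum>t\<in>T. M t \<omega>)\<^sup>2) = expectation (\<lambda>\<omega>. \<Sum>s\<in>T. \<Sum>t\<in>T. M s \<omega> * M t \<omega>)"
      by (simp only: power2_eq_square sum_product)
    also have "\<dots> = (\<Sum>s\<in>T. expectation (\<lambda>\<omega>. \<Sum>t\<in>T. M s \<omega> * M t \<omega>))"
      by (rule Bochner_Integration.integral_sum) (intro Bochner_Integration.integrable_sum int_MM)
    also have "\<dots> = (\<Sum>s\<in>T. \<Sum>t\<in>T. expectation (\<lambda>\<omega>. M s \<omega> * M t \<omega>))"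
      by (intro sum.cong refl Bochner_Integration.integral_sum int_MM)
    finally show ?thesis .
  qed
  also have "\<dots> = (\<Sum>s\<in>T. \<Sum>t\<in>T. if t = s then expectation (\<lambda>\<omega>. M s \<omega> * M s \<omega>) else 0)"
  proof (intro sum.cong refl)
    fix s t
    show "expectation (\<lambda>\<omega>. M s \<omega> * M t \<omega>) = (if t = s then expectation (\<lambda>\<omega>. M s \<omega> * M s \<omega>) else 0)"
      using orth[of s t] orth[of t s] by (cases s t rule: linorder_cases) (auto simp: mult.commute)
  qed
  also have "\<dots> = (\<Sum>s\<in>T. expectation (\<lambda>\<omega>. M s \<omega> * M s \<omega>))" using T by simp
  also have "\<dots> \<le> (\<Sum>t\<in>T. expectation (\<lambda>\<omega>. (g (a0 * \<epsilon> t \<omega> + Y t \<omega>))\<^sup>2))"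
    by (intro sum_mono diag)
  finally show ?thesis unfolding M_def .
qed

end

section \<open>Variance of the empirical coefficients\<close>

context iid_innovations
begin

text \<open>
  The martingale decomposition separates the current innovation from the part of the process that is determined
  by the past.
\<close>

lemma linear_process_split:
  assumes "\<And>t. AE \<omega> in P. summable (\<lambda>i. a i * \<epsilon> (t - int i) \<omega>)"
  shows "AE \<omega> in P. summable (\<lambda>i. a (Suc i) * \<epsilon> (t - int i) \<omega>)"
    and "AE \<omega> in P. linear_process a \<epsilon> t \<omega> = a 0 * \<epsilon> t \<omega> + linear_process (\<lambda>i. a (Suc i)) \<epsilon> (t - 1) \<omega>"
proof -
  show "AE \<omega> in P. summable (\<lambda>i. a (Suc i) * \<epsilon> (t - int i) \<omega>)"
    using assms[of "t + 1"]
  proof eventually_elim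
    case (elim \<omega>)
    then have "summable (\<lambda>i. a (Suc i) * \<epsilon> (t + 1 - int (Suc i)) \<omega>)"
      by (subst summable_Suc_iff)
    then show ?case by simp
  qed
  show "AE \<omega> in P. linear_process a \<epsilon> t \<omega> = a 0 * \<epsilon> t \<omega> + linear_process (\<lambda>i. a (Suc i)) \<epsilon> (t - 1) \<omega>"
    using assms[of t]
  proof eventually_elim
    case (elim \<omega>)
    have "(\<Sum>i. a (Suc i) * \<epsilon> (t - int (Suc i)) \<omega>) = (\<Sum>i. a i * \<epsilon> (t - int i) \<omega>) - a 0 * \<epsilon> (t - int 0) \<omega>"
      using suminf_split_head[OF elim] by simp
    then show ?case by (simp add: linear_process_def algebra_simps)
  qed
qed

text \<open>
  Averaging over the current innovation multiplies the Fourier transform of \<open>g\<close> by the characteristic function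
  of \<open>a 0 * \<epsilon> 1\<close>. The constant subtracted has the same form, since the characteristic function of the whole process is
  the product of those of its two parts. The times \<open>s t\<close> are arbitrary by stationarity.
\<close>

lemma smooth_part_fourier:
  fixes a :: "nat \<Rightarrow> real"
  defines "b \<equiv> \<lambda>i. a (Suc i)"
  assumes sm: "\<And>t. AE \<omega> in P. summable (\<lambda>i. a i * \<epsilon> (t - int i) \<omega>)"
    and g: "compactly_supported g" "twice_continuously_differentiable g" and T: "finite T"
  shows "of_real (\<Sum>t\<in>T. expectation (\<lambda>\<omega>'. g (a 0 * \<epsilon> 1 \<omega>' + y t)) - expectation (\<lambda>\<omega>'. g (linear_process a \<epsilon> 1 \<omega>')))
    = of_real (1 / (2 * pi)) * (CLINT u|lborel. fourier g u * (cf (- (u * a 0)) *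
        (\<Sum>t\<in>T. iexp (- u * y t) - (CLINT \<omega>|P. iexp (- u * linear_process b \<epsilon> (s t) \<omega>)))))"
proof -
  note F = C2_compact_support_facts[OF g]
  define m where "m v = (CLINT \<omega>|P. iexp (v * linear_process b \<epsilon> 0 \<omega>))" for v
  have smb: "AE \<omega> in P. summable (\<lambda>i. b i * \<epsilon> (t - int i) \<omega>)" for t
    unfolding b_def by (rule linear_process_split[OF sm])
  have mt: "(CLINT \<omega>|P. iexp (v * linear_process b \<epsilon> t \<omega>)) = m v" for v t
    unfolding m_def by (rule LIMSEQ_unique[OF cf_linear_process[OF smb] cf_linear_process[OF smb]])
  have mX: "(CLINT \<omega>|P. iexp (v * linear_process a \<epsilon> 1 \<omega>)) = cf (v * a 0) * m v" for v
  proof (rule LIMSEQ_unique)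
    show "(\<lambda>N. \<Prod>i<Suc N. cf (v * a i)) \<longlonglongrightarrow> (CLINT \<omega>|P. iexp (v * linear_process a \<epsilon> 1 \<omega>))"
      using cf_linear_process[OF sm[of 1], of v] by (rule LIMSEQ_Suc)
    show "(\<lambda>N. \<Prod>i<Suc N. cf (v * a i)) \<longlonglongrightarrow> cf (v * a 0) * m v"
      unfolding prod.lessThan_Suc_shift m_def using cf_linear_process[OF smb[of 0], of v]
      by (intro tendsto_intros) (simp add: b_def)
  qed
  have m_meas[measurable]: "m \<in> borel_measurable borel" unfolding m_def by measurable
  have m_le: "cmod (m v) \<le> 1" for v
    unfolding m_def by (rule order_trans[OF Bochner_Integration.integral_norm_bound]) (simp add: prob_space)
  have [measurable]: "g \<in> borel_measurable borel" using F(1) by measurable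
  have h: "of_real (expectation (\<lambda>\<omega>. g (a 0 * \<epsilon> 1 \<omega> + z))) = of_real (1 / (2 * pi)) * (CLINT u|lborel. fourier g u * (cf (- (u * a 0)) * iexp (- u * z)))" for z
  proof -
    have inner: "(CLINT \<omega>|P. iexp (- (u * (a 0 * \<epsilon> 1 \<omega> + z)))) = cf (- (u * a 0)) * iexp (- u * z)" for u
    proof -
      have "(CLINT \<omega>|P. iexp (- (u * (a 0 * \<epsilon> 1 \<omega> + z)))) = (CLINT \<omega>|P. iexp (- (u * a 0) * \<epsilon> 1 \<omega>) * iexp (- u * z))"
        by (intro Bochner_Integration.integral_cong refl) (simp add: algebra_simps flip: exp_add)
      also have "\<dots> = cf (- (u * a 0)) * iexp (- u * z)"
        unfolding integral_mult_left_zero cf_eq ..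
      finally show ?thesis .
    qed
    have rv: "(\<lambda>\<omega>. a 0 * \<epsilon> 1 \<omega> + z) \<in> borel_measurable P"
      by measurable
    show ?thesis unfolding expectation_fourier[OF g rv] inner ..
  qed
  have be: "of_real (expectation (\<lambda>\<omega>. g (linear_process a \<epsilon> 1 \<omega>))) = of_real (1 / (2 * pi)) * (CLINT u|lborel. fourier g u * (cf (- (u * a 0)) * m (- u)))"
  proof -
    have inner: "(CLINT \<omega>|P. iexp (- (u * linear_process a \<epsilon> 1 \<omega>))) = cf (- (u * a 0)) * m (- u)" for u
      using mX[of "- u"] by simp
    have rv: "linear_process a \<epsilon> 1 \<in> borel_measurable P"
      by measurable
    show ?thesis unfolding expectation_fourier[OF g rv] inner ..
  qed
  have i1: "integrable lborel (\<lambda>u. fourier g u * (cf (- (u * a 0)) * iexp (- u * z)))" for z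
  proof (rule Bochner_Integration.integrable_bound[OF F(5)])
    show "AE u in lborel. cmod (fourier g u * (cf (- (u * a 0)) * iexp (- u * z))) \<le> cmod (fourier g u)"
      using norm_cf_le by (auto simp: norm_mult intro!: mult_left_le)
  qed measurable
  have i2: "integrable lborel (\<lambda>u. fourier g u * (cf (- (u * a 0)) * m (- u)))"
  proof (rule Bochner_Integration.integrable_bound[OF F(5)])
    show "AE u in lborel. cmod (fourier g u * (cf (- (u * a 0)) * m (- u))) \<le> cmod (fourier g u)"
      using norm_cf_le m_le by (auto simp: norm_mult intro!: mult_left_le mult_le_one)
  qed measurable
  have "of_real (\<Sum>t\<in>T. expectation (\<lambda>\<omega>'. g (a 0 * \<epsilon> 1 \<omega>' + y t)) - expectation (\<lambda>\<omega>'. g (linear_process a \<epsilon> 1 \<omega>')))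
    = (\<Sum>t\<in>T. of_real (1 / (2 * pi)) * (CLINT u|lborel. fourier g u * (cf (- (u * a 0)) * iexp (- u * y t)) - fourier g u * (cf (- (u * a 0)) * m (- u))))"
    unfolding of_real_sum of_real_diff h be Bochner_Integration.integral_diff[OF i1 i2] right_diff_distrib ..
  also have "\<dots> = of_real (1 / (2 * pi)) * (CLINT u|lborel. (\<Sum>t\<in>T. fourier g u * (cf (- (u * a 0)) * iexp (- u * y t)) - fourier g u * (cf (- (u * a 0)) * m (- u))))"
    unfolding sum_distrib_left[symmetric]
    by (subst Bochner_Integration.integral_sum) (rule Bochner_Integration.integrable_diff[OF i1 i2], rule refl)
  also have "\<dots> = of_real (1 / (2 * pi)) * (CLINT u|lborel. fourier g u * (cf (- (u * a 0)) *
        (\<Sum>t\<in>T. iexp (- u * y t) - (CLINT \<omega>|P. iexp (- u * linear_process b \<epsilon> (s t) \<omega>)))))"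
    unfolding mt by (simp only: sum_distrib_left right_diff_distrib)
  finally show ?thesis .
qed

text \<open>
  The empirical coefficient minus its mean is \<open>1 / n\<close> times the sum of a martingale and of smooth functions of the
  past. The martingale contributes \<open>O(2\<^sup>j / n)\<close> to the variance; the rest contributes \<open>O(1 / n)\<close> at every level, which is
  absorbed since \<open>2\<^sup>j\<close> is at least 1.
\<close>

lemma empirical_coefficient_variance:
  assumes sm: "\<And>t. AE \<omega> in P. summable (\<lambda>i. a i * \<epsilon> (t - int i) \<omega>)"
    and sg: "summable (\<lambda>i. \<bar>a i\<bar> powr \<gamma>)"
    and var: "\<And>u. 1 - (cmod (cf u))\<^sup>2 \<le> c * \<bar>u\<bar> powr (2 * \<gamma>)" and c: "c \<ge> 0"
    and W: "(\<integral>\<^sup>+u. ennreal ((cmod (cf (a 0 * u)))\<^sup>2 * \<bar>u\<bar> powr (2 * \<gamma>)) \<partial>lborel) < \<infinity>"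
    and g: "compactly_supported g" "twice_continuously_differentiable g"
  shows "\<exists>C>0. \<forall>j n K. 0 \<le> j \<longrightarrow> 1 \<le> n \<longrightarrow> finite K \<longrightarrow>
    (\<integral>\<^sup>+\<omega>. ennreal (\<Sum>k\<in>K. (empirical_coeff g n (\<lambda>i. linear_process a \<epsilon> (int i) \<omega>) j k
        - expectation (\<lambda>\<omega>'. dilate g j k (linear_process a \<epsilon> 1 \<omega>')))\<^sup>2) \<partial>P)
      \<le> ennreal (C * 2 powr real_of_int j / real n)"
proof -
  define b where "b i = a (Suc i)" for i
  define Y where "Y t = linear_process b \<epsilon> (t - 1)" for t
  define A where "A = (\<Sum>i. \<bar>b i\<bar> powr \<gamma>)"
  define V where "V = enn2real (\<integral>\<^sup>+u. ennreal ((cmod (cf (a 0 * u)))\<^sup>2 * \<bar>u\<bar> powr (2 * \<gamma>)) \<partial>lborel)"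
  have V: "(\<integral>\<^sup>+u. ennreal ((cmod (cf (a 0 * u)))\<^sup>2 * \<bar>u\<bar> powr (2 * \<gamma>)) \<partial>lborel) = ennreal V"
    using W by (simp add: V_def)
  have V0: "V \<ge> 0" by (simp add: V_def)
  have smb: "AE \<omega> in P. summable (\<lambda>i. b i * \<epsilon> (t - int i) \<omega>)" for t
    unfolding b_def by (rule linear_process_split[OF sm])
  have sgb: "summable (\<lambda>i. \<bar>b i\<bar> powr \<gamma>)"
    unfolding b_def using sg by (subst summable_Suc_iff)
  have Xsplit: "AE \<omega> in P. linear_process a \<epsilon> t \<omega> = a 0 * \<epsilon> t \<omega> + Y t \<omega>" for t
    using linear_process_split(2)[OF sm] by (simp add: Y_def b_def[abs_def])
  have [measurable]: "Y t \<in> borel_measurable P" for t unfolding Y_def by measurable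
  obtain B where B: "\<And>x. \<bar>g x\<bar> \<le> B" using C2_compact_support_facts(3)[OF g] by blast
  have g_meas[measurable]: "g \<in> borel_measurable borel" using C2_compact_support_facts(1)[OF g] by measurable
  have d_meas[measurable]: "dilate g j k \<in> borel_measurable borel" for j k unfolding dilate_def by measurable
  obtain Cd where Cd: "Cd > 0" "\<And>K j x. finite K \<Longrightarrow> (\<Sum>k\<in>K. (dilate g j k x)\<^sup>2) \<le> Cd * 2 powr real_of_int j"
    using sum_dilate_square_bound[OF g(1) B] by blast
  obtain C1 where C1: "C1 > 0" "\<And>j K (D :: real \<Rightarrow> complex). finite K \<Longrightarrow> D \<in> borel_measurable borel \<Longrightarrow>
     ennreal (\<Sum>k\<in>K. (cmod (fourier_pairing (dilate g j k) D))\<^sup>2)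
       \<le> ennreal (C1 * 2 powr (- 2 * real_of_int j * 0)) * weighted_energy 0 D"
    \<comment> \<open>for \<open>m = 0\<close> and \<open>s = 0\<close> the moment condition is void and the bound the same at every level\<close>
    using wavelet_coefficients_bound[OF g, of 0 0] by (auto simp: vanishing_moments_def)
  \<comment> \<open>the factor 2 comes from squaring the sum of the martingale part and the smooth part\<close>
  define C where "C = 2 * (Cd + C1 * (c * V * A\<^sup>2))"
  have C0: "C > 0" unfolding C_def using Cd(1) C1(1) c V0 by (intro mult_pos_pos add_pos_nonneg mult_nonneg_nonneg) auto
  have main: "(\<integral>\<^sup>+\<omega>. ennreal (\<Sum>k\<in>K. (empirical_coeff g n (\<lambda>i. linear_process a \<epsilon> (int i) \<omega>) j k
        - expectation (\<lambda>\<omega>'. dilate g j k (linear_process a \<epsilon> 1 \<omega>')))\<^sup>2) \<partial>P)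
      \<le> ennreal (C * 2 powr real_of_int j / real n)"
    if j: "0 \<le> j" and n: "1 \<le> n" and K: "finite K" for j :: int and n :: nat and K :: "int set"
  proof -
    define T where "T = {1..int n}"
    have T: "finite T" "card T = n" by (auto simp: T_def)
    define h where "h k z = expectation (\<lambda>\<omega>. dilate g j k (a 0 * \<epsilon> 1 \<omega> + z))" for k z
    define \<beta> where "\<beta> k = expectation (\<lambda>\<omega>'. dilate g j k (linear_process a \<epsilon> 1 \<omega>'))" for k
    define M where "M k \<omega> = (\<Sum>t\<in>T. dilate g j k (a 0 * \<epsilon> t \<omega> + Y t \<omega>) - h k (Y t \<omega>))" for k \<omega>
    define S where "S k \<omega> = (\<Sum>t\<in>T. h k (Y t \<omega>) - \<beta> k)" for k \<omega>
    have [measurable]: "h k \<in> borel_measurable borel" for k unfolding h_def by measurable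
    have [measurable]: "M k \<in> borel_measurable P" "S k \<in> borel_measurable P" for k
      unfolding M_def S_def by measurable
    have gd: "compactly_supported (dilate g j k)" "twice_continuously_differentiable (dilate g j k)" for k
      using g by (auto intro: compactly_supported_dilate twice_continuously_differentiable_dilate)
    have Mk: "(\<integral>\<^sup>+\<omega>. ennreal (\<Sum>k\<in>K. (M k \<omega>)\<^sup>2) \<partial>P) \<le> ennreal (real n * (Cd * 2 powr real_of_int j))"
    proof -
      define Bj where "Bj = 2 powr (real_of_int j / 2) * B"
      have Bj: "\<bar>dilate g j k x\<bar> \<le> Bj" for k x
        unfolding dilate_def Bj_def abs_mult using B by (intro mult_mono) auto
      have Bj2: "\<bar>(dilate g j k x)\<^sup>2\<bar> \<le> Bj\<^sup>2" for k x using power_mono[OF Bj[of k x], of 2] by simp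
      have i2: "integrable P (\<lambda>\<omega>. (dilate g j k (a 0 * \<epsilon> t \<omega> + Y t \<omega>))\<^sup>2)" for k t
        by (rule bounded_integrable[where B="Bj\<^sup>2"]) (use Bj2 in auto)
      have hb: "\<bar>h k z\<bar> \<le> Bj" for k z
        unfolding h_def by (rule abs_expectation_le[OF _ Bj]) measurable
      have Mb: "\<bar>M k \<omega>\<bar> \<le> (\<Sum>t\<in>T. 2 * Bj)" for k \<omega>
        unfolding M_def
      proof (rule order_trans[OF sum_abs sum_mono])
        fix t show "\<bar>dilate g j k (a 0 * \<epsilon> t \<omega> + Y t \<omega>) - h k (Y t \<omega>)\<bar> \<le> 2 * Bj"
          using Bj[of k "a 0 * \<epsilon> t \<omega> + Y t \<omega>"] hb[of k "Y t \<omega>"] by linarith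
      qed
      have iM: "integrable P (\<lambda>\<omega>. (M k \<omega>)\<^sup>2)" for k
      proof (rule bounded_integrable[where B="(\<Sum>t\<in>T. 2 * Bj)\<^sup>2"])
        show "norm ((M k \<omega>)\<^sup>2) \<le> (\<Sum>t\<in>T. 2 * Bj)\<^sup>2" for \<omega>
          using power_mono[OF Mb[of k \<omega>], of 2] by simp
      qed measurable
      have "(\<integral>\<^sup>+\<omega>. ennreal (\<Sum>k\<in>K. (M k \<omega>)\<^sup>2) \<partial>P) = ennreal (expectation (\<lambda>\<omega>. \<Sum>k\<in>K. (M k \<omega>)\<^sup>2))"
        by (rule nn_integral_eq_integral) (auto intro!: Bochner_Integration.integrable_sum iM sum_nonneg)
      also have "expectation (\<lambda>\<omega>. \<Sum>k\<in>K. (M k \<omega>)\<^sup>2) = (\<Sum>k\<in>K. expectation (\<lambda>\<omega>. (M k \<omega>)\<^sup>2))"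
        by (rule Bochner_Integration.integral_sum[OF iM])
      also have "\<dots> \<le> (\<Sum>k\<in>K. \<Sum>t\<in>T. expectation (\<lambda>\<omega>. (dilate g j k (a 0 * \<epsilon> t \<omega> + Y t \<omega>))\<^sup>2))"
        unfolding M_def h_def Y_def by (rule sum_mono) (rule martingale_difference_variance[OF d_meas Bj T(1)])
      also have "\<dots> = (\<Sum>t\<in>T. expectation (\<lambda>\<omega>. \<Sum>k\<in>K. (dilate g j k (a 0 * \<epsilon> t \<omega> + Y t \<omega>))\<^sup>2))"
        by (subst sum.swap) (intro sum.cong refl Bochner_Integration.integral_sum[OF i2, symmetric])
      also have "\<dots> \<le> (\<Sum>t\<in>T. expectation (\<lambda>\<omega>. Cd * 2 powr real_of_int j))"
        by (intro sum_mono Bochner_Integration.integral_mono Bochner_Integration.integrable_sum i2 Cd K) auto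
      also have "\<dots> = real n * (Cd * 2 powr real_of_int j)" by (simp add: prob_space T)
      finally show ?thesis by (simp add: ennreal_leI)
    qed
    define D where "D \<omega> u = cf (- (u * a 0)) * (\<Sum>t\<in>T. iexp (- u * Y t \<omega>) - (CLINT \<omega>'|P. iexp (- u * Y t \<omega>')))" for \<omega> u
    have D_meas[measurable]: "(\<lambda>(\<omega>, u). D \<omega> u) \<in> borel_measurable (P \<Otimes>\<^sub>M lborel)"
      unfolding D_def by measurable
    have D_meas'[measurable]: "D \<omega> \<in> borel_measurable borel" for \<omega>
      unfolding D_def by measurable
    have Sk: "(\<integral>\<^sup>+\<omega>. ennreal (\<Sum>k\<in>K. (S k \<omega>)\<^sup>2) \<partial>P) \<le> ennreal (real n * (C1 * (c * V * A\<^sup>2)))"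
    proof -
      let ?N = "\<lambda>\<omega>. \<integral>\<^sup>+u. ennreal ((cmod (D \<omega> u))\<^sup>2) \<partial>lborel"
      have S_eq: "complex_of_real (S k \<omega>) = of_real (1 / (2 * pi)) * (fourier_pairing (dilate g j k) (D \<omega>))" for k \<omega>
        unfolding S_def h_def \<beta>_def D_def Y_def b_def[abs_def]
        by (rule smooth_part_fourier[OF sm gd T(1)])
      have S_le: "(S k \<omega>)\<^sup>2 \<le> (cmod (fourier_pairing (dilate g j k) (D \<omega>)))\<^sup>2" for k \<omega>
        by (rule square_le_of_eq_inverse_two_pi[OF S_eq])
      have "(\<integral>\<^sup>+\<omega>. ennreal (\<Sum>k\<in>K. (S k \<omega>)\<^sup>2) \<partial>P) \<le> (\<integral>\<^sup>+\<omega>. ennreal C1 * ?N \<omega> \<partial>P)"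
      proof (rule nn_integral_mono)
        fix \<omega>
        have "ennreal (\<Sum>k\<in>K. (S k \<omega>)\<^sup>2) \<le> ennreal (\<Sum>k\<in>K. (cmod (fourier_pairing (dilate g j k) (D \<omega>)))\<^sup>2)"
          by (intro ennreal_leI sum_mono S_le)
        also have "\<dots> \<le> ennreal (C1 * 2 powr (- 2 * real_of_int j * 0)) * weighted_energy 0 (D \<omega>)"
          by (rule C1(2)[OF K D_meas'])
        also have "\<dots> \<le> ennreal C1 * ?N \<omega>"
          by (intro mult_mono nn_integral_mono ennreal_leI) auto
        finally show "ennreal (\<Sum>k\<in>K. (S k \<omega>)\<^sup>2) \<le> ennreal C1 * ?N \<omega>" .
      qed
      also have "\<dots> = ennreal C1 * (\<integral>\<^sup>+\<omega>. ?N \<omega> \<partial>P)"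
        by (rule nn_integral_cmult) measurable
      also have "(\<integral>\<^sup>+\<omega>. ?N \<omega> \<partial>P) = (\<integral>\<^sup>+u. (\<integral>\<^sup>+\<omega>. ennreal ((cmod (D \<omega> u))\<^sup>2) \<partial>P) \<partial>lborel)"
      proof -
        interpret L: pair_sigma_finite P lborel
          by (simp add: pair_sigma_finite_def sigma_finite_measure_axioms sigma_finite_lborel)
        show ?thesis by (rule L.Fubini'[symmetric]) measurable
      qed
      also have "\<dots> \<le> (\<integral>\<^sup>+u. ennreal (real n * c * A\<^sup>2) * ennreal ((cmod (cf (a 0 * u)))\<^sup>2 * \<bar>u\<bar> powr (2 * \<gamma>)) \<partial>lborel)"
      proof (rule nn_integral_mono)
        fix u :: real
        let ?Q = "\<lambda>\<omega>. (cmod (\<Sum>t\<in>T. iexp (- u * Y t \<omega>) - (CLINT \<omega>'|P. iexp (- u * Y t \<omega>'))))\<^sup>2"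
        have cfc: "cmod (cf (- (u * a 0))) = cmod (cf (a 0 * u))"
          unfolding cf_uminus complex_mod_cnj by (simp only: mult.commute)
        have Q: "expectation ?Q \<le> real n * (c * \<bar>u\<bar> powr (2 * \<gamma>) * A\<^sup>2)"
        proof -
          \<comment> \<open>\<open>Y t\<close> is a linear process at time \<open>t - 1\<close>\<close>
          define T' where "T' = (\<lambda>t. t - 1) ` T"
          have T': "finite T'" "card T' = n"
            using T by (auto simp: T'_def card_image inj_on_def)
          have "expectation ?Q = expectation (\<lambda>\<omega>. (cmod (\<Sum>t\<in>T'. iexp (- u * linear_process b \<epsilon> t \<omega>) -
            (CLINT \<omega>|P. iexp (- u * linear_process b \<epsilon> t \<omega>))))\<^sup>2)"
            unfolding T'_def Y_def by (subst sum.reindex) (simp_all add: inj_on_def)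
          also have "\<dots> \<le> real (card T') * (c * \<bar>- u\<bar> powr (2 * \<gamma>) * (\<Sum>i. \<bar>b i\<bar> powr \<gamma>)\<^sup>2)"
            by (rule linear_process_empirical_cf_variance[OF var c smb sgb T'(1)])
          finally show ?thesis by (simp add: A_def T')
        qed
        have Qb: "?Q \<omega> \<le> (\<Sum>t\<in>T. 2)\<^sup>2" for \<omega>
        proof (intro power_mono sum_norm_le norm_ge_zero)
          fix t
          have "cmod (CLINT \<omega>'|P. iexp (- u * Y t \<omega>')) \<le> 1"
            by (rule order_trans[OF Bochner_Integration.integral_norm_bound]) (simp add: prob_space)
          then show "cmod (iexp (- u * Y t \<omega>) - (CLINT \<omega>'|P. iexp (- u * Y t \<omega>'))) \<le> 2"
            by (intro order_trans[OF norm_triangle_ineq4]) simp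
        qed
        have iQ: "integrable P ?Q"
        proof (rule bounded_integrable[where B="(\<Sum>t\<in>T. 2)\<^sup>2"])
          show "norm (?Q \<omega>) \<le> (\<Sum>t\<in>T. 2)\<^sup>2" for \<omega>
            unfolding real_norm_def using Qb[of \<omega>] by (subst abs_of_nonneg) simp_all
        qed measurable
        have "(\<integral>\<^sup>+\<omega>. ennreal ((cmod (D \<omega> u))\<^sup>2) \<partial>P) = (\<integral>\<^sup>+\<omega>. ennreal ((cmod (cf (a 0 * u)))\<^sup>2 * ?Q \<omega>) \<partial>P)"
          unfolding D_def norm_mult cfc power_mult_distrib ..
        also have "\<dots> = ennreal (expectation (\<lambda>\<omega>. (cmod (cf (a 0 * u)))\<^sup>2 * ?Q \<omega>))"
          by (rule nn_integral_eq_integral[OF integrable_mult_right[OF iQ]]) simp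
        also have "expectation (\<lambda>\<omega>. (cmod (cf (a 0 * u)))\<^sup>2 * ?Q \<omega>) = (cmod (cf (a 0 * u)))\<^sup>2 * expectation ?Q"
          by (rule integral_mult_right_zero)
        also have "ennreal \<dots> \<le> ennreal ((cmod (cf (a 0 * u)))\<^sup>2 * (real n * (c * \<bar>u\<bar> powr (2 * \<gamma>) * A\<^sup>2)))"
          by (intro ennreal_leI mult_left_mono Q) simp
        also have "\<dots> = ennreal (real n * c * A\<^sup>2) * ennreal ((cmod (cf (a 0 * u)))\<^sup>2 * \<bar>u\<bar> powr (2 * \<gamma>))"
          using c by (subst ennreal_mult'[symmetric]) (simp_all add: mult_ac)
        finally show "(\<integral>\<^sup>+\<omega>. ennreal ((cmod (D \<omega> u))\<^sup>2) \<partial>P)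
          \<le> ennreal (real n * c * A\<^sup>2) * ennreal ((cmod (cf (a 0 * u)))\<^sup>2 * \<bar>u\<bar> powr (2 * \<gamma>))" .
      qed
      also have "\<dots> = ennreal (real n * c * A\<^sup>2) * ennreal V"
        unfolding V[symmetric] by (rule nn_integral_cmult) measurable
      also have "ennreal C1 * (ennreal (real n * c * A\<^sup>2) * ennreal V) = ennreal (real n * (C1 * (c * V * A\<^sup>2)))"
        using c C1(1) V0 by (simp add: mult_ac flip: ennreal_mult')
      finally show ?thesis by (simp add: mult_left_mono)
    qed
    let ?R = "\<lambda>\<omega> k. empirical_coeff g n (\<lambda>i. linear_process a \<epsilon> (int i) \<omega>) j k - \<beta> k"
    have "(\<integral>\<^sup>+\<omega>. ennreal (\<Sum>k\<in>K. (?R \<omega> k)\<^sup>2) \<partial>P)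
      \<le> (\<integral>\<^sup>+\<omega>. ennreal (2 / (real n)\<^sup>2) * (ennreal (\<Sum>k\<in>K. (M k \<omega>)\<^sup>2) + ennreal (\<Sum>k\<in>K. (S k \<omega>)\<^sup>2)) \<partial>P)"
    proof (rule nn_integral_mono_AE)
      have "AE \<omega> in P. \<forall>t\<in>T. linear_process a \<epsilon> t \<omega> = a 0 * \<epsilon> t \<omega> + Y t \<omega>"
        using T Xsplit by (simp add: AE_ball_countable countable_finite)
      then show "AE \<omega> in P. ennreal (\<Sum>k\<in>K. (?R \<omega> k)\<^sup>2)
        \<le> ennreal (2 / (real n)\<^sup>2) * (ennreal (\<Sum>k\<in>K. (M k \<omega>)\<^sup>2) + ennreal (\<Sum>k\<in>K. (S k \<omega>)\<^sup>2))"
      proof eventually_elim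
        case (elim \<omega>)
        have ec: "?R \<omega> k = (M k \<omega> + S k \<omega>) / real n" for k
        proof -
          have "T = int ` {1..n}" by (simp add: T_def image_int_atLeastAtMost)
          then have "(\<Sum>i=1..n. dilate g j k (linear_process a \<epsilon> (int i) \<omega>)) = (\<Sum>t\<in>T. dilate g j k (linear_process a \<epsilon> t \<omega>))"
            by (simp add: sum.reindex)
          also have "\<dots> = (\<Sum>t\<in>T. dilate g j k (a 0 * \<epsilon> t \<omega> + Y t \<omega>))"
            using elim by (intro sum.cong refl) auto
          also have "\<dots> = M k \<omega> + S k \<omega> + real n * \<beta> k"
            using T by (simp add: M_def S_def sum_subtractf)
          finally show ?thesis
            using n by (simp add: empirical_coeff_def field_simps)
        qed
        have "(\<Sum>k\<in>K. (?R \<omega> k)\<^sup>2)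
           \<le> (\<Sum>k\<in>K. 2 / (real n)\<^sup>2 * ((M k \<omega>)\<^sup>2 + (S k \<omega>)\<^sup>2))"
        proof (rule sum_mono)
          fix k
          have "(M k \<omega> + S k \<omega>)\<^sup>2 \<le> 2 * ((M k \<omega>)\<^sup>2 + (S k \<omega>)\<^sup>2)"
            using sum_squares_bound[of "M k \<omega>" "S k \<omega>"] by (simp add: power2_sum)
          then show "(?R \<omega> k)\<^sup>2 \<le> 2 / (real n)\<^sup>2 * ((M k \<omega>)\<^sup>2 + (S k \<omega>)\<^sup>2)"
            unfolding ec power_divide by (simp add: divide_right_mono)
        qed
        also have "\<dots> = 2 / (real n)\<^sup>2 * ((\<Sum>k\<in>K. (M k \<omega>)\<^sup>2) + (\<Sum>k\<in>K. (S k \<omega>)\<^sup>2))"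
          by (simp only: sum_distrib_left[symmetric] sum.distrib)
        finally show ?case
          by (simp add: sum_nonneg flip: ennreal_mult' ennreal_plus)
      qed
    qed
    also have "\<dots> = ennreal (2 / (real n)\<^sup>2) * ((\<integral>\<^sup>+\<omega>. ennreal (\<Sum>k\<in>K. (M k \<omega>)\<^sup>2) \<partial>P) + (\<integral>\<^sup>+\<omega>. ennreal (\<Sum>k\<in>K. (S k \<omega>)\<^sup>2) \<partial>P))"
      by (simp add: nn_integral_cmult nn_integral_add)
    also have "\<dots> \<le> ennreal (2 / (real n)\<^sup>2) * (ennreal (real n * (Cd * 2 powr real_of_int j)) + ennreal (real n * (C1 * (c * V * A\<^sup>2))))"
      by (intro mult_left_mono add_mono Mk Sk) auto
    also have "\<dots> = ennreal (2 / (real n)\<^sup>2 * (real n * (Cd * 2 powr real_of_int j) + real n * (C1 * (c * V * A\<^sup>2))))"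
    proof -
      have "ennreal z * (ennreal x + ennreal y) = ennreal (z * (x + y))" if "0 \<le> x" "0 \<le> y" "0 \<le> z" for x y z
        using that by (simp only: ennreal_mult' ennreal_plus)
      then show ?thesis using Cd(1) C1(1) c V0 by simp
    qed
    also have "\<dots> \<le> ennreal (C * 2 powr real_of_int j / real n)"
    proof (rule ennreal_leI)
      have "1 \<le> 2 powr real_of_int j" using j by (simp add: ge_one_powr_ge_zero)
      then have "C1 * (c * V * A\<^sup>2) * 1 \<le> C1 * (c * V * A\<^sup>2) * 2 powr real_of_int j"
        using C1(1) c V0 by (intro mult_left_mono) auto
      then have "2 * (Cd * 2 powr real_of_int j + C1 * (c * V * A\<^sup>2)) \<le> C * 2 powr real_of_int j"
        by (simp add: C_def algebra_simps)
      then have "2 * (Cd * 2 powr real_of_int j + C1 * (c * V * A\<^sup>2)) / real n \<le> C * 2 powr real_of_int j / real n"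
        by (rule divide_right_mono) simp
      moreover have "2 / (real n)\<^sup>2 * (real n * (Cd * 2 powr real_of_int j) + real n * (C1 * (c * V * A\<^sup>2)))
        = 2 * (Cd * 2 powr real_of_int j + C1 * (c * V * A\<^sup>2)) / real n"
        using n by (simp add: field_simps power2_eq_square)
      ultimately show "2 / (real n)\<^sup>2 * (real n * (Cd * 2 powr real_of_int j) + real n * (C1 * (c * V * A\<^sup>2))) \<le> C * 2 powr real_of_int j / real n"
        by linarith
    qed
    finally show ?thesis unfolding \<beta>_def .
  qed
  show ?thesis using C0 main by blast
qed

end

section \<open>Orthonormal expansion of the estimation error\<close>

lemma L2_measurable: "g \<in> L2 \<Longrightarrow> g \<in> borel_measurable borel"
  by (simp add: L2_def)

lemma L2_integrable_mult:
  assumes "g \<in> L2" "h \<in> L2"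
  shows "integrable lborel (\<lambda>x. g x * h x)"
proof (rule Bochner_Integration.integrable_bound)
  have [measurable]: "g \<in> borel_measurable borel" "h \<in> borel_measurable borel"
    using assms by (auto simp: L2_def)
  show "integrable lborel (\<lambda>x. (g x)\<^sup>2 + (h x)\<^sup>2)" using assms by (simp add: L2_def)
  show "(\<lambda>x. g x * h x) \<in> borel_measurable lborel" by measurable
  show "AE x in lborel. norm (g x * h x) \<le> norm ((g x)\<^sup>2 + (h x)\<^sup>2)"
  proof (intro AE_I2)
    fix x
    have "2 * \<bar>g x * h x\<bar> \<le> (g x)\<^sup>2 + (h x)\<^sup>2"
      using sum_squares_bound[of "\<bar>g x\<bar>" "\<bar>h x\<bar>"] by (simp add: abs_mult)
    then show "norm (g x * h x) \<le> norm ((g x)\<^sup>2 + (h x)\<^sup>2)" by simp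
  qed
qed

lemma L2_scale: "g \<in> L2 \<Longrightarrow> (\<lambda>x. c * g x) \<in> L2"
  by (auto simp: L2_def power_mult_distrib)

lemma L2_add:
  assumes "g \<in> L2" "h \<in> L2"
  shows "(\<lambda>x. g x + h x) \<in> L2"
proof -
  have "integrable lborel (\<lambda>x. (g x)\<^sup>2 + 2 * (g x * h x) + (h x)\<^sup>2)"
    using assms L2_integrable_mult[OF assms]
    by (intro Bochner_Integration.integrable_add integrable_mult_right) (auto simp: L2_def)
  then show ?thesis using assms by (auto simp: L2_def power2_sum algebra_simps)
qed

lemma L2_diff: "g \<in> L2 \<Longrightarrow> h \<in> L2 \<Longrightarrow> (\<lambda>x. g x - h x) \<in> L2"
  using L2_add[of g "\<lambda>x. - 1 * h x"] L2_scale[of h "- 1"] by simp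

lemma L2_combination:
  assumes "finite F" "\<And>i. i \<in> F \<Longrightarrow> e i \<in> L2"
  shows "(\<lambda>x. \<Sum>i\<in>F. c i * e i x) \<in> L2"
  using assms
proof (induction F rule: finite_induct)
  case empty
  then show ?case by (simp add: L2_def)
next
  case (insert i F)
  then show ?case by (simp add: L2_add L2_scale)
qed

lemma L2_inner_diff_left:
  "g \<in> L2 \<Longrightarrow> h \<in> L2 \<Longrightarrow> k \<in> L2 \<Longrightarrow> L2_inner (\<lambda>x. g x - h x) k = L2_inner g k - L2_inner h k"
  unfolding L2_inner_def left_diff_distrib by (intro Bochner_Integration.integral_diff L2_integrable_mult)

lemma L2_inner_combination_left:
  assumes "finite F" "\<And>i. i \<in> F \<Longrightarrow> e i \<in> L2" "k \<in> L2"
  shows "L2_inner (\<lambda>x. \<Sum>i\<in>F. c i * e i x) k = (\<Sum>i\<in>F. c i * L2_inner (e i) k)"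
proof -
  have "L2_inner (\<lambda>x. \<Sum>i\<in>F. c i * e i x) k = (LINT x|lborel. (\<Sum>i\<in>F. c i * (e i x * k x)))"
    by (simp add: L2_inner_def sum_distrib_right mult.assoc)
  also have "\<dots> = (\<Sum>i\<in>F. LINT x|lborel. c i * (e i x * k x))"
    by (rule Bochner_Integration.integral_sum) (intro integrable_mult_right L2_integrable_mult assms)
  finally show ?thesis by (simp add: L2_inner_def)
qed

lemma L2_inner_commute: "L2_inner g h = L2_inner h g"
  by (simp add: L2_inner_def mult.commute)

text \<open>
  One half of Parseval's identity. Every finite combination \<open>h\<close> over \<open>F\<close> is at least as far from \<open>g\<close> as the orthogonal
  projection of \<open>g\<close> onto the span of \<open>F\<close>, so if \<open>h\<close> is within \<open>sqrt \<delta>\<close> of \<open>g\<close>, then the squared coefficients over \<open>F\<close>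
  exhaust the squared norm of \<open>g\<close> up to \<open>\<delta>\<close>.
\<close>

lemma orthonormal_basis_norm_bound:
  assumes onb: "orthonormal_basis e I L2" and g: "g \<in> L2"
    and B: "\<And>F. finite F \<Longrightarrow> F \<subseteq> I \<Longrightarrow> (\<Sum>i\<in>F. (L2_inner g (e i))\<^sup>2) \<le> B"
  shows "L2_inner g g \<le> B"
proof (rule field_le_epsilon)
  fix \<delta> :: real assume \<delta>: "\<delta> > 0"
  have eL: "\<And>i. i \<in> I \<Longrightarrow> e i \<in> L2"
    and ortho: "\<And>i j. i \<in> I \<Longrightarrow> j \<in> I \<Longrightarrow> L2_inner (e i) (e j) = (if i = j then 1 else 0)"
    using onb unfolding orthonormal_basis_def by blast+
  have "g \<in> L2_closure (finite_combinations e I)" using onb g by (simp add: orthonormal_basis_def)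
  then obtain h where "h \<in> finite_combinations e I" and h: "L2_norm (\<lambda>x. g x - h x) < sqrt \<delta>"
  proof -
    have "sqrt \<delta> > 0" using \<delta> by simp
    then show ?thesis
      using \<open>g \<in> L2_closure (finite_combinations e I)\<close> that unfolding L2_closure_def by blast
  qed
  then obtain F c where F: "finite F" "F \<subseteq> I" and hF: "h = (\<lambda>x. \<Sum>i\<in>F. c i * e i x)"
    unfolding finite_combinations_def by blast
  have eF: "\<And>i. i \<in> F \<Longrightarrow> e i \<in> L2" using F eL by blast
  have hL: "h \<in> L2" unfolding hF by (rule L2_combination[OF F(1) eF])
  have he: "L2_inner h (e j) = c j" if "j \<in> F" for j
  proof -
    have "L2_inner h (e j) = (\<Sum>i\<in>F. c i * L2_inner (e i) (e j))"
      unfolding hF using that by (intro L2_inner_combination_left F eF)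
    also have "\<dots> = (\<Sum>i\<in>F. if i = j then c j else 0)"
    proof (rule sum.cong[OF refl])
      fix i assume "i \<in> F"
      then have "L2_inner (e i) (e j) = (if i = j then 1 else 0)" using that F(2) by (intro ortho) auto
      then show "c i * L2_inner (e i) (e j) = (if i = j then c j else 0)" by simp
    qed
    finally show ?thesis using that F by simp
  qed
  have hk: "L2_inner h k = (\<Sum>i\<in>F. c i * L2_inner (e i) k)" if "k \<in> L2" for k
    unfolding hF by (intro L2_inner_combination_left F eF that)
  let ?D = "\<lambda>x. g x - h x"
  have DL: "?D \<in> L2" by (rule L2_diff[OF g hL])
  have "L2_inner ?D ?D = L2_inner g ?D - L2_inner h ?D" by (rule L2_inner_diff_left[OF g hL DL])
  also have "L2_inner g ?D = L2_inner g g - L2_inner h g"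
    unfolding L2_inner_commute[of g ?D] by (rule L2_inner_diff_left[OF g hL g])
  also have "L2_inner h ?D = L2_inner h g - L2_inner h h"
    unfolding L2_inner_commute[of h ?D] L2_inner_commute[of h g] by (rule L2_inner_diff_left[OF g hL hL])
  also have "L2_inner h h = (\<Sum>i\<in>F. (c i)\<^sup>2)"
    unfolding hk[OF hL]
  proof (rule sum.cong[OF refl])
    fix i assume "i \<in> F"
    then have "L2_inner (e i) h = c i" using he L2_inner_commute[of "e i" h] by simp
    then show "c i * L2_inner (e i) h = (c i)\<^sup>2" by (simp add: power2_eq_square)
  qed
  also have "L2_inner h g = (\<Sum>i\<in>F. c i * L2_inner g (e i))"
    unfolding hk[OF g] by (intro sum.cong refl arg_cong2[where f="(*)"] L2_inner_commute)
  finally have dd: "L2_inner ?D ?D = L2_inner g g - (\<Sum>i\<in>F. c i * L2_inner g (e i)) -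
      ((\<Sum>i\<in>F. c i * L2_inner g (e i)) - (\<Sum>i\<in>F. (c i)\<^sup>2))" .
  have "(\<Sum>i\<in>F. (c i - L2_inner g (e i))\<^sup>2) = (\<Sum>i\<in>F. (c i)\<^sup>2) - 2 * (\<Sum>i\<in>F. c i * L2_inner g (e i))
      + (\<Sum>i\<in>F. (L2_inner g (e i))\<^sup>2)"
    by (simp add: power2_diff sum.distrib sum_subtractf sum_distrib_left mult.assoc)
  with dd have "L2_inner (\<lambda>x. g x - h x) (\<lambda>x. g x - h x) + (\<Sum>i\<in>F. (L2_inner g (e i))\<^sup>2)
      = L2_inner g g + (\<Sum>i\<in>F. (c i - L2_inner g (e i))\<^sup>2)"
    by linarith
  moreover have "(\<Sum>i\<in>F. (c i - L2_inner g (e i))\<^sup>2) \<ge> 0" by (simp add: sum_nonneg)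
  moreover have "L2_inner (\<lambda>x. g x - h x) (\<lambda>x. g x - h x) < \<delta>"
    using h unfolding L2_norm_def by simp
  ultimately show "L2_inner g g \<le> B + \<delta>" using B[OF F] by linarith
qed

lemma empirical_coeff_finite_support:
  assumes "compactly_supported g"
  shows "finite {k. empirical_coeff g n xs j k \<noteq> 0}"
proof -
  obtain R where R: "R > 0" "\<And>x. R \<le> \<bar>x\<bar> \<Longrightarrow> g x = 0"
    using compactly_supported_vanishes[OF assms] by blast
  let ?y = "\<lambda>i. 2 powr real_of_int j * xs i"
  have "{k. empirical_coeff g n xs j k \<noteq> 0} \<subseteq> (\<Union>i\<in>{1..n}. {\<lceil>?y i - R\<rceil>..\<lfloor>?y i + R\<rfloor>})"
  proof
    fix k assume "k \<in> {k. empirical_coeff g n xs j k \<noteq> 0}"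
    then have "\<exists>i\<in>{1..n}. dilate g j k (xs i) \<noteq> 0"
      unfolding empirical_coeff_def by (auto dest: sum.neutral[rotated] intro: ccontr)
    then obtain i where i: "i \<in> {1..n}" and "dilate g j k (xs i) \<noteq> 0" by blast
    then have iR: "\<not> R \<le> \<bar>?y i - k\<bar>"
      using R(2)[of "?y i - k"] by (auto simp: dilate_def)
    then have "k \<in> {\<lceil>?y i - R\<rceil>..\<lfloor>?y i + R\<rfloor>}"
      unfolding atLeastAtMost_iff ceiling_le_iff le_floor_iff by linarith
    with i show "k \<in> (\<Union>i\<in>{1..n}. {\<lceil>?y i - R\<rceil>..\<lfloor>?y i + R\<rfloor>})" by blast
  qed
  then show ?thesis by (rule finite_subset) auto
qed

lemma infsum_finite_support:
  fixes f :: "'a \<Rightarrow> real"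
  assumes "finite K" "\<And>k. k \<notin> K \<Longrightarrow> f k = 0"
  shows "infsum f UNIV = sum f K"
proof -
  have "infsum f UNIV = infsum f K"
    by (rule infsum_cong_neutral) (use assms in auto)
  then show ?thesis using assms by simp
qed

text \<open>
  Indexed like the basis, so that the error of the estimator can be read off coefficient by coefficient.
\<close>

definition estimator_coeff :: "(real \<Rightarrow> real) \<Rightarrow> (real \<Rightarrow> real) \<Rightarrow> int \<Rightarrow> nat \<Rightarrow> (nat \<Rightarrow> real) \<Rightarrow> int + int \<times> int \<Rightarrow> real" where
  "estimator_coeff \<phi> \<psi> J n xs = case_sum (empirical_coeff \<phi> n xs 0)
     (\<lambda>(j, k). if 0 \<le> j \<and> j \<le> J then empirical_coeff \<psi> n xs j k else 0)"

abbreviation wavelet_family :: "(real \<Rightarrow> real) \<Rightarrow> (real \<Rightarrow> real) \<Rightarrow> int + int \<times> int \<Rightarrow> real \<Rightarrow> real" where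
  "wavelet_family \<phi> \<psi> \<equiv> case_sum (dilate \<phi> 0) (\<lambda>(j, k). dilate \<psi> j k)"

text \<open>
  For a fixed sample only finitely many empirical coefficients of each level differ from 0.
\<close>

lemma wavelet_estimator_combination:
  assumes "compactly_supported \<phi>" "compactly_supported \<psi>"
  shows "\<exists>F. finite F \<and> F \<subseteq> UNIV <+> ({0..} \<times> UNIV) \<and> (\<forall>i. i \<notin> F \<longrightarrow> estimator_coeff \<phi> \<psi> J n xs i = 0) \<and>
    wavelet_estimator \<phi> \<psi> J n xs = (\<lambda>x. \<Sum>i\<in>F. estimator_coeff \<phi> \<psi> J n xs i * wavelet_family \<phi> \<psi> i x)"
proof -
  define K0 where "K0 = {k. empirical_coeff \<phi> n xs 0 k \<noteq> 0}"
  define K where "K j = {k. empirical_coeff \<psi> n xs j k \<noteq> 0}" for j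
  have fin: "finite K0" "finite (K j)" for j
    unfolding K0_def K_def using assms by (auto intro: empirical_coeff_finite_support)
  define F where "F = K0 <+> Sigma {0..J} K"
  have F: "finite F" unfolding F_def using fin by auto
  have "wavelet_estimator \<phi> \<psi> J n xs x = (\<Sum>i\<in>F. estimator_coeff \<phi> \<psi> J n xs i * wavelet_family \<phi> \<psi> i x)" for x
  proof -
    have "wavelet_estimator \<phi> \<psi> J n xs x = (\<Sum>k\<in>K0. empirical_coeff \<phi> n xs 0 k * dilate \<phi> 0 k x)
        + (\<Sum>j=0..J. \<Sum>k\<in>K j. empirical_coeff \<psi> n xs j k * dilate \<psi> j k x)"
      unfolding wavelet_estimator_def
      by (intro arg_cong2[where f="(+)"] sum.cong refl infsum_finite_support fin) (auto simp: K0_def K_def)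
    also have "(\<Sum>j=0..J. \<Sum>k\<in>K j. empirical_coeff \<psi> n xs j k * dilate \<psi> j k x)
       = (\<Sum>(j, k)\<in>Sigma {0..J} K. empirical_coeff \<psi> n xs j k * dilate \<psi> j k x)"
      by (rule sum.Sigma) (use fin in auto)
    also have "\<dots> = (\<Sum>p\<in>Sigma {0..J} K. estimator_coeff \<phi> \<psi> J n xs (Inr p) * wavelet_family \<phi> \<psi> (Inr p) x)"
      by (rule sum.cong) (auto simp: estimator_coeff_def)
    also have "(\<Sum>k\<in>K0. empirical_coeff \<phi> n xs 0 k * dilate \<phi> 0 k x)
       = (\<Sum>k\<in>K0. estimator_coeff \<phi> \<psi> J n xs (Inl k) * wavelet_family \<phi> \<psi> (Inl k) x)"
      by (simp add: estimator_coeff_def)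
    finally show ?thesis
      unfolding F_def using fin by (subst sum.Plus) (auto intro!: finite_SigmaI)
  qed
  moreover have "estimator_coeff \<phi> \<psi> J n xs i = 0" if "i \<notin> F" for i
    using that by (auto simp: F_def K0_def K_def estimator_coeff_def split: sum.splits)
  moreover have "F \<subseteq> UNIV <+> ({0..} \<times> UNIV)" by (auto simp: F_def)
  ultimately show ?thesis using F by blast
qed

definition truncated_index :: "nat \<Rightarrow> (int + int \<times> int) set" where
  "truncated_index N = {- int N..int N} <+> ({0..int N} \<times> {- int N..int N})"

lemma truncated_index_exhausts:
  assumes "finite F" "F \<subseteq> UNIV <+> ({0..} \<times> UNIV)"
  shows "\<exists>N. F \<subseteq> truncated_index N"
  using assms
proof (induction F rule: finite_induct)
  case empty
  then show ?case by simp
next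
  case (insert i F)
  then obtain N where N: "F \<subseteq> truncated_index N" by auto
  have mono: "truncated_index N \<subseteq> truncated_index N'" if "N \<le> N'" for N N'
    using that by (auto simp: truncated_index_def)
  obtain N' where N': "i \<in> truncated_index N'"
  proof (cases i)
    case (Inl k)
    then have "i \<in> truncated_index (nat \<bar>k\<bar>)" by (auto simp: truncated_index_def)
    then show ?thesis by (rule that)
  next
    case (Inr p)
    obtain j k where p: "p = (j, k)" by (cases p)
    have "0 \<le> j" using insert.prems Inr p by auto
    then have "i \<in> truncated_index (max (nat j) (nat \<bar>k\<bar>))" using Inr p by (auto simp: truncated_index_def)
    then show ?thesis by (rule that)
  qed
  show ?case using N N' mono[of N "max N N'"] mono[of N' "max N N'"] by (intro exI[of _ "max N N'"]) auto
qed

text \<open>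
  The sum over the whole basis is written as a supremum over an increasing sequence of finite index sets, which
  later commutes with the expectation by monotone convergence.
\<close>

lemma wavelet_estimator_error_bound:
  assumes wb: "wavelet_basis \<phi> \<psi>" and f: "f \<in> L2"
    and cs: "compactly_supported \<phi>" "compactly_supported \<psi>"
  shows "(\<integral>\<^sup>+x. ennreal ((wavelet_estimator \<phi> \<psi> J n xs x - f x)\<^sup>2) \<partial>lborel)
    \<le> (SUP N. ennreal (\<Sum>i\<in>truncated_index N. (estimator_coeff \<phi> \<psi> J n xs i - L2_inner f (wavelet_family \<phi> \<psi> i))\<^sup>2))"
    (is "?L \<le> ?S")
proof -
  let ?e = "wavelet_family \<phi> \<psi>" and ?I = "UNIV <+> ({0..} \<times> UNIV) :: (int + int \<times> int) set" and ?c = "estimator_coeff \<phi> \<psi> J n xs"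
  have onb: "orthonormal_basis ?e ?I L2" using wb by (simp add: wavelet_basis_def)
  obtain F where F: "finite F" "F \<subseteq> ?I" "\<And>i. i \<notin> F \<Longrightarrow> ?c i = 0"
    and est: "wavelet_estimator \<phi> \<psi> J n xs = (\<lambda>x. \<Sum>i\<in>F. ?c i * ?e i x)"
    using wavelet_estimator_combination[OF cs, of J n xs] by blast
  have eL: "?e i \<in> L2" if "i \<in> ?I" for i using onb that unfolding orthonormal_basis_def by blast
  have ortho: "L2_inner (?e i) (?e j) = (if i = j then 1 else 0)" if "i \<in> ?I" "j \<in> ?I" for i j
    using onb that unfolding orthonormal_basis_def by blast
  have estL: "wavelet_estimator \<phi> \<psi> J n xs \<in> L2"
    unfolding est by (rule L2_combination[OF F(1)]) (use F(2) eL in blast)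
  define g where "g x = wavelet_estimator \<phi> \<psi> J n xs x - f x" for x
  have g: "g \<in> L2" unfolding g_def using estL f by (rule L2_diff)
  have ge: "L2_inner g (?e i) = ?c i - L2_inner f (?e i)" if i: "i \<in> ?I" for i
  proof -
    have "L2_inner g (?e i) = L2_inner (wavelet_estimator \<phi> \<psi> J n xs) (?e i) - L2_inner f (?e i)"
      unfolding g_def by (rule L2_inner_diff_left[OF estL f eL[OF i]])
    also have "L2_inner (wavelet_estimator \<phi> \<psi> J n xs) (?e i) = (\<Sum>i'\<in>F. ?c i' * L2_inner (?e i') (?e i))"
      unfolding est by (rule L2_inner_combination_left[OF F(1) _ eL[OF i]]) (use F(2) eL in blast)
    also have "\<dots> = (\<Sum>i'\<in>F. if i' = i then ?c i else 0)"
    proof (rule sum.cong[OF refl])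
      fix i' assume "i' \<in> F"
      then have "L2_inner (?e i') (?e i) = (if i' = i then 1 else 0)" using F(2) i by (intro ortho) blast+
      then show "?c i' * L2_inner (?e i') (?e i) = (if i' = i then ?c i else 0)" by simp
    qed
    also have "\<dots> = ?c i" using F by auto
    finally show ?thesis .
  qed
  have "?L = ennreal (L2_inner g g)"
    unfolding L2_inner_def g_def[symmetric]
    using g by (subst nn_integral_eq_integral) (auto simp: L2_def power2_eq_square)
  also have "\<dots> \<le> ?S"
  proof -
    have up: "ennreal (\<Sum>i\<in>truncated_index N. (?c i - L2_inner f (?e i))\<^sup>2) \<le> ?S" for N
      by (rule SUP_upper) simp
    define S where "S = ?S"
    have "ennreal (L2_inner g g) \<le> S"
    proof (cases S)
      case (real B)
      have "L2_inner g g \<le> B"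
      proof (rule orthonormal_basis_norm_bound[OF onb g])
        fix F' assume F': "finite F'" "F' \<subseteq> ?I"
        obtain N where N: "F' \<subseteq> truncated_index N" using truncated_index_exhausts[OF F'] by blast
        have "(\<Sum>i\<in>F'. (L2_inner g (?e i))\<^sup>2) = (\<Sum>i\<in>F'. (?c i - L2_inner f (?e i))\<^sup>2)"
        proof (rule sum.cong[OF refl])
          fix i assume "i \<in> F'"
          then have "i \<in> ?I" using F'(2) by (rule subsetD[rotated])
          then show "(L2_inner g (?e i))\<^sup>2 = (?c i - L2_inner f (?e i))\<^sup>2" by (simp only: ge)
        qed
        also have "\<dots> \<le> (\<Sum>i\<in>truncated_index N. (?c i - L2_inner f (?e i))\<^sup>2)"
          by (rule sum_mono2[OF _ N]) (auto simp: truncated_index_def)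
        finally have "(\<Sum>i\<in>F'. (L2_inner g (?e i))\<^sup>2) \<le> (\<Sum>i\<in>truncated_index N. (?c i - L2_inner f (?e i))\<^sup>2)" .
        moreover have "(\<Sum>i\<in>truncated_index N. (?c i - L2_inner f (?e i))\<^sup>2) \<le> B"
          using up[of N] real(1) unfolding S_def[symmetric] real(2) by (simp only: ennreal_le_iff)
        ultimately show "(\<Sum>i\<in>F'. (L2_inner g (?e i))\<^sup>2) \<le> B" by (rule order_trans)
      qed
      then show ?thesis unfolding real(2) by (rule ennreal_leI)
    next
      case top
      then show ?thesis by (simp only: top_greatest)
    qed
    then show ?thesis unfolding S_def .
  qed
  finally show ?thesis .
qed

section \<open>Smoothness of the density and decay of its coefficients\<close>

lemma continuous_AE_le_imp_le:
  fixes h :: "real \<Rightarrow> real"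
  assumes cont: "continuous_on UNIV h" and ae: "AE x in lborel. h x \<le> C"
  shows "h x \<le> C"
proof (rule ccontr)
  assume "\<not> h x \<le> C"
  then have ne: "{x. C < h x} \<noteq> {}" by (auto simp: not_le)
  have op: "open {x. C < h x}" using cont by (intro open_Collect_less continuous_intros)
  have "{x. C < h x} \<in> null_sets lborel"
    using ae op AE_iff_null_sets[of "{x. C < h x}" lborel] by (simp add: not_less)
  then have "negligible {x. C < h x}" by (simp add: negligible_iff_null_sets null_sets_completionI)
  with open_not_negligible[OF op ne] show False by blast
qed

lemma sum_geometric_int_le:
  fixes p :: "int \<Rightarrow> int"
  assumes "finite S" "inj_on p S" "\<And>j. j \<in> S \<Longrightarrow> 0 \<le> p j" "0 < r" "r < (1::real)"
  shows "(\<Sum>j\<in>S. r powr real_of_int (p j)) \<le> 1 / (1 - r)"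
proof -
  have "(\<Sum>j\<in>S. r powr real_of_int (p j)) = (\<Sum>j\<in>S. r ^ nat (p j))"
    using assms by (intro sum.cong refl) (simp flip: powr_realpow)
  also have "\<dots> = (\<Sum>i\<in>(\<lambda>j. nat (p j)) ` S. r ^ i)"
  proof (subst sum.reindex)
    show "inj_on (\<lambda>j. nat (p j)) S"
      using assms(2,3) unfolding inj_on_def by (metis eq_nat_nat_iff)
  qed simp
  also have "\<dots> \<le> (\<Sum>i. r ^ i)"
    by (rule sum_le_suminf) (use assms in \<open>auto intro: summable_geometric\<close>)
  also have "\<dots> = 1 / (1 - r)" using assms by (intro suminf_geometric) auto
  finally show ?thesis .
qed

lemma has_vector_derivative_bounded_lipschitz:
  fixes F :: "real \<Rightarrow> 'a::real_normed_vector"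
  assumes d: "\<And>u. (F has_vector_derivative F' u) (at u)" and L: "\<And>u. norm (F' u) \<le> L"
  shows "norm (F x - F y) \<le> L * \<bar>x - y\<bar>"
proof -
  have "norm (F x - F y) \<le> L * norm (x - y)"
  proof (rule differentiable_bound[where S=UNIV and f'="\<lambda>u t. t *\<^sub>R F' u"])
    show "(F has_derivative (\<lambda>t. t *\<^sub>R F' u)) (at u within UNIV)" for u
      using d[of u] by (simp add: has_vector_derivative_def)
    show "onorm (\<lambda>t. t *\<^sub>R F' u) \<le> L" for u
      by (rule onorm_le) (use mult_right_mono[OF L[of u] abs_ge_zero] in \<open>simp add: mult.commute\<close>)
  qed auto
  then show ?thesis by simp
qed

context iid_innovations
begin

text \<open>
  The bound is linear in \<open>\<bar>u\<bar>\<close> near 0, which for \<open>\<gamma> \<le> 1 / 2\<close> is stronger than \<open>\<bar>u\<bar> powr (2 * \<gamma>)\<close>; away from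
  0 the variance is at most 1.
\<close>

lemma variance_bound_of_lipschitz:
  assumes L: "\<And>u. cmod (cf u - 1) \<le> L * \<bar>u\<bar>" and \<gamma>: "0 < \<gamma>" "\<gamma> \<le> 1 / 2"
  shows "1 - (cmod (cf u))\<^sup>2 \<le> (2 * L + 1) * \<bar>u\<bar> powr (2 * \<gamma>)"
proof (cases "u = 0")
  case True
  then show ?thesis by (simp add: cf_0)
next
  case False
  have L0: "L \<ge> 0" using L[of 1] norm_ge_zero[of "cf 1 - 1"] by linarith
  show ?thesis
  proof (cases "\<bar>u\<bar> \<le> 1")
    case True
    have "1 - (cmod (cf u))\<^sup>2 = (1 - cmod (cf u)) * (1 + cmod (cf u))" by (simp add: power2_eq_square algebra_simps)
    also have "\<dots> \<le> (1 - cmod (cf u)) * 2" using norm_cf_le[of u] by (intro mult_left_mono) auto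
    also have "1 - cmod (cf u) \<le> L * \<bar>u\<bar>"
      using L[of u] norm_triangle_ineq2[of 1 "cf u"] by (simp add: norm_minus_commute)
    also have "L * \<bar>u\<bar> * 2 = 2 * L * \<bar>u\<bar> powr 1" using False by simp
    also have "\<dots> \<le> 2 * L * \<bar>u\<bar> powr (2 * \<gamma>)"
      using True L0 \<gamma> by (intro mult_left_mono powr_mono') auto
    also have "\<dots> \<le> (2 * L + 1) * \<bar>u\<bar> powr (2 * \<gamma>)" by (intro mult_right_mono) auto
    finally show ?thesis by simp
  next
    case gt: False
    have "1 - (cmod (cf u))\<^sup>2 \<le> 1 * 1" by simp
    also have "\<dots> \<le> (2 * L + 1) * \<bar>u\<bar> powr (2 * \<gamma>)"
      using gt \<gamma> L0 by (intro mult_mono ge_one_powr_ge_zero) auto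
    finally show ?thesis .
  qed
qed

lemma cf_continuous: "continuous_on UNIV cf"
  using real_distribution.isCont_char[OF real_distribution_innovation]
  by (simp add: continuous_at_imp_continuous_on)

text \<open>
  For \<open>\<bar>u\<bar> > 1\<close> the exponent may be raised from \<open>\<gamma>\<close> to \<open>\<beta>\<close>. One of the two resulting factors
  \<open>\<bar>u\<bar> powr \<beta> * cmod (cf (a0 * u))\<close> is bounded, the other one integrable.
\<close>

lemma cf_weight_finite:
  assumes \<beta>: "0 < \<gamma>" "\<gamma> \<le> \<beta>" and a0: "a0 \<noteq> 0"
    and int: "integrable lborel (\<lambda>u. \<bar>u\<bar> powr \<beta> * cmod (cf u))"
    and Q: "\<And>u. \<bar>u\<bar> powr \<beta> * cmod (cf u) \<le> Q"
  shows "(\<integral>\<^sup>+u. ennreal ((cmod (cf (a0 * u)))\<^sup>2 * \<bar>u\<bar> powr (2 * \<gamma>)) \<partial>lborel) < \<infinity>"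
proof -
  define q where "q u = \<bar>u\<bar> powr \<beta> * cmod (cf u)" for u
  have q0: "q u \<ge> 0" for u by (simp add: q_def)
  have Q0: "Q \<ge> 0" using Q[of 0] by (auto intro: order_trans[rotated])
  define B where "B u = indicator {-1..1} u + \<bar>a0\<bar> powr (- (2 * \<beta>)) * Q * q (0 + a0 * u)" for u :: real
  have iB: "integrable lborel B"
    unfolding B_def using lborel_integrable_real_affine[OF int a0, of 0]
    by (intro Bochner_Integration.integrable_add integrable_mult_right) (auto simp: q_def)
  have B0: "B u \<ge> 0" for u using q0 Q0 by (simp add: B_def)
  have le: "(cmod (cf (a0 * u)))\<^sup>2 * \<bar>u\<bar> powr (2 * \<gamma>) \<le> B u" for u
  proof (cases "\<bar>u\<bar> \<le> 1")
    case True
    have "(cmod (cf (a0 * u)))\<^sup>2 * \<bar>u\<bar> powr (2 * \<gamma>) \<le> 1 * 1"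
      using True \<beta> norm_cf_le[of "a0 * u"]
      by (intro mult_mono power_le_one powr_le1) auto
    also have "\<dots> \<le> B u" using True q0 Q0 by (simp add: B_def indicator_def abs_le_iff)
    finally show ?thesis .
  next
    case False
    then have "\<bar>u\<bar> powr (2 * \<gamma>) \<le> \<bar>u\<bar> powr (2 * \<beta>)" using \<beta> by (intro powr_mono) auto
    also have "\<dots> = \<bar>a0\<bar> powr (- (2 * \<beta>)) * \<bar>a0 * u\<bar> powr (2 * \<beta>)"
      using a0 by (simp add: abs_mult powr_mult powr_minus)
    also have "\<bar>a0 * u\<bar> powr (2 * \<beta>) = (\<bar>a0 * u\<bar> powr \<beta>)\<^sup>2"
      by (simp add: power2_eq_square flip: powr_add)
    finally have "(cmod (cf (a0 * u)))\<^sup>2 * \<bar>u\<bar> powr (2 * \<gamma>) \<le> (cmod (cf (a0 * u)))\<^sup>2 * (\<bar>a0\<bar> powr (- (2 * \<beta>)) * (\<bar>a0 * u\<bar> powr \<beta>)\<^sup>2)"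
      by (intro mult_left_mono) auto
    also have "\<dots> = \<bar>a0\<bar> powr (- (2 * \<beta>)) * (q (a0 * u) * q (a0 * u))"
      by (simp add: q_def power2_eq_square mult_ac)
    also have "\<dots> \<le> \<bar>a0\<bar> powr (- (2 * \<beta>)) * (Q * q (a0 * u))"
      by (intro mult_left_mono mult_right_mono q0) (use Q in \<open>auto simp: q_def\<close>)
    also have "\<dots> \<le> B u" by (simp add: B_def)
    finally show ?thesis .
  qed
  have "(\<integral>\<^sup>+u. ennreal ((cmod (cf (a0 * u)))\<^sup>2 * \<bar>u\<bar> powr (2 * \<gamma>)) \<partial>lborel) \<le> (\<integral>\<^sup>+u. ennreal (B u) \<partial>lborel)"
    by (intro nn_integral_mono ennreal_leI le)
  also have "\<dots> = ennreal (LINT u|lborel. B u)" by (rule nn_integral_eq_integral[OF iB]) (simp add: B0)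
  also have "\<dots> < \<infinity>" by simp
  finally show ?thesis .
qed

text \<open>
  Each coefficient in \<open>I\<close> contributes one factor \<open>\<bar>u\<bar> powr \<beta> * cmod (cf (a i * u))\<close>, all other factors of the
  characteristic function of the process being at most 1 in modulus. One of the squared factors is integrable, the
  others are bounded.
\<close>

lemma linear_process_sobolev:
  assumes \<beta>: "0 < \<beta>" and I: "finite I" "I \<noteq> {}" "\<And>i. i \<in> I \<Longrightarrow> a i \<noteq> 0"
    and int: "integrable lborel (\<lambda>u. \<bar>u\<bar> powr \<beta> * cmod (cf u))"
    and Q: "\<And>u. \<bar>u\<bar> powr \<beta> * cmod (cf u) \<le> Q"
    and sm: "AE \<omega> in P. summable (\<lambda>i. a i * \<epsilon> (t - int i) \<omega>)"
  shows "(\<integral>\<^sup>+u. ennreal (\<bar>u\<bar> powr (2 * (real (card I) * \<beta>)) * (cmod (CLINT \<omega>|P. iexp (- (u * linear_process a \<epsilon> t \<omega>))))\<^sup>2) \<partial>lborel) < \<infinity>"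
proof -
  define q where "q u = \<bar>u\<bar> powr \<beta> * cmod (cf u)" for u
  have q0: "q u \<ge> 0" for u by (simp add: q_def)
  have qQ: "q u \<le> Q" for u using Q by (simp add: q_def)
  have Q0: "Q \<ge> 0" using q0 qQ order_trans by blast
  have qm: "q (- u) = q u" for u unfolding q_def cf_uminus by simp
  obtain i0 where i0: "i0 \<in> I" using I(2) by blast
  define B where "B u = (\<Prod>i\<in>I - {i0}. (\<bar>a i\<bar> powr (- \<beta>) * Q)\<^sup>2) * ((\<bar>a i0\<bar> powr (- \<beta>))\<^sup>2 * Q * q (0 + a i0 * u))" for u
  have iB: "integrable lborel B"
    unfolding B_def using lborel_integrable_real_affine[OF int, of "a i0" 0] I(3)[OF i0]
    by (intro integrable_mult_right) (auto simp: q_def)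
  have B0: "B u \<ge> 0" for u unfolding B_def using q0 Q0 by (intro mult_nonneg_nonneg prod_nonneg) auto
  have le: "\<bar>u\<bar> powr (2 * (real (card I) * \<beta>)) * (cmod (CLINT \<omega>|P. iexp (- (u * linear_process a \<epsilon> t \<omega>))))\<^sup>2 \<le> B u" for u
  proof -
    let ?m = "CLINT \<omega>|P. iexp (- u * linear_process a \<epsilon> t \<omega>)"
    obtain N0 where N0: "I \<subseteq> {..<N0}" using I(1) finite_nat_iff_bounded by blast
    have m_le: "cmod ?m \<le> (\<Prod>i\<in>I. cmod (cf (- u * a i)))"
    proof (rule LIMSEQ_le_const2)
      show "(\<lambda>N. cmod (\<Prod>i<N. cf (- u * a i))) \<longlonglongrightarrow> cmod ?m"
        by (intro tendsto_norm cf_linear_process sm)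
      show "\<exists>N. \<forall>n\<ge>N. cmod (\<Prod>i<n. cf (- u * a i)) \<le> (\<Prod>i\<in>I. cmod (cf (- u * a i)))"
      proof (intro exI allI impI)
        fix n assume "N0 \<le> n"
        then have "I \<subseteq> {..<n}" using N0 by auto
        have "cmod (\<Prod>i<n. cf (- u * a i)) = (\<Prod>i<n. cmod (cf (- u * a i)))" by (simp only: prod_norm)
        also have "\<dots> = (\<Prod>i\<in>{..<n} - I. cmod (cf (- u * a i))) * (\<Prod>i\<in>I. cmod (cf (- u * a i)))"
          by (rule prod.subset_diff[OF \<open>I \<subseteq> {..<n}\<close>]) simp
        also have "\<dots> \<le> 1 * (\<Prod>i\<in>I. cmod (cf (- u * a i)))"
          by (intro mult_right_mono prod_le_1 prod_nonneg) (auto simp: norm_cf_le)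
        finally show "cmod (\<Prod>i<n. cf (- u * a i)) \<le> (\<Prod>i\<in>I. cmod (cf (- u * a i)))" by simp
      qed
    qed
    have pw: "\<bar>u\<bar> powr (2 * (real (card I) * \<beta>)) = (\<Prod>i\<in>I. (\<bar>u\<bar> powr \<beta>)\<^sup>2)"
    proof (cases "u = 0")
      case True
      then show ?thesis using I(1,2) \<beta> by (simp add: card_gt_0_iff)
    next
      case False
      then show ?thesis
        by (simp add: power2_eq_square powr_power mult_ac flip: powr_add)
    qed
    have fac: "(\<bar>u\<bar> powr \<beta>)\<^sup>2 * (cmod (cf (- u * a i)))\<^sup>2 = (\<bar>a i\<bar> powr (- \<beta>) * q (a i * u))\<^sup>2" if "i \<in> I" for i
    proof -
      have "\<bar>u\<bar> powr \<beta> = \<bar>a i\<bar> powr (- \<beta>) * \<bar>a i * u\<bar> powr \<beta>"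
        using I(3)[OF that] by (simp add: abs_mult powr_mult powr_minus)
      moreover have "cmod (cf (- u * a i)) = cmod (cf (a i * u))"
        using cf_uminus[of "a i * u"] by (simp add: mult.commute)
      ultimately show ?thesis by (simp only: q_def power_mult_distrib mult_ac)
    qed
    have "\<bar>u\<bar> powr (2 * (real (card I) * \<beta>)) * (cmod ?m)\<^sup>2 \<le> (\<Prod>i\<in>I. (\<bar>u\<bar> powr \<beta>)\<^sup>2) * (\<Prod>i\<in>I. cmod (cf (- u * a i)))\<^sup>2"
      unfolding pw by (intro mult_left_mono power_mono m_le prod_nonneg) auto
    also have "\<dots> = (\<Prod>i\<in>I. (\<bar>u\<bar> powr \<beta>)\<^sup>2 * (cmod (cf (- u * a i)))\<^sup>2)"
      by (simp only: prod.distrib prod_power_distrib)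
    also have "\<dots> = (\<Prod>i\<in>I. (\<bar>a i\<bar> powr (- \<beta>) * q (a i * u))\<^sup>2)"
      by (intro prod.cong refl fac)
    also have "\<dots> = (\<bar>a i0\<bar> powr (- \<beta>) * q (a i0 * u))\<^sup>2 * (\<Prod>i\<in>I - {i0}. (\<bar>a i\<bar> powr (- \<beta>) * q (a i * u))\<^sup>2)"
      by (rule prod.remove[OF I(1) i0])
    also have "\<dots> \<le> ((\<bar>a i0\<bar> powr (- \<beta>))\<^sup>2 * Q * q (a i0 * u)) * (\<Prod>i\<in>I - {i0}. (\<bar>a i\<bar> powr (- \<beta>) * Q)\<^sup>2)"
    proof (rule mult_mono)
      have "q (a i0 * u) * q (a i0 * u) \<le> Q * q (a i0 * u)" by (intro mult_right_mono q0 qQ)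
      then have "(\<bar>a i0\<bar> powr (- \<beta>))\<^sup>2 * (q (a i0 * u) * q (a i0 * u)) \<le> (\<bar>a i0\<bar> powr (- \<beta>))\<^sup>2 * (Q * q (a i0 * u))"
        by (rule mult_left_mono) simp
      then show "(\<bar>a i0\<bar> powr (- \<beta>) * q (a i0 * u))\<^sup>2 \<le> (\<bar>a i0\<bar> powr (- \<beta>))\<^sup>2 * Q * q (a i0 * u)"
        by (simp add: power_mult_distrib power2_eq_square[of "q _"] mult.assoc)
      show "(\<Prod>i\<in>I - {i0}. (\<bar>a i\<bar> powr (- \<beta>) * q (a i * u))\<^sup>2) \<le> (\<Prod>i\<in>I - {i0}. (\<bar>a i\<bar> powr (- \<beta>) * Q)\<^sup>2)"
        by (intro prod_mono conjI power_mono mult_left_mono qQ) (auto intro!: mult_nonneg_nonneg q0)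
      show "0 \<le> (\<bar>a i0\<bar> powr (- \<beta>))\<^sup>2 * Q * q (a i0 * u)" using q0 Q0 by simp
    qed (auto intro!: prod_nonneg)
    also have "\<dots> = B u" by (simp add: B_def mult_ac)
    finally show ?thesis by simp
  qed
  have "(\<integral>\<^sup>+u. ennreal (\<bar>u\<bar> powr (2 * (real (card I) * \<beta>)) * (cmod (CLINT \<omega>|P. iexp (- (u * linear_process a \<epsilon> t \<omega>))))\<^sup>2) \<partial>lborel) \<le> (\<integral>\<^sup>+u. ennreal (B u) \<partial>lborel)"
    by (intro nn_integral_mono ennreal_leI le)
  also have "\<dots> = ennreal (LINT u|lborel. B u)" by (rule nn_integral_eq_integral[OF iB]) (simp add: B0)
  also have "\<dots> < \<infinity>" by simp
  finally show ?thesis .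
qed

end

lemma (in prob_space) wavelet_coefficient_decay:
  assumes g: "compactly_supported g" "twice_continuously_differentiable g" "vanishing_moments g m"
    and s: "0 \<le> s" "s \<le> real m" and [measurable]: "X \<in> borel_measurable M"
    and fin: "(\<integral>\<^sup>+u. ennreal (\<bar>u\<bar> powr (2 * s) * (cmod (CLINT \<omega>|M. iexp (- (u * X \<omega>))))\<^sup>2) \<partial>lborel) < \<infinity>"
  shows "\<exists>C>0. \<forall>j K. finite K \<longrightarrow> (\<Sum>k\<in>K. (expectation (\<lambda>\<omega>. dilate g j k (X \<omega>)))\<^sup>2) \<le> C * 2 powr (- 2 * real_of_int j * s)"
proof -
  let ?D = "\<lambda>u. CLINT \<omega>|M. iexp (- (u * X \<omega>))"
  obtain C where C: "C > 0" "\<And>j K (D :: real \<Rightarrow> complex). finite K \<Longrightarrow> D \<in> borel_measurable borel \<Longrightarrow>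
     ennreal (\<Sum>k\<in>K. (cmod (fourier_pairing (dilate g j k) D))\<^sup>2)
       \<le> ennreal (C * 2 powr (- 2 * real_of_int j * s)) * weighted_energy s D"
    using wavelet_coefficients_bound[OF g s] by blast
  define Z where "Z = enn2real (weighted_energy s ?D)"
  have Z: "weighted_energy s ?D = ennreal Z"
    using fin by (simp add: Z_def)
  have Z0: "Z \<ge> 0" by (simp add: Z_def)
  have D_meas: "?D \<in> borel_measurable borel" by measurable
  have "(\<Sum>k\<in>K. (expectation (\<lambda>\<omega>. dilate g j k (X \<omega>)))\<^sup>2) \<le> C * (Z + 1) * 2 powr (- 2 * real_of_int j * s)" if K: "finite K" for j K
  proof -
    let ?w = "2 powr (- 2 * real_of_int j * s)"
    have le: "(expectation (\<lambda>\<omega>. dilate g j k (X \<omega>)))\<^sup>2 \<le> (cmod (fourier_pairing (dilate g j k) ?D))\<^sup>2" for k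
      using g by (intro square_le_of_eq_inverse_two_pi expectation_fourier compactly_supported_dilate
          twice_continuously_differentiable_dilate) auto
    have "ennreal (\<Sum>k\<in>K. (cmod (fourier_pairing (dilate g j k) ?D))\<^sup>2) \<le> ennreal (C * ?w) * ennreal Z"
      unfolding Z[symmetric] by (rule C(2)[OF K D_meas])
    also have "\<dots> = ennreal (C * ?w * Z)" using C(1) Z0 by (subst ennreal_mult') auto
    finally have "(\<Sum>k\<in>K. (cmod (fourier_pairing (dilate g j k) ?D))\<^sup>2) \<le> C * ?w * Z"
      using C(1) Z0 by (subst (asm) ennreal_le_iff) auto
    moreover have "(\<Sum>k\<in>K. (expectation (\<lambda>\<omega>. dilate g j k (X \<omega>)))\<^sup>2) \<le> (\<Sum>k\<in>K. (cmod (fourier_pairing (dilate g j k) ?D))\<^sup>2)"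
      by (intro sum_mono le)
    moreover have "C * ?w * Z \<le> C * ?w * (Z + 1)" using C(1) by (intro mult_left_mono) auto
    ultimately show ?thesis by (simp add: mult_ac)
  qed
  moreover have "C * (Z + 1) > 0" using C(1) Z0 by simp
  ultimately show ?thesis by blast
qed

section \<open>The rate of convergence\<close>

text \<open>
  Here \<open>r\<close> is the rate of convergence. Rounding the level up costs at most the factor 2 in the variance and nothing in the bias.
\<close>

lemma truncation_level_bounds:
  assumes n: "1 \<le> n" and s: "0 \<le> s"
  defines "J \<equiv> \<lceil>log 2 (real n) / (2 * s + 1)\<rceil>" and "r \<equiv> real n powr (- (2 * s) / (2 * s + 1))"
  shows "0 \<le> J" and "2 powr real_of_int J / real n \<le> 2 * r" and "2 powr (- 2 * real_of_int J * s) \<le> r"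
proof -
  let ?x = "log 2 (real n) / (2 * s + 1)"
  have x0: "0 \<le> ?x" using n s by simp
  then show "0 \<le> J" unfolding J_def by simp
  have J: "?x \<le> real_of_int J" "real_of_int J \<le> ?x + 1" unfolding J_def by linarith+
  have px: "2 powr (c * ?x) = real n powr (c / (2 * s + 1))" for c
  proof -
    have "2 powr (c * ?x) = (2 powr log 2 (real n)) powr (c / (2 * s + 1))" by (simp add: powr_powr mult.commute)
    then show ?thesis using n by simp
  qed
  have "2 powr real_of_int J \<le> 2 powr (?x + 1)" using J(2) by simp
  also have "\<dots> = 2 * real n powr (1 / (2 * s + 1))" using px[of 1] by (simp add: powr_add)
  finally have "2 powr real_of_int J / real n \<le> 2 * real n powr (1 / (2 * s + 1)) / real n powr 1"
    using n by (simp add: divide_right_mono)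
  also have "\<dots> = 2 * real n powr (1 / (2 * s + 1) - 1)" by (simp add: powr_diff)
  also have "1 / (2 * s + 1) - 1 = - (2 * s) / (2 * s + 1)" using s by (simp add: field_simps)
  finally show "2 powr real_of_int J / real n \<le> 2 * r" by (simp add: r_def)
  have "2 powr (- 2 * real_of_int J * s) \<le> 2 powr (- (2 * s) * ?x)"
    using mult_left_mono[OF J(1), of "2 * s"] s by (simp add: mult_ac)
  then show "2 powr (- 2 * real_of_int J * s) \<le> r" unfolding px r_def .
qed

text \<open>
  Both geometric sums are dominated by their terms next to \<open>J\<close>.
\<close>

lemma level_sum_bound:
  assumes s: "s > 0" and C: "0 \<le> C1" "0 \<le> C2"
  shows "\<exists>D\<ge>0. \<forall>N (J :: int) v. 0 \<le> v \<longrightarrow>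
    (\<Sum>j=0..int N. if j \<le> J then C1 * 2 powr real_of_int j * v else C2 * 2 powr (- 2 * real_of_int j * s))
      \<le> D * (2 powr real_of_int J * v + 2 powr (- 2 * real_of_int J * s))"
proof -
  define q where "q = 2 powr (- 2 * s)"
  have q: "0 < q" "q < 1" using s by (auto simp: q_def powr_less_one)
  define D where "D = 2 * C1 + C2 * (1 / (1 - q))"
  have D0: "D \<ge> 0" using C q by (simp add: D_def)
  have "(\<Sum>j=0..int N. if j \<le> J then C1 * 2 powr real_of_int j * v else C2 * 2 powr (- 2 * real_of_int j * s))
      \<le> D * (2 powr real_of_int J * v + 2 powr (- 2 * real_of_int J * s))" if v: "0 \<le> v" for N and J :: int and v
  proof -
    let ?S = "\<Sum>j=0..int N. if j \<le> J then C1 * 2 powr real_of_int j * v else C2 * 2 powr (- 2 * real_of_int j * s)"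
    let ?A = "{0..int N} \<inter> {j. j \<le> J}" and ?B = "{0..int N} \<inter> - {j. j \<le> J}"
    have fin: "finite ?A" "finite ?B" by simp_all
    have "?S
      = (\<Sum>j\<in>?A. C1 * 2 powr real_of_int j * v) + (\<Sum>j\<in>?B. C2 * 2 powr (- 2 * real_of_int j * s))"
      by (rule sum.If_cases) simp
    also have "(\<Sum>j\<in>?A. C1 * 2 powr real_of_int j * v) = C1 * (2 powr real_of_int J * v) * (\<Sum>j\<in>?A. (1 / 2) powr real_of_int (J - j))"
    proof -
      have "2 powr real_of_int j = 2 powr real_of_int J * (1 / 2) powr real_of_int (J - j)" for j
      proof -
        have "(1 / 2 :: real) powr x = 2 powr (- x)" for x
          by (simp add: powr_divide powr_minus_divide)
        then have "2 powr real_of_int J * (1 / 2) powr real_of_int (J - j) = 2 powr (real_of_int J + - real_of_int (J - j))"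
          by (simp only: powr_add)
        then show ?thesis by simp
      qed
      then have "C1 * 2 powr real_of_int j * v = C1 * (2 powr real_of_int J * v) * (1 / 2) powr real_of_int (J - j)" for j
        by (metis mult.assoc mult.commute)
      then show ?thesis unfolding sum_distrib_left by (rule sum.cong[OF refl])
    qed
    also have "\<dots> \<le> C1 * (2 powr real_of_int J * v) * (1 / (1 - 1 / 2))"
      using C(1) v by (intro mult_left_mono sum_geometric_int_le fin) (auto simp: inj_on_def)
    also have "(\<Sum>j\<in>?B. C2 * 2 powr (- 2 * real_of_int j * s)) = C2 * 2 powr (- 2 * real_of_int J * s) * (\<Sum>j\<in>?B. q powr real_of_int (j - J))"
    proof -
      have "2 powr (- 2 * real_of_int j * s) = 2 powr (- 2 * real_of_int J * s) * q powr real_of_int (j - J)" for j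
      proof -
        have "2 powr (- 2 * real_of_int J * s) * q powr real_of_int (j - J) = 2 powr (- 2 * real_of_int J * s + - 2 * s * real_of_int (j - J))"
          unfolding q_def powr_powr powr_add ..
        also have "- 2 * real_of_int J * s + - 2 * s * real_of_int (j - J) = - 2 * real_of_int j * s"
          by (simp add: algebra_simps)
        finally show ?thesis ..
      qed
      then have "C2 * 2 powr (- 2 * real_of_int j * s) = C2 * 2 powr (- 2 * real_of_int J * s) * q powr real_of_int (j - J)" for j
        by (metis mult.assoc)
      then show ?thesis unfolding sum_distrib_left by (rule sum.cong[OF refl])
    qed
    also have "\<dots> \<le> C2 * 2 powr (- 2 * real_of_int J * s) * (1 / (1 - q))"
      using C(2) q by (intro mult_left_mono sum_geometric_int_le fin) (auto simp: inj_on_def)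
    finally have "?S
      \<le> 2 * C1 * (2 powr real_of_int J * v) + C2 * (1 / (1 - q)) * 2 powr (- 2 * real_of_int J * s)"
      by (simp add: mult_ac)
    also have "\<dots> \<le> D * (2 powr real_of_int J * v) + D * 2 powr (- 2 * real_of_int J * s)"
      using C q v by (intro add_mono mult_right_mono) (auto simp: D_def)
    finally show ?thesis by (simp add: distrib_left)
  qed
  with D0 show ?thesis by blast
qed

lemma sum_truncated_index:
  fixes F :: "int + int \<times> int \<Rightarrow> real"
  shows "(\<Sum>i\<in>truncated_index N. F i) = (\<Sum>k\<in>{- int N..int N}. F (Inl k)) + (\<Sum>j=0..int N. \<Sum>k\<in>{- int N..int N}. F (Inr (j, k)))"
  unfolding truncated_index_def
  by (subst sum.Plus) (auto simp: sum.cartesian_product)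

theorem theorem2p1:
  fixes P :: "'w measure" and \<epsilon> :: "int \<Rightarrow> 'w \<Rightarrow> real" and a :: "nat \<Rightarrow> real"
    and f \<phi> \<psi> :: "real \<Rightarrow> real" and \<phi>\<^sub>\<epsilon> :: "real \<Rightarrow> complex"
    and \<gamma> \<beta> :: real and M :: nat
  assumes "prob_space P"
    and "iid P \<epsilon>"
    and "a 0 \<noteq> 0"
    and "\<And>n. AE \<omega> in P. summable (\<lambda>i. a i * \<epsilon> (n - int i) \<omega>)"
    and "\<And>x. 0 \<le> f x"
    and "\<And>n. distributed P lborel (linear_process a \<epsilon> n) (\<lambda>x. ennreal (f x))"
    and "f \<in> L2"
    and "\<phi>\<^sub>\<epsilon> = char (distr P borel (\<epsilon> 1))"
    and "wavelet_basis \<phi> \<psi>"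
    and "0 < \<gamma>" and "\<gamma> \<le> 1"
    and "summable (\<lambda>i. \<bar>a i\<bar> powr \<gamma>)"
    and "1 \<le> M"
    and "infinite {i. a i \<noteq> 0} \<or> M \<le> card {i. a i \<noteq> 0}"
    and "\<gamma> \<le> \<beta>"
    and "integrable lborel (\<lambda>u. of_real (\<bar>u\<bar> powr \<beta>) * \<phi>\<^sub>\<epsilon> u)"
    and "\<exists>C. AE u in lborel. cmod (of_real (\<bar>u\<bar> powr \<beta>) * \<phi>\<^sub>\<epsilon> u) \<le> C"
    and "compactly_supported \<phi>" and "compactly_supported \<psi>"
    and "twice_continuously_differentiable \<phi>" and "twice_continuously_differentiable \<psi>"
    and "vanishing_moments \<psi> (nat \<lceil>real M * \<beta>\<rceil>)"
    and "\<exists>\<phi>\<^sub>\<epsilon>' C. \<forall>u. (\<phi>\<^sub>\<epsilon> has_vector_derivative \<phi>\<^sub>\<epsilon>' u) (at u) \<and> cmod (\<phi>\<^sub>\<epsilon>' u) \<le> C"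
    and "1 / 2 < \<gamma> \<Longrightarrow> \<exists>c>0. \<forall>u.
           (LINT \<omega>|P. (cmod (iexp (u * \<epsilon> 1 \<omega>) - \<phi>\<^sub>\<epsilon> u))\<^sup>2) \<le> c * min (\<bar>u\<bar> powr (2 * \<gamma>)) 1"
  shows "\<exists>C::real. \<forall>n::nat. 1 \<le> n \<longrightarrow>
           (\<integral>\<^sup>+\<omega>. (\<integral>\<^sup>+x. ennreal ((wavelet_estimator \<phi> \<psi>
                 \<lceil>log 2 (real n) / (2 * real M * \<beta> + 1)\<rceil> n
                 (\<lambda>i. linear_process a \<epsilon> (int i) \<omega>) x - f x)\<^sup>2) \<partial>lborel) \<partial>P)
           \<le> ennreal (C * real n powr (- (2 * real M * \<beta>) / (2 * real M * \<beta> + 1)))"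
proof -
  interpret iid_innovations P \<epsilon>
    using assms(1,2) by (simp add: iid_innovations_def iid_innovations_axioms_def)
  note sm = assms(4) and f_nn = assms(5) and dens = assms(6) and fL2 = assms(7) and \<phi>\<epsilon> = assms(8)
  define s where "s = real M * \<beta>"
  have \<beta>: "0 < \<beta>" using assms(10,15) by linarith
  have s: "0 < s" using \<beta> assms(13) by (simp add: s_def)
  obtain L F' where L: "\<And>u. (cf has_vector_derivative F' u) (at u)" "\<And>u. cmod (F' u) \<le> L"
    using assms(23) unfolding \<phi>\<epsilon> by blast
  have lip: "cmod (cf u - 1) \<le> L * \<bar>u\<bar>" for u
    using has_vector_derivative_bounded_lipschitz[OF L, of u 0] by (simp add: cf_0)
  obtain c where c: "0 \<le> c" and var: "\<And>u. 1 - (cmod (cf u))\<^sup>2 \<le> c * \<bar>u\<bar> powr (2 * \<gamma>)"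
    \<comment> \<open>for \<open>\<gamma> \<le> 1 / 2\<close> the Lipschitz continuity of the characteristic function suffices\<close>
  proof (cases "1 / 2 < \<gamma>")
    case True
    then obtain c where c: "c > 0" "\<And>u. (LINT \<omega>|P. (cmod (iexp (u * \<epsilon> 1 \<omega>) - cf u))\<^sup>2) \<le> c * min (\<bar>u\<bar> powr (2 * \<gamma>)) 1"
      using assms(24) unfolding \<phi>\<epsilon> by blast
    have "1 - (cmod (cf u))\<^sup>2 \<le> c * \<bar>u\<bar> powr (2 * \<gamma>)" for u
      unfolding variance_iexp_innovation[of u 1, symmetric]
      by (rule order_trans[OF c(2)]) (use c(1) in \<open>auto intro: mult_left_mono\<close>)
    with c(1) show ?thesis by (intro that[of c]) auto
  next
    case False
    have "L \<ge> 0" using L(2)[of 0] norm_ge_zero[of "F' 0"] by linarith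
    moreover have "1 - (cmod (cf u))\<^sup>2 \<le> (2 * L + 1) * \<bar>u\<bar> powr (2 * \<gamma>)" for u
      by (rule variance_bound_of_lipschitz[OF lip assms(10)]) (use False in simp)
    ultimately show ?thesis by (intro that[of "2 * L + 1"]) auto
  qed
  have int: "integrable lborel (\<lambda>u. \<bar>u\<bar> powr \<beta> * cmod (cf u))"
    using integrable_norm[OF assms(16)] unfolding \<phi>\<epsilon> by (simp add: norm_mult)
  obtain Q where Q: "\<And>u. \<bar>u\<bar> powr \<beta> * cmod (cf u) \<le> Q"
  proof -
    obtain Q where "AE u in lborel. cmod (of_real (\<bar>u\<bar> powr \<beta>) * cf u) \<le> Q"
      using assms(17) unfolding \<phi>\<epsilon> by blast
    then have ae: "AE u in lborel. \<bar>u\<bar> powr \<beta> * cmod (cf u) \<le> Q" by (simp add: norm_mult)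
    have "continuous_on UNIV (\<lambda>u. \<bar>u\<bar> powr \<beta> * cmod (cf u))"
      using \<beta> by (intro continuous_on_mult continuous_on_powr' continuous_on_norm cf_continuous continuous_intros) auto
    from continuous_AE_le_imp_le[OF this ae] show ?thesis by (rule that)
  qed
  obtain I where I: "finite I" "card I = M" "I \<subseteq> {i. a i \<noteq> 0}"
  proof (cases "infinite {i. a i \<noteq> 0}")
    case True
    from infinite_arbitrarily_large[OF this, of M] show ?thesis using that by blast
  next
    case False
    then have "M \<le> card {i. a i \<noteq> 0}" using assms(14) by blast
    then obtain I where "I \<subseteq> {i. a i \<noteq> 0}" "card I = M" "finite I"
      by (rule obtain_subset_with_card_n)
    then show ?thesis by (intro that)
  qed
  have Ine: "I \<noteq> {}" using I(2) assms(13) by auto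
  note [measurable] = L2_measurable[OF fL2]
  have coef: "L2_inner f h = expectation (\<lambda>\<omega>. h (linear_process a \<epsilon> 1 \<omega>))" if [measurable]: "h \<in> borel_measurable borel" for h
    using distributed_integral[OF dens[of 1], of h] f_nn by (simp add: L2_inner_def)
  have meas: "dilate g j k \<in> borel_measurable borel" if "compactly_supported g" "twice_continuously_differentiable g" for g j k
    using C2_compact_support_facts(1)[OF compactly_supported_dilate[OF that(1)] twice_continuously_differentiable_dilate[OF that(2)]]
    by measurable
  note \<phi>C = assms(18,20) and \<psi>C = assms(19,21)
  have wt: "(\<integral>\<^sup>+u. ennreal ((cmod (cf (a 0 * u)))\<^sup>2 * \<bar>u\<bar> powr (2 * \<gamma>)) \<partial>lborel) < \<infinity>"
    by (rule cf_weight_finite[OF assms(10,15,3) int Q])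
  obtain C\<phi> where C\<phi>: "C\<phi> > 0" "\<And>j n K. 0 \<le> j \<Longrightarrow> 1 \<le> n \<Longrightarrow> finite K \<Longrightarrow>
    (\<integral>\<^sup>+\<omega>. ennreal (\<Sum>k\<in>K. (empirical_coeff \<phi> n (\<lambda>i. linear_process a \<epsilon> (int i) \<omega>) j k
        - expectation (\<lambda>\<omega>'. dilate \<phi> j k (linear_process a \<epsilon> 1 \<omega>')))\<^sup>2) \<partial>P)
      \<le> ennreal (C\<phi> * 2 powr real_of_int j / real n)"
    by (rule exE[OF empirical_coefficient_variance[OF sm assms(12) var c wt \<phi>C]]) (elim conjE, rule that, assumption, simp only: mp)
  obtain C\<psi> where C\<psi>: "C\<psi> > 0" "\<And>j n K. 0 \<le> j \<Longrightarrow> 1 \<le> n \<Longrightarrow> finite K \<Longrightarrow>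
    (\<integral>\<^sup>+\<omega>. ennreal (\<Sum>k\<in>K. (empirical_coeff \<psi> n (\<lambda>i. linear_process a \<epsilon> (int i) \<omega>) j k
        - expectation (\<lambda>\<omega>'. dilate \<psi> j k (linear_process a \<epsilon> 1 \<omega>')))\<^sup>2) \<partial>P)
      \<le> ennreal (C\<psi> * 2 powr real_of_int j / real n)"
    by (rule exE[OF empirical_coefficient_variance[OF sm assms(12) var c wt \<psi>C]]) (elim conjE, rule that, assumption, simp only: mp)
  have sob: "(\<integral>\<^sup>+u. ennreal (\<bar>u\<bar> powr (2 * s) * (cmod (CLINT \<omega>|P. iexp (- (u * linear_process a \<epsilon> 1 \<omega>))))\<^sup>2) \<partial>lborel) < \<infinity>"
  proof -
    have "a i \<noteq> 0" if "i \<in> I" for i using I(3) that by blast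
    from linear_process_sobolev[OF \<beta> I(1) Ine this int Q sm[of 1]] show ?thesis
      unfolding I(2) s_def .
  qed
  have s_le: "s \<le> real (nat \<lceil>real M * \<beta>\<rceil>)"
    unfolding s_def by (rule real_nat_ceiling_ge)
  obtain Cb where Cb: "Cb > 0" "\<And>j K. finite K \<Longrightarrow>
      (\<Sum>k\<in>K. (expectation (\<lambda>\<omega>. dilate \<psi> j k (linear_process a \<epsilon> 1 \<omega>)))\<^sup>2) \<le> Cb * 2 powr (- 2 * real_of_int j * s)"
    using wavelet_coefficient_decay[OF \<psi>C assms(22) less_imp_le[OF s] s_le linear_process_measurable sob] by blast
  obtain D where D: "D \<ge> 0" "\<And>N (J :: int) v. 0 \<le> v \<Longrightarrow>
    (\<Sum>j=0..int N. if j \<le> J then C\<psi> * 2 powr real_of_int j * v else Cb * 2 powr (- 2 * real_of_int j * s))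
      \<le> D * (2 powr real_of_int J * v + 2 powr (- 2 * real_of_int J * s))"
    using level_sum_bound[OF s less_imp_le[OF C\<psi>(1)] less_imp_le[OF Cb(1)]] by blast
  have main: "(\<integral>\<^sup>+\<omega>. (\<integral>\<^sup>+x. ennreal ((wavelet_estimator \<phi> \<psi> \<lceil>log 2 (real n) / (2 * s + 1)\<rceil> n
                 (\<lambda>i. linear_process a \<epsilon> (int i) \<omega>) x - f x)\<^sup>2) \<partial>lborel) \<partial>P)
      \<le> ennreal ((2 * C\<phi> + 3 * D) * real n powr (- (2 * s) / (2 * s + 1)))" if n: "1 \<le> n" for n
  proof -
    define J where "J = \<lceil>log 2 (real n) / (2 * s + 1)\<rceil>"
    define r where "r = real n powr (- (2 * s) / (2 * s + 1))"
    have J: "0 \<le> J" "2 powr real_of_int J / real n \<le> 2 * r" "2 powr (- 2 * real_of_int J * s) \<le> r"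
      using truncation_level_bounds[OF n less_imp_le[OF s]] by (simp_all add: J_def r_def)
    define X where "X \<omega> i = linear_process a \<epsilon> (int i) \<omega>" for \<omega> i
    define E where "E \<omega> i = (estimator_coeff \<phi> \<psi> J n (X \<omega>) i - L2_inner f (wavelet_family \<phi> \<psi> i))\<^sup>2" for \<omega> i
    let ?K = "\<lambda>N. {- int N..int N}"
    have ec_meas: "(\<lambda>\<omega>. empirical_coeff g n (X \<omega>) j k) \<in> borel_measurable P"
      if "compactly_supported g" "twice_continuously_differentiable g" for g j k
      unfolding empirical_coeff_def X_def using meas[OF that] by measurable
    have [measurable]: "(\<lambda>\<omega>. E \<omega> i) \<in> borel_measurable P" for i
    proof -
      note [measurable] = ec_meas[OF \<phi>C] ec_meas[OF \<psi>C]
      show ?thesis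
      proof (cases i)
        case (Inl k)
        show ?thesis unfolding E_def estimator_coeff_def Inl sum.case by measurable
      next
        case (Inr p)
        obtain j k where p: "p = (j, k)" by (cases p)
        show ?thesis unfolding E_def estimator_coeff_def Inr p sum.case prod.case
          by (cases "0 \<le> j \<and> j \<le> J") (simp_all only: if_True if_False, measurable)
      qed
    qed
    have E0: "0 \<le> E \<omega> i" for \<omega> i by (simp add: E_def)
    have EN: "(\<integral>\<^sup>+\<omega>. ennreal (\<Sum>i\<in>truncated_index N. E \<omega> i) \<partial>P) \<le> ennreal ((2 * C\<phi> + 3 * D) * r)" for N
    proof -
      let ?L = "\<lambda>j. if j \<le> J then C\<psi> * 2 powr real_of_int j * (1 / real n) else Cb * 2 powr (- 2 * real_of_int j * s)"
      have lvl0: "(\<integral>\<^sup>+\<omega>. ennreal (\<Sum>k\<in>?K N. E \<omega> (Inl k)) \<partial>P) \<le> ennreal (C\<phi> * (1 / real n))"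
        using C\<phi>(2)[OF order_refl n, of "?K N"]
        by (simp add: E_def estimator_coeff_def X_def[abs_def] coef[OF meas[OF \<phi>C]])
      have lvl: "(\<integral>\<^sup>+\<omega>. ennreal (\<Sum>k\<in>?K N. E \<omega> (Inr (j, k))) \<partial>P)
          \<le> ennreal (?L j)"
        if j: "j \<in> {0..int N}" for j
      proof (cases "j \<le> J")
        case True
        then show ?thesis using j C\<psi>(2)[OF _ n, of j "?K N"]
          by (simp add: E_def estimator_coeff_def X_def[abs_def] coef[OF meas[OF \<psi>C]])
      next
        case False
        have "(\<integral>\<^sup>+\<omega>. ennreal (\<Sum>k\<in>?K N. E \<omega> (Inr (j, k))) \<partial>P)
          = ennreal (\<Sum>k\<in>?K N. (expectation (\<lambda>\<omega>. dilate \<psi> j k (linear_process a \<epsilon> 1 \<omega>)))\<^sup>2)"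
          using False by (simp add: E_def estimator_coeff_def coef[OF meas[OF \<psi>C]] emeasure_space_1)
        also have "\<dots> \<le> ennreal (Cb * 2 powr (- 2 * real_of_int j * s))"
          by (intro ennreal_leI Cb) simp
        finally show ?thesis using False by simp
      qed
      have "(\<integral>\<^sup>+\<omega>. ennreal (\<Sum>i\<in>truncated_index N. E \<omega> i) \<partial>P)
        = (\<integral>\<^sup>+\<omega>. ennreal (\<Sum>k\<in>?K N. E \<omega> (Inl k)) + (\<Sum>j=0..int N. ennreal (\<Sum>k\<in>?K N. E \<omega> (Inr (j, k)))) \<partial>P)"
        unfolding sum_truncated_index
        by (intro nn_integral_cong) (simp add: sum_nonneg E0)
      also have "\<dots> = (\<integral>\<^sup>+\<omega>. ennreal (\<Sum>k\<in>?K N. E \<omega> (Inl k)) \<partial>P)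
          + (\<Sum>j=0..int N. \<integral>\<^sup>+\<omega>. ennreal (\<Sum>k\<in>?K N. E \<omega> (Inr (j, k))) \<partial>P)"
        by (simp add: nn_integral_add nn_integral_sum)
      also have "\<dots> \<le> ennreal (C\<phi> * (1 / real n)) + (\<Sum>j=0..int N. ennreal (?L j))"
        by (intro add_mono sum_mono lvl0 lvl)
      also have "\<dots> = ennreal (C\<phi> * (1 / real n) + (\<Sum>j=0..int N. ?L j))"
      proof -
        have nn: "0 \<le> (?L j)" for j
          using C\<psi>(1) Cb(1) by simp
        have "0 \<le> C\<phi> * (1 / real n)" using C\<phi>(1) by simp
        then show ?thesis by (simp only: sum_ennreal[OF nn] ennreal_plus[OF _ sum_nonneg[OF nn]])
      qed
      also have "\<dots> \<le> ennreal ((2 * C\<phi> + 3 * D) * r)"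
      proof (rule ennreal_leI)
        have "1 \<le> 2 powr real_of_int J" using J(1) by (simp add: ge_one_powr_ge_zero)
        then have "1 / real n \<le> 2 powr real_of_int J / real n" by (intro divide_right_mono) auto
        then have "C\<phi> * (1 / real n) \<le> C\<phi> * (2 * r)"
          using J(2) C\<phi>(1) by (intro mult_left_mono) auto
        moreover have "D * (2 powr real_of_int J * (1 / real n) + 2 powr (- 2 * real_of_int J * s)) \<le> D * (2 * r + r)"
          using J(2,3) D(1) by (intro mult_left_mono add_mono) auto
        moreover have "(\<Sum>j=0..int N. ?L j)
            \<le> D * (2 powr real_of_int J * (1 / real n) + 2 powr (- 2 * real_of_int J * s))"
          by (rule D(2)) simp
        moreover have "C\<phi> * (2 * r) + D * (2 * r + r) = (2 * C\<phi> + 3 * D) * r" by (simp add: algebra_simps)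
        ultimately show "C\<phi> * (1 / real n) + (\<Sum>j=0..int N. ?L j) \<le> (2 * C\<phi> + 3 * D) * r"
          by linarith
      qed
      finally show ?thesis .
    qed
    have "(\<integral>\<^sup>+\<omega>. (\<integral>\<^sup>+x. ennreal ((wavelet_estimator \<phi> \<psi> J n (X \<omega>) x - f x)\<^sup>2) \<partial>lborel) \<partial>P)
      \<le> (\<integral>\<^sup>+\<omega>. (SUP N. ennreal (\<Sum>i\<in>truncated_index N. E \<omega> i)) \<partial>P)"
      unfolding E_def by (intro nn_integral_mono wavelet_estimator_error_bound assms(9) fL2 \<phi>C(1) \<psi>C(1))
    also have "\<dots> = (SUP N. \<integral>\<^sup>+\<omega>. ennreal (\<Sum>i\<in>truncated_index N. E \<omega> i) \<partial>P)"
    proof (rule nn_integral_monotone_convergence_SUP)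
      show "incseq (\<lambda>N \<omega>. ennreal (\<Sum>i\<in>truncated_index N. E \<omega> i))"
        by (intro incseq_SucI le_funI ennreal_leI sum_mono2 E0) (auto simp: truncated_index_def)
    qed measurable
    also have "\<dots> \<le> ennreal ((2 * C\<phi> + 3 * D) * r)"
      by (intro SUP_least EN)
    finally show ?thesis by (simp only: J_def X_def[abs_def] r_def)
  qed
  have e: "2 * real M * \<beta> = 2 * s" by (simp add: s_def)
  show ?thesis unfolding e using main by blast
qed

end
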